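(* Assume the following. (1) The rows of $\mathbf{Z}$ are i.i.d. real or complex random vectors, either standard normal distributed, or distributed as $\sqrt{M}\,\mathbf{u}$ where $\mathbf{u}$ is uniformly (Haar) distributed on the unit sphere in $\mathbb{R}^M$ or $\mathbb{C}^M$. (2) $\mathbf{C}_N=\mathrm{diag}(c_1,\dots,c_N)$ with $c_n\ge0$ (the $c_n$ may depend on $N$), and there exist constants $C>0$, $\kappa>0$ such that $\frac1N\mathrm{tr}\,\mathbf{C}_N^2\le C$ and $\|\mathbf{C}_N\|\le\kappa\log M$. (3) The spectral density $f\in L^1(-\pi,\pi)$ of $\mathbf{R}_M$ is positive and is bounded on $[-\pi,\pi]\setminus(-\delta,\delta)$ for every $\delta>0$. (4) $\operatorname{ess\,inf}_{\theta\in(-\pi,\pi)}f(\theta)>0$. (5) $f$ is even and $f(x)=L(|x|^{-1})/|x|^a$ for $x\in[-\pi,\pi]\setminus\{0\}$, where $a\in(0,1)$ and $L$, defined on $[\pi^{-1},\infty)$, is slowly varying at $\infty$. Suppose that $\xi_N=N^{-1}\mathrm{tr}\,\mathbf{C}_N=1$. Then as $M\to\infty$ with $N=N(M)\gg\log^3M$, almost surely $$\left\|(\mathbf{R}_M^b)^{-1/2}\hat{\mathbf{R}}_M^b(\mathbf{R}_M^b)^{-1/2}-\mathbf{I}\right\|\to0,$$ but $$\left\|\mathbf{R}_M^{-1/2}\hat{\mathbf{R}}_M^b\mathbf{R}_M^{-1/2}-\mathbf{I}\right\|\not\to0.$$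
   Context: For integers $M,N\ge1$, let $\mathbf{X}=\mathbf{C}_N^{1/2}\mathbf{Z}\mathbf{R}_M^{1/2}$, where $\mathbf{C}_N$ is an $N\times N$ deterministic matrix, $\mathbf{Z}$ is an $N\times M$ random matrix (all random matrices being defined on a common probability space), and $\mathbf{R}_M=(r_{i-j})_{i,j=1}^M$ is the Toeplitz matrix with spectral density $f$, i.e. $r_k=\frac{1}{2\pi}\int_{-\pi}^{\pi}f(x)e^{-\mathbf{i}kx}\,dx$. Let $S_{i,j}$ denote the entries of the $M\times M$ matrix $\frac1N\mathbf{X}^*\mathbf{X}$, and define $$\hat r_k^b=\frac{1}{M}\sum_i S_{i+k,i}\,\mathbf{1}_{\{1\le i,\ i+k\le M\}}\quad(|k|\le M-1),$$ where the sum is over $i$ with both $1\le i\le M$ and $1\le i+k\le M$, and $\hat{\mathbf{R}}_M^b=(\hat r^b_{i-j})_{1\le i,j\le M}$. Let $\mathbf{R}_M^b=\left(\left(1-\frac{|i-j|}{M}\right)r_{i-j}\right)_{i,j=1}^M$ (which equals $\mathbb{E}\hat{\mathbf{R}}_M^b$ when $\xi_N=1$). $\|\cdot\|$ is the operator (spectral) norm. $a_M\gg b_M$ means $a_M/b_M\to\infty$. *)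

theory Defs
  imports "HOL-Probability.Probability" "Jordan_Normal_Form.Schur_Decomposition"
begin

text \<open>Matrices are complex matrices with row and column indices starting at 0. Real matrices and
  vectors are regarded as complex ones with entries in \<open>\<real>\<close>.\<close>

section \<open>Matrix notions\<close>

definition mat_trace :: "complex mat \<Rightarrow> complex" where
  "mat_trace A = (\<Sum>i<dim_row A. A $$ (i, i))"

definition euclid_norm :: "complex vec \<Rightarrow> real" where
  "euclid_norm v = L2_set (\<lambda>i. cmod (vec_index v i)) {..<dim_vec v}"

definition spectral_norm :: "complex mat \<Rightarrow> real" where
  "spectral_norm A =
     (SUP v \<in> {v \<in> carrier_vec (dim_col A). euclid_norm v \<le> 1}. euclid_norm (A *\<^sub>v v))"

definition pos_semidef :: "nat \<Rightarrow> complex mat \<Rightarrow> bool" where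
  "pos_semidef n A \<longleftrightarrow> A \<in> carrier_mat n n \<and> mat_adjoint A = A \<and>
     (\<forall>v \<in> carrier_vec n. 0 \<le> Re ((A *\<^sub>v v) \<bullet>c v))"

text \<open>The square root is meaningful for positive semidefinite, the inverse square root for positive
  definite arguments only.\<close>

definition psd_sqrt :: "complex mat \<Rightarrow> complex mat" where
  "psd_sqrt A = (THE B. pos_semidef (dim_row A) B \<and> B * B = A)"

definition inv_sqrt :: "complex mat \<Rightarrow> complex mat" where
  "inv_sqrt A = the (mat_inverse (psd_sqrt A))"

definition toeplitz :: "nat \<Rightarrow> (int \<Rightarrow> complex) \<Rightarrow> complex mat" where
  "toeplitz M r = Matrix.mat M M (\<lambda>(i, j). r (int i - int j))"


section \<open>Spectral density\<close>

definition fourier_coeff :: "(real \<Rightarrow> real) \<Rightarrow> int \<Rightarrow> complex" where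
  "fourier_coeff f k =
     (LINT x:{-pi..pi}|lebesgue. of_real (f x) * exp (- \<i> * of_int k * of_real x)) / of_real (2 * pi)"

definition essinf :: "'a measure \<Rightarrow> ('a \<Rightarrow> ereal) \<Rightarrow> ereal" where
  "essinf M g = - esssup M (\<lambda>x. - g x)"

definition slowly_varying :: "real \<Rightarrow> (real \<Rightarrow> real) \<Rightarrow> bool" where
  "slowly_varying x0 L \<longleftrightarrow> L \<in> borel_measurable (lebesgue_on {x0..}) \<and> (\<forall>t\<ge>x0. 0 < L t) \<and>
     (\<forall>s>0. ((\<lambda>t. L (s * t) / L t) \<longlongrightarrow> 1) at_top)"


section \<open>The estimator\<close>

definition biased_mat :: "nat \<Rightarrow> (int \<Rightarrow> complex) \<Rightarrow> complex mat" where
  "biased_mat M r = toeplitz M (\<lambda>k. of_real (1 - real_of_int \<bar>k\<bar> / real M) * r k)"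

definition data_mat :: "complex mat \<Rightarrow> complex mat \<Rightarrow> complex mat \<Rightarrow> complex mat" where
  "data_mat C Z R = psd_sqrt C * Z * psd_sqrt R"

definition sample_cov :: "complex mat \<Rightarrow> complex mat" where
  "sample_cov X = (1 / of_nat (dim_row X)) \<cdot>\<^sub>m (mat_adjoint X * X)"

definition biased_autocov :: "nat \<Rightarrow> complex mat \<Rightarrow> int \<Rightarrow> complex" where
  "biased_autocov M S k =
     (\<Sum>i | i < M \<and> 0 \<le> int i + k \<and> int i + k < int M. S $$ (nat (int i + k), i)) / of_nat M"

definition biased_estimator :: "complex mat \<Rightarrow> complex mat" where
  "biased_estimator X = toeplitz (dim_col X) (biased_autocov (dim_col X) (sample_cov X))"


section \<open>Laws of the rows\<close>

text \<open>A random vector with \<open>M\<close> complex coordinates is a random variable with values in the product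
  space \<open>cvec_space M\<close>.\<close>

definition cvec_space :: "nat \<Rightarrow> (nat \<Rightarrow> complex) measure" where
  "cvec_space M = PiM {..<M} (\<lambda>_. borel)"

definition std_normal :: "real measure" where
  "std_normal = density lborel (\<lambda>x. ennreal (std_normal_density x))"

text \<open>Normalised such that a complex standard normal \<open>z\<close> has \<open>E |z|\<^sup>2 = 1\<close>.\<close>

definition complex_std_normal :: "complex measure" where
  "complex_std_normal = distr (std_normal \<Otimes>\<^sub>M std_normal) borel (\<lambda>(x, y). Complex x y / of_real (sqrt 2))"

definition normal_real_vec :: "nat \<Rightarrow> (nat \<Rightarrow> complex) measure" where
  "normal_real_vec M = PiM {..<M} (\<lambda>_. distr std_normal borel complex_of_real)"

definition normal_complex_vec :: "nat \<Rightarrow> (nat \<Rightarrow> complex) measure" where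
  "normal_complex_vec M = PiM {..<M} (\<lambda>_. complex_std_normal)"

definition unitary_group :: "nat \<Rightarrow> complex mat set" where
  "unitary_group M = {U \<in> carrier_mat M M. mat_adjoint U * U = 1\<^sub>m M}"

definition orthogonal_group :: "nat \<Rightarrow> complex mat set" where
  "orthogonal_group M = {U \<in> unitary_group M. \<forall>i<M. \<forall>j<M. U $$ (i, j) \<in> \<real>}"

definition complex_sphere :: "nat \<Rightarrow> (nat \<Rightarrow> complex) set" where
  "complex_sphere M = {x \<in> space (cvec_space M). (\<Sum>j<M. (cmod (x j))\<^sup>2) = 1}"

definition real_sphere :: "nat \<Rightarrow> (nat \<Rightarrow> complex) set" where
  "real_sphere M = {x \<in> complex_sphere M. \<forall>j<M. x j \<in> \<real>}"

definition mat_act :: "nat \<Rightarrow> complex mat \<Rightarrow> (nat \<Rightarrow> complex) \<Rightarrow> (nat \<Rightarrow> complex)" where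
  "mat_act M U x = (\<lambda>i\<in>{..<M}. \<Sum>j<M. U $$ (i, j) * x j)"

text \<open>The Haar (uniform) law on a sphere \<open>S\<close> with transitive isometry group \<open>G\<close>: the unique
  \<open>G\<close>-invariant probability measure carried by \<open>S\<close>.\<close>

definition haar_on_sphere ::
    "nat \<Rightarrow> complex mat set \<Rightarrow> (nat \<Rightarrow> complex) set \<Rightarrow> (nat \<Rightarrow> complex) measure \<Rightarrow> bool" where
  "haar_on_sphere M G S \<mu> \<longleftrightarrow> prob_space \<mu> \<and> sets \<mu> = sets (cvec_space M) \<and> (AE x in \<mu>. x \<in> S) \<and>
     (\<forall>U \<in> G. distr \<mu> (cvec_space M) (mat_act M U) = \<mu>)"

definition scale_law :: "nat \<Rightarrow> real \<Rightarrow> (nat \<Rightarrow> complex) measure \<Rightarrow> (nat \<Rightarrow> complex) measure" where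
  "scale_law M s \<mu> = distr \<mu> (cvec_space M) (\<lambda>x. \<lambda>j\<in>{..<M}. of_real s * x j)"

definition row_laws :: "nat \<Rightarrow> (nat \<Rightarrow> complex) measure set" where
  "row_laws M = {normal_real_vec M, normal_complex_vec M}
     \<union> {scale_law M (sqrt (real M)) \<mu> | \<mu>. haar_on_sphere M (orthogonal_group M) (real_sphere M) \<mu>}
     \<union> {scale_law M (sqrt (real M)) \<mu> | \<mu>. haar_on_sphere M (unitary_group M) (complex_sphere M) \<mu>}"

definition row_var :: "nat \<Rightarrow> ('w \<Rightarrow> complex mat) \<Rightarrow> nat \<Rightarrow> 'w \<Rightarrow> nat \<Rightarrow> complex" where
  "row_var M Z n \<omega> = (\<lambda>j\<in>{..<M}. Z \<omega> $$ (n, j))"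

definition iid_rows ::
    "'w measure \<Rightarrow> nat \<Rightarrow> nat \<Rightarrow> ('w \<Rightarrow> complex mat) \<Rightarrow> (nat \<Rightarrow> complex) measure \<Rightarrow> bool" where
  "iid_rows P N M Z \<mu> \<longleftrightarrow> (\<forall>\<omega> \<in> space P. Z \<omega> \<in> carrier_mat N M) \<and>
     prob_space.indep_vars P (\<lambda>_. cvec_space M) (row_var M Z) {..<N} \<and>
     (\<forall>n<N. distr P (cvec_space M) (row_var M Z n) = \<mu>)"

end

theory Submission
  imports Defs "HOL-Real_Asymp.Real_Asymp"
begin

text \<open>
  Write \<open>e\<^sub>\<theta>\<close> for the vector with entries \<open>exp (i j \<theta>)\<close>. The matrix \<open>R\<^sup>b\<close> and the estimator \<open>R'\<close> arise from \<open>R\<close> and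
  from the sample covariance \<open>S\<close> by the same linear operation, the replacement of each diagonal by its
  sum divided by \<open>M\<close>. The symbol of the resulting Toeplitz matrix at \<open>\<theta>\<close> is \<open>\<langle>S e\<^sub>\<theta>, e\<^sub>\<theta>\<rangle> / M\<close>. Since all
  exponents that occur have modulus below \<open>2M\<close>, the quadratic form of the Toeplitz matrix is a
  nonnegative combination of the values of the symbol at \<open>2M\<close> equidistant points
  (\<open>quad_form_toeplitz_average\<close>). Hence if \<open>\<bar>\<langle>S e, e\<rangle> - \<langle>R e, e\<rangle>\<bar> \<le> \<epsilon> \<langle>R e, e\<rangle>\<close> at these \<open>2M\<close> vectors \<open>e\<close>, then
  \<open>\<bar>\<langle>R' v, v\<rangle> - \<langle>R\<^sup>b v, v\<rangle>\<bar> \<le> \<epsilon> \<langle>R\<^sup>b v, v\<rangle>\<close> at all \<open>v\<close>, and polarization turns this into a bound for the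
  norm in the first claim.

  With \<open>y = R\<^sup>1\<^sup>/\<^sup>2 e\<close> one has \<open>\<langle>S e, e\<rangle> = N\<^sup>-\<^sup>1 \<Sum>\<^sub>n c\<^sub>n \<bar>(Z y)\<^sub>n\<bar>\<^sup>2\<close> and \<open>\<parallel>y\<parallel>\<^sup>2 = \<langle>R e, e\<rangle>\<close>: up to normalization, a
  weighted mean of independent variables of mean 1. They have a common exponential moment for all
  admitted laws of the rows (\<open>row_laws_isotropic\<close>): for Gaussian rows by decoupling the square of the
  linear form with an independent Gaussian variable, for spherical rows by comparison with Gaussian
  ones. Chernoff's bound with exponent of order \<open>N / ln M\<close>, as the weights allow, gives failure
  probabilities smaller than any power of \<open>M\<close>; these survive the union over \<open>2M\<close> points and are
  summable, so that the Borel--Cantelli lemma applies.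

  For the second claim it then suffices to see that \<open>\<langle>R\<^sup>b v, v\<rangle> / \<langle>R v, v\<rangle>\<close> does not tend to 1 for the constant
  vector \<open>v\<close> (\<open>biased_form_not_close\<close>). Let \<open>T\<^sub>M = \<langle>R v, v\<rangle> = \<Sum>\<^sub>k (M - \<bar>k\<bar>) r\<^sub>k\<close> and
  \<open>U\<^sub>M = M \<langle>R\<^sup>b v, v\<rangle> = \<Sum>\<^sub>k (M - \<bar>k\<bar>)\<^sup>2 r\<^sub>k\<close>. Then \<open>U\<^sub>M\<^sub>+\<^sub>1 = U\<^sub>M + T\<^sub>M + T\<^sub>M\<^sub>+\<^sub>1\<close>. If \<open>U\<^sub>M / M\<close> were asymptotic to \<open>T\<^sub>M\<close>, this
  recurrence would force \<open>T\<^sub>M\<close> to grow like \<open>M\<close>, up to factors smaller than any power. But the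
  singularity of \<open>f\<close> at 0 makes \<open>T\<^sub>M\<close> at least of order \<open>M\<^sup>1\<^sup>+\<^sup>a L(M)\<close>.
\<close>

unbundle no vec_syntax

section \<open>Hermitian matrices\<close>

lemma mat_adjoint_carrier [simp]: "A \<in> carrier_mat n m \<Longrightarrow> mat_adjoint A \<in> carrier_mat m n"
  by (auto simp: mat_adjoint_def)

lemma mat_adjoint_dim [simp]:
  "dim_row (mat_adjoint A) = dim_col A" "dim_col (mat_adjoint A) = dim_row A"
  by (auto simp: mat_adjoint_def)

lemma mat_adjoint_index [simp]:
  "A \<in> carrier_mat n m \<Longrightarrow> i < m \<Longrightarrow> j < n \<Longrightarrow> mat_adjoint A $$ (i, j) = cnj (A $$ (j, i))"
  by (auto simp: mat_adjoint_def mat_of_rows_def)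

lemma hermitianI:
  assumes "A \<in> carrier_mat n n" and "\<And>i j. i < n \<Longrightarrow> j < n \<Longrightarrow> cnj (A $$ (j, i)) = A $$ (i, j)"
  shows "mat_adjoint A = A"
  by (rule eq_matI) (use assms mat_adjoint_index[OF assms(1)] in auto)

lemma cscalar_prod_sum:
  "w \<in> carrier_vec n \<Longrightarrow> v \<bullet>c w = (\<Sum>i<n. v $ i * cnj (w $ i))" for v w :: "complex vec"
  by (auto simp: scalar_prod_def lessThan_atLeast0)

lemma mult_mat_vec_sum:
  "A \<in> carrier_mat n m \<Longrightarrow> v \<in> carrier_vec m \<Longrightarrow> i < n \<Longrightarrow> (A *\<^sub>v v) $ i = (\<Sum>j<m. A $$ (i, j) * v $ j)"
  for v :: "complex vec"
  by (auto simp: scalar_prod_def lessThan_atLeast0)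

lemma mult_mat_sum:
  "A \<in> carrier_mat n m \<Longrightarrow> B \<in> carrier_mat m k \<Longrightarrow> i < n \<Longrightarrow> j < k \<Longrightarrow>
    (A * B) $$ (i, j) = (\<Sum>l<m. A $$ (i, l) * B $$ (l, j))" for A :: "complex mat"
  by (auto simp: scalar_prod_def lessThan_atLeast0)

lemma mat_vec_carrier: "A \<in> carrier_mat n m \<Longrightarrow> v \<in> carrier_vec m \<Longrightarrow> A *\<^sub>v v \<in> carrier_vec n"
  by auto

lemma adjoint_cscalar_prod:
  fixes A :: "complex mat"
  assumes A: "A \<in> carrier_mat n m" and v: "v \<in> carrier_vec m" and w: "w \<in> carrier_vec n"
  shows "(A *\<^sub>v v) \<bullet>c w = v \<bullet>c (mat_adjoint A *\<^sub>v w)"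
proof -
  have A': "mat_adjoint A \<in> carrier_mat m n" using A by simp
  have "(A *\<^sub>v v) \<bullet>c w = (\<Sum>i<n. \<Sum>j<m. A $$ (i, j) * v $ j * cnj (w $ i))"
    unfolding cscalar_prod_sum[OF w] by (simp add: mult_mat_vec_sum[OF A v] sum_distrib_right)
  also have "\<dots> = (\<Sum>j<m. \<Sum>i<n. A $$ (i, j) * v $ j * cnj (w $ i))"
    by (rule sum.swap)
  also have "\<dots> = v \<bullet>c (mat_adjoint A *\<^sub>v w)"
    unfolding cscalar_prod_sum[OF mat_vec_carrier[OF A' w]]
    by (intro sum.cong refl) (simp add: mult_mat_vec_sum[OF A' w] mat_adjoint_index[OF A] sum_distrib_left mult_ac)
  finally show ?thesis .
qed

lemma hermitian_cscalar_prod: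
  fixes A :: "complex mat"
  assumes "A \<in> carrier_mat n n" "mat_adjoint A = A" "v \<in> carrier_vec n" "w \<in> carrier_vec n"
  shows "(A *\<^sub>v v) \<bullet>c w = v \<bullet>c (A *\<^sub>v w)"
  using adjoint_cscalar_prod[of A n n v w] assms by simp

lemma cnj_cscalar_prod:
  fixes v w :: "complex vec"
  assumes "v \<in> carrier_vec n" "w \<in> carrier_vec n"
  shows "cnj (v \<bullet>c w) = w \<bullet>c v"
  unfolding cscalar_prod_sum[OF assms(1)] cscalar_prod_sum[OF assms(2)] by (simp add: mult_ac)

lemma hermitian_quadratic_form_real:
  fixes A :: "complex mat"
  assumes "A \<in> carrier_mat n n" "mat_adjoint A = A" "v \<in> carrier_vec n"
  shows "(A *\<^sub>v v) \<bullet>c v = of_real (Re ((A *\<^sub>v v) \<bullet>c v))"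
proof -
  have "cnj ((A *\<^sub>v v) \<bullet>c v) = v \<bullet>c (A *\<^sub>v v)"
    by (rule cnj_cscalar_prod[of _ n]) (use assms in auto)
  also have "\<dots> = (A *\<^sub>v v) \<bullet>c v" using hermitian_cscalar_prod[of A n v v] assms by simp
  finally show ?thesis by (simp add: complex_eq_iff)
qed

lemma cscalar_prod_self:
  "v \<in> carrier_vec n \<Longrightarrow> v \<bullet>c v = of_real (\<Sum>i<n. (cmod (v $ i))\<^sup>2)" for v :: "complex vec"
  by (simp add: cscalar_prod_sum complex_norm_square del: of_real_power)

lemma euclid_norm_sq: "v \<in> carrier_vec n \<Longrightarrow> of_real ((euclid_norm v)\<^sup>2) = v \<bullet>c v"
  by (simp add: cscalar_prod_self euclid_norm_def L2_set_def sum_nonneg del: of_real_power)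

lemma euclid_norm_sq_sum: "v \<in> carrier_vec n \<Longrightarrow> (euclid_norm v)\<^sup>2 = (\<Sum>i<n. (cmod (v $ i))\<^sup>2)"
  by (simp add: euclid_norm_def L2_set_def sum_nonneg)

lemma euclid_norm_nonneg [simp]: "0 \<le> euclid_norm v"
  by (simp add: euclid_norm_def)

text \<open>The trace of a square does not change under similarity and is the sum of the squared
  eigenvalues for a triangular matrix. For a Hermitian matrix it is the sum of the squared moduli of
  the entries. So a Hermitian matrix without nonzero eigenvalues vanishes; existence and uniqueness
  of square roots both rest on this.\<close>

lemma hermitian_nonzero_eigenvector:
  fixes H :: "complex mat"
  assumes H: "H \<in> carrier_mat n n" and herm: "mat_adjoint H = H" and nz: "H \<noteq> 0\<^sub>m n n"
  shows "\<exists>u \<mu>. u \<in> carrier_vec n \<and> u \<noteq> 0\<^sub>v n \<and> \<mu> \<noteq> 0 \<and> H *\<^sub>v u = \<mu> \<cdot>\<^sub>v u"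
proof -
  obtain as where as: "char_poly H = (\<Prod>a\<leftarrow>as. [:- a, 1:])"
    using char_poly_factorized[OF H] by blast
  obtain B where B: "B \<in> carrier_mat n n" "upper_triangular B" "similar_mat H B"
    using schur_decomposition_exists[OF H as] by blast
  obtain P Q where "similar_mat_wit H B P Q" using B(3) by (auto simp: similar_mat_def)
  note PQ = similar_mat_witD2[OF H this]
  have P: "P \<in> carrier_mat n n" and Q: "Q \<in> carrier_mat n n" using PQ by auto
  have trace_comm: "(\<Sum>i<n. (X * Y) $$ (i, i)) = (\<Sum>i<n. (Y * X) $$ (i, i))"
    if X: "X \<in> carrier_mat n n" and Y: "Y \<in> carrier_mat n n" for X Y :: "complex mat"
    using sum.swap[of "\<lambda>i j. X $$ (i, j) * Y $$ (j, i)" "{..<n}" "{..<n}"]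
    by (simp add: mult_mat_sum[OF X Y] mult_mat_sum[OF Y X] mult_ac)
  have HH: "H * H = P * (B * B * Q)"
  proof -
    have "H * H = (P * B * Q) * (P * B * Q)" using PQ(3) by simp
    also have "\<dots> = P * B * (Q * P) * (B * Q)" using P Q B(1) by (simp add: assoc_mult_mat[of _ n n _ n _ n])
    also have "\<dots> = P * (B * B * Q)" using P Q B(1) PQ(2) by (simp add: assoc_mult_mat[of _ n n _ n _ n])
    finally show ?thesis .
  qed
  have "(\<Sum>i<n. (H * H) $$ (i, i)) = (\<Sum>i<n. (B * B * Q * P) $$ (i, i))"
    unfolding HH by (rule trace_comm) (use P Q B(1) in auto)
  also have "B * B * Q * P = B * B" using P Q B(1) PQ(2) by (simp add: assoc_mult_mat[of _ n n _ n _ n])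
  also have "(\<Sum>i<n. (B * B) $$ (i, i)) = (\<Sum>i<n. (B $$ (i, i))\<^sup>2)"
  proof (intro sum.cong refl)
    fix i assume "i \<in> {..<n}"
    hence i: "i < n" by simp
    have "(\<Sum>l<n. B $$ (i, l) * B $$ (l, i)) = (\<Sum>l<n. if l = i then (B $$ (i, i))\<^sup>2 else 0)"
    proof (intro sum.cong refl)
      fix l assume "l \<in> {..<n}"
      then have "l < n" by simp
      then show "B $$ (i, l) * B $$ (l, i) = (if l = i then (B $$ (i, i))\<^sup>2 else 0)"
        using upper_triangularD[OF B(2), of l i] upper_triangularD[OF B(2), of i l] i B(1)
        by (cases "l = i"; cases "l < i") (auto simp: power2_eq_square)
    qed
    then show "(B * B) $$ (i, i) = (B $$ (i, i))\<^sup>2"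
      unfolding mult_mat_sum[OF B(1) B(1) i i] using i by simp
  qed
  finally have tr: "(\<Sum>i<n. (H * H) $$ (i, i)) = (\<Sum>i<n. (B $$ (i, i))\<^sup>2)" .
  have frob: "(\<Sum>i<n. (H * H) $$ (i, i)) = of_real (\<Sum>i<n. \<Sum>j<n. (cmod (H $$ (i, j)))\<^sup>2)"
  proof -
    have "H $$ (j, i) = cnj (H $$ (i, j))" if "i < n" "j < n" for i j
      using mat_adjoint_index[OF H, of j i] that herm by simp
    then have "H $$ (i, j) * H $$ (j, i) = of_real ((cmod (H $$ (i, j)))\<^sup>2)" if "i < n" "j < n" for i j
      using that by (metis complex_norm_square)
    then show ?thesis by (simp add: mult_mat_sum[OF H H] del: of_real_power)
  qed
  have "\<exists>i<n. B $$ (i, i) \<noteq> 0"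
  proof (rule ccontr)
    assume "\<not> ?thesis"
    then have "(\<Sum>i<n. \<Sum>j<n. (cmod (H $$ (i, j)))\<^sup>2) = 0"
      using tr frob by (metis (no_types, lifting) lessThan_iff of_real_eq_0_iff sum.neutral zero_power2)
    then have "\<forall>i<n. \<forall>j<n. H $$ (i, j) = 0"
      by (simp add: sum_nonneg_eq_0_iff sum_nonneg)
    then show False using nz H by (auto intro!: eq_matI)
  qed
  then obtain i where i: "i < n" "B $$ (i, i) \<noteq> 0" by blast
  have "char_poly H = (\<Prod>a\<leftarrow>diag_mat B. [:- a, 1:])"
    using char_poly_similar[OF B(3)] char_poly_upper_triangular[OF B(1,2)] by simp
  moreover have "B $$ (i, i) \<in> set (diag_mat B)"
    using i B(1) by (auto simp: diag_mat_def)
  ultimately have "poly (char_poly H) (B $$ (i, i)) = 0"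
    by (auto simp: poly_prod_list prod_list_zero_iff)
  then have "eigenvalue H (B $$ (i, i))" using eigenvalue_root_char_poly[OF H] by simp
  then show ?thesis using i(2) H unfolding eigenvalue_def eigenvector_def by auto
qed

section \<open>Square roots\<close>

definition orthonormal_eigenvectors ::
    "complex mat \<Rightarrow> nat \<Rightarrow> nat \<Rightarrow> (nat \<Rightarrow> complex vec) \<Rightarrow> (nat \<Rightarrow> real) \<Rightarrow> bool" where
  "orthonormal_eigenvectors A n k v \<mu> \<longleftrightarrow>
     (\<forall>i<k. v i \<in> carrier_vec n \<and> A *\<^sub>v v i = of_real (\<mu> i) \<cdot>\<^sub>v v i) \<and>
     (\<forall>i<k. \<forall>j<k. v i \<bullet>c v j = (if i = j then 1 else 0))"

text \<open>By Bessel's inequality the squared moduli of the coordinates at any fixed position add up to at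
  most 1; adding over the \<open>n\<close> positions bounds the number of vectors.\<close>

lemma orthonormal_eigenvectors_le_dim:
  assumes "orthonormal_eigenvectors A n k v \<mu>"
  shows "k \<le> n"
proof -
  have v: "v i \<in> carrier_vec n" if "i < k" for i
    using assms that by (auto simp: orthonormal_eigenvectors_def)
  have on: "(\<Sum>p<n. v i $ p * cnj (v j $ p)) = (if i = j then 1 else 0)" if "i < k" "j < k" for i j
    using assms that cscalar_prod_sum[OF v[of j], of "v i"] by (auto simp: orthonormal_eigenvectors_def)
  have le1: "(\<Sum>i<k. (cmod (v i $ p))\<^sup>2) \<le> 1" if p: "p < n" for p
  proof -
    \<comment> \<open>\<open>w\<close> is the projection of the \<open>p\<close>-th unit vector to the span; \<open>s\<close> is its squared norm and its \<open>p\<close>-th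
      coordinate.\<close>
    define s where "s = (\<Sum>i<k. (cmod (v i $ p))\<^sup>2)"
    define w where "w q = (\<Sum>i<k. cnj (v i $ p) * v i $ q)" for q
    have wp: "w p = of_real s"
      unfolding w_def s_def
      by (simp add: complex_norm_square mult.commute del: of_real_power)
    have "of_real (\<Sum>q<n. (cmod (w q))\<^sup>2) = (\<Sum>q<n. w q * cnj (w q))"
      by (simp add: complex_norm_square del: of_real_power)
    also have "\<dots> = (\<Sum>q<n. \<Sum>i<k. \<Sum>j<k. cnj (v i $ p) * v j $ p * (v i $ q * cnj (v j $ q)))"
      by (simp add: w_def sum_product mult_ac)
    also have "\<dots> = (\<Sum>i<k. \<Sum>q<n. \<Sum>j<k. cnj (v i $ p) * v j $ p * (v i $ q * cnj (v j $ q)))"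
      by (rule sum.swap)
    also have "\<dots> = (\<Sum>i<k. \<Sum>j<k. \<Sum>q<n. cnj (v i $ p) * v j $ p * (v i $ q * cnj (v j $ q)))"
      by (intro sum.cong refl sum.swap)
    also have "\<dots> = (\<Sum>i<k. \<Sum>j<k. cnj (v i $ p) * v j $ p * (if i = j then 1 else 0))"
      by (intro sum.cong refl) (simp add: on flip: sum_distrib_left)
    also have "\<dots> = of_real s"
      by (simp add: s_def complex_norm_square mult.commute if_distrib sum.delta del: of_real_power cong: if_cong)
    finally have "(\<Sum>q<n. (cmod (w q))\<^sup>2) = s"
      using of_real_eq_iff by blast
    moreover have "(cmod (w p))\<^sup>2 \<le> (\<Sum>q<n. (cmod (w q))\<^sup>2)"
      using p by (intro member_le_sum) auto
    ultimately have "s\<^sup>2 \<le> s" by (simp add: wp)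
    have "s \<le> 1"
    proof (rule ccontr)
      assume "\<not> s \<le> 1"
      then have "s * 1 < s * s" by (intro mult_strict_left_mono) auto
      with \<open>s\<^sup>2 \<le> s\<close> show False by (simp add: power2_eq_square)
    qed
    then show ?thesis by (simp only: s_def)
  qed
  have one: "(\<Sum>p<n. (cmod (v i $ p))\<^sup>2) = 1" if "i < k" for i
  proof -
    have "of_real (\<Sum>p<n. (cmod (v i $ p))\<^sup>2) = (1::complex)"
      using on[OF that that] by (simp add: complex_norm_square del: of_real_power)
    then show ?thesis by (metis of_real_eq_1_iff)
  qed
  have "real k = (\<Sum>i<k. \<Sum>p<n. (cmod (v i $ p))\<^sup>2)"
    using one by simp
  also have "\<dots> = (\<Sum>p<n. \<Sum>i<k. (cmod (v i $ p))\<^sup>2)" by (rule sum.swap)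
  also have "\<dots> \<le> (\<Sum>p<n. 1)" by (intro sum_mono le1) auto
  finally show ?thesis by simp
qed

text \<open>A maximal orthonormal family of eigenvectors exhausts the matrix: an eigenvector of the
  remainder for a nonzero eigenvalue would be orthogonal to the family and extend it.\<close>

lemma hermitian_spectral_decomposition:
  fixes A :: "complex mat"
  assumes A: "A \<in> carrier_mat n n" and herm: "mat_adjoint A = A"
  obtains k v \<mu> where "orthonormal_eigenvectors A n k v \<mu>"
    "\<And>p q. p < n \<Longrightarrow> q < n \<Longrightarrow> A $$ (p, q) = (\<Sum>i<k. of_real (\<mu> i) * v i $ p * cnj (v i $ q))"
proof -
  let ?P = "\<lambda>k. \<exists>v \<mu>. orthonormal_eigenvectors A n k v \<mu>"
  have "?P 0" by (simp add: orthonormal_eigenvectors_def)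
  moreover have bd: "?P j \<Longrightarrow> j \<le> n" for j using orthonormal_eigenvectors_le_dim by blast
  moreover define k where "k = Greatest ?P"
  ultimately have k: "?P k" "\<And>j. ?P j \<Longrightarrow> j \<le> k"
    using GreatestI_nat[of ?P 0 n] Greatest_le_nat[of ?P _ n] unfolding k_def by blast+
  then obtain v \<mu> where fam: "orthonormal_eigenvectors A n k v \<mu>" by blast
  have v: "v i \<in> carrier_vec n" if "i < k" for i
    using fam that by (auto simp: orthonormal_eigenvectors_def)
  have ev: "A *\<^sub>v v i = of_real (\<mu> i) \<cdot>\<^sub>v v i" if "i < k" for i
    using fam that by (auto simp: orthonormal_eigenvectors_def)
  have on: "v i \<bullet>c v j = (if i = j then 1 else 0)" if "i < k" "j < k" for i j
    using fam that by (auto simp: orthonormal_eigenvectors_def)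
  define H where "H = Matrix.mat n n (\<lambda>(p, q). A $$ (p, q) - (\<Sum>i<k. of_real (\<mu> i) * v i $ p * cnj (v i $ q)))"
  have H: "H \<in> carrier_mat n n" by (simp add: H_def)
  have Aherm: "cnj (A $$ (q, p)) = A $$ (p, q)" if "p < n" "q < n" for p q
    using mat_adjoint_index[OF A that] herm by simp
  have Hherm: "mat_adjoint H = H"
    by (rule hermitianI[OF H]) (simp add: H_def Aherm mult_ac)
  have Hx: "(H *\<^sub>v x) $ p = (A *\<^sub>v x) $ p - (\<Sum>i<k. of_real (\<mu> i) * v i $ p * (x \<bullet>c v i))"
    if x: "x \<in> carrier_vec n" and p: "p < n" for x p
  proof -
    have "(H *\<^sub>v x) $ p = (\<Sum>q<n. A $$ (p, q) * x $ q) - (\<Sum>q<n. \<Sum>i<k. of_real (\<mu> i) * v i $ p * (x $ q * cnj (v i $ q)))"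
      unfolding mult_mat_vec_sum[OF H x p]
      using p by (simp add: H_def right_diff_distrib sum_subtractf sum_distrib_left mult_ac)
    also have "(\<Sum>q<n. \<Sum>i<k. of_real (\<mu> i) * v i $ p * (x $ q * cnj (v i $ q))) = (\<Sum>i<k. \<Sum>q<n. of_real (\<mu> i) * v i $ p * (x $ q * cnj (v i $ q)))"
      by (rule sum.swap)
    also have "\<dots> = (\<Sum>i<k. of_real (\<mu> i) * v i $ p * (x \<bullet>c v i))"
      by (intro sum.cong refl) (simp add: cscalar_prod_sum[OF v] sum_distrib_left)
    finally show ?thesis using mult_mat_vec_sum[OF A x p] by simp
  qed
  have "H = 0\<^sub>m n n"
  proof (rule ccontr)
    assume "H \<noteq> 0\<^sub>m n n"
    then obtain u \<nu> where u: "u \<in> carrier_vec n" "u \<noteq> 0\<^sub>v n" "\<nu> \<noteq> 0" "H *\<^sub>v u = \<nu> \<cdot>\<^sub>v u"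
      using hermitian_nonzero_eigenvector[OF H Hherm] by blast
    have Hv: "H *\<^sub>v v j = 0\<^sub>v n" if j: "j < k" for j
    proof (rule eq_vecI)
      fix p assume "p < dim_vec (0\<^sub>v n :: complex vec)"
      then have p: "p < n" by simp
      have "(\<Sum>i<k. of_real (\<mu> i) * v i $ p * (v j \<bullet>c v i)) = (\<Sum>i<k. if i = j then of_real (\<mu> j) * v j $ p else 0)"
        using j by (intro sum.cong refl) (simp add: on)
      then show "(H *\<^sub>v v j) $ p = 0\<^sub>v n $ p"
        using Hx[OF v[OF j] p] ev[OF j] v[OF j] j p by simp
    qed (use H in auto)
    have orth: "u \<bullet>c v j = 0" if j: "j < k" for j
    proof -
      have "\<nu> * (u \<bullet>c v j) = (H *\<^sub>v u) \<bullet>c v j"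
        using u v[OF j] by (simp add: smult_scalar_prod_distrib[of _ n])
      also have "\<dots> = u \<bullet>c (H *\<^sub>v v j)"
        using hermitian_cscalar_prod[OF H Hherm u(1) v[OF j]] .
      also have "\<dots> = 0" using u(1) by (simp add: Hv[OF j])
      finally show ?thesis using u(3) by simp
    qed
    have Au: "A *\<^sub>v u = \<nu> \<cdot>\<^sub>v u"
    proof (rule eq_vecI)
      fix p assume "p < dim_vec (\<nu> \<cdot>\<^sub>v u)"
      then have p: "p < n" using u(1) by simp
      show "(A *\<^sub>v u) $ p = (\<nu> \<cdot>\<^sub>v u) $ p"
        using Hx[OF u(1) p] u(4) orth by simp
    qed (use A u in auto)
    define s where "s = (euclid_norm u)\<^sup>2"
    have uu: "u \<bullet>c u = of_real s" using euclid_norm_sq[OF u(1)] by (simp add: s_def)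
    then have s0: "s \<noteq> 0" using conjugate_square_eq_0_vec[OF u(1)] u(2) by auto
    then have spos: "s > 0" by (simp add: s_def)
    have "\<nu> * of_real s = (A *\<^sub>v u) \<bullet>c u" using u(1) by (simp add: Au smult_scalar_prod_distrib[of _ n] uu)
    also have "\<dots> = of_real (Re ((A *\<^sub>v u) \<bullet>c u))" by (rule hermitian_quadratic_form_real[OF A herm u(1)])
    finally have \<nu>: "\<nu> = of_real (Re \<nu>)"
      using s0 by (simp add: complex_eq_iff)
    define t where "t = 1 / sqrt s"
    have t: "t * t * s = 1" using spos by (simp add: t_def field_simps)
    define w where "w = of_real t \<cdot>\<^sub>v u"
    have w: "w \<in> carrier_vec n" using u(1) by (simp add: w_def)
    have ww: "w \<bullet>c w = 1"
    proof -
      have "w \<bullet>c w = of_real (t * t) * (u \<bullet>c u)"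
        unfolding cscalar_prod_sum[OF w] cscalar_prod_sum[OF u(1)]
        using u(1) by (simp add: w_def sum_distrib_left mult_ac)
      then show ?thesis using t by (simp add: uu flip: of_real_mult)
    qed
    have wv: "w \<bullet>c v j = 0" if "j < k" for j
      using orth[OF that] u(1) v[OF that] by (simp add: w_def smult_scalar_prod_distrib[of _ n])
    have vw: "v j \<bullet>c w = 0" if "j < k" for j
      using cnj_cscalar_prod[OF w v[OF that]] wv[OF that] by simp
    have Aw: "A *\<^sub>v w = of_real (Re \<nu>) \<cdot>\<^sub>v w"
      using A u(1) \<nu> by (simp add: w_def mult_mat_vec[of _ n n] Au smult_smult_assoc mult.commute)
    have "orthonormal_eigenvectors A n (Suc k) (v(k := w)) (\<mu>(k := Re \<nu>))"
      unfolding orthonormal_eigenvectors_def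
      using w Aw v ev on ww wv vw by (auto simp: less_Suc_eq)
    then have "Suc k \<le> k" using k(2) by blast
    then show False by simp
  qed
  then have "H $$ (p, q) = 0" if "p < n" "q < n" for p q
    using that by simp
  then show ?thesis
    by (intro that[OF fam]) (simp add: H_def)
qed

text \<open>With the decomposition \<open>A = \<Sum>\<^sub>i \<mu>\<^sub>i v\<^sub>i v\<^sub>i\<^sup>*\<close> the square root is \<open>\<Sum>\<^sub>i \<surd>\<mu>\<^sub>i v\<^sub>i v\<^sub>i\<^sup>*\<close>.\<close>

lemma psd_sqrt_exists:
  assumes A: "pos_semidef n A"
  shows "\<exists>B. pos_semidef n B \<and> B * B = A"
proof -
  have Ac: "A \<in> carrier_mat n n" and herm: "mat_adjoint A = A"
    and pos: "\<And>v. v \<in> carrier_vec n \<Longrightarrow> 0 \<le> Re ((A *\<^sub>v v) \<bullet>c v)"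
    using A by (auto simp: pos_semidef_def)
  obtain k v \<mu> where fam: "orthonormal_eigenvectors A n k v \<mu>" and
    dec: "\<And>p q. p < n \<Longrightarrow> q < n \<Longrightarrow> A $$ (p, q) = (\<Sum>i<k. of_real (\<mu> i) * v i $ p * cnj (v i $ q))"
    using hermitian_spectral_decomposition[OF Ac herm] by blast
  have v: "v i \<in> carrier_vec n" if "i < k" for i
    using fam that by (auto simp: orthonormal_eigenvectors_def)
  have on: "v i \<bullet>c v j = (if i = j then 1 else 0)" if "i < k" "j < k" for i j
    using fam that by (auto simp: orthonormal_eigenvectors_def)
  have \<mu>: "\<mu> i \<ge> 0" if "i < k" for i
  proof -
    have "(A *\<^sub>v v i) \<bullet>c v i = of_real (\<mu> i)"
      using fam that v[OF that] on[OF that that]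
      by (auto simp: orthonormal_eigenvectors_def smult_scalar_prod_distrib[of _ n])
    then show ?thesis using pos[OF v[OF that]] by simp
  qed
  define B where "B = Matrix.mat n n (\<lambda>(p, q). \<Sum>i<k. of_real (sqrt (\<mu> i)) * v i $ p * cnj (v i $ q))"
  have B: "B \<in> carrier_mat n n" by (simp add: B_def)
  have "B * B = A"
  proof (rule eq_matI)
    fix p q assume "p < dim_row A" "q < dim_col A"
    then have pq: "p < n" "q < n" using Ac by auto
    have "(B * B) $$ (p, q) = (\<Sum>l<n. \<Sum>i<k. \<Sum>j<k. of_real (sqrt (\<mu> i)) * of_real (sqrt (\<mu> j)) * v i $ p * cnj (v j $ q) * (v j $ l * cnj (v i $ l)))"
      unfolding mult_mat_sum[OF B B pq]
    proof (intro sum.cong refl)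
      fix l assume "l \<in> {..<n}"
      then have "B $$ (p, l) * B $$ (l, q) = (\<Sum>i<k. of_real (sqrt (\<mu> i)) * v i $ p * cnj (v i $ l)) * (\<Sum>j<k. of_real (sqrt (\<mu> j)) * v j $ l * cnj (v j $ q))"
        using pq by (simp add: B_def)
      also have "\<dots> = (\<Sum>i<k. \<Sum>j<k. (of_real (sqrt (\<mu> i)) * v i $ p * cnj (v i $ l)) * (of_real (sqrt (\<mu> j)) * v j $ l * cnj (v j $ q)))"
        by (rule sum_product)
      finally show "B $$ (p, l) * B $$ (l, q) = (\<Sum>i<k. \<Sum>j<k. of_real (sqrt (\<mu> i)) * of_real (sqrt (\<mu> j)) * v i $ p * cnj (v j $ q) * (v j $ l * cnj (v i $ l)))"
        by (simp add: mult_ac)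
    qed
    also have "\<dots> = (\<Sum>i<k. \<Sum>l<n. \<Sum>j<k. of_real (sqrt (\<mu> i)) * of_real (sqrt (\<mu> j)) * v i $ p * cnj (v j $ q) * (v j $ l * cnj (v i $ l)))"
      by (rule sum.swap)
    also have "\<dots> = (\<Sum>i<k. \<Sum>j<k. \<Sum>l<n. of_real (sqrt (\<mu> i)) * of_real (sqrt (\<mu> j)) * v i $ p * cnj (v j $ q) * (v j $ l * cnj (v i $ l)))"
      by (intro sum.cong refl sum.swap)
    also have "\<dots> = (\<Sum>i<k. \<Sum>j<k. of_real (sqrt (\<mu> i)) * of_real (sqrt (\<mu> j)) * v i $ p * cnj (v j $ q) * (v j \<bullet>c v i))"
      by (intro sum.cong refl) (simp add: cscalar_prod_sum[OF v] flip: sum_distrib_left)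
    also have "\<dots> = (\<Sum>i<k. \<Sum>j<k. if j = i then of_real (\<mu> i) * v i $ p * cnj (v i $ q) else 0)"
      by (intro sum.cong refl) (auto simp: on \<mu> simp flip: of_real_mult)
    also have "\<dots> = A $$ (p, q)" by (simp add: dec[OF pq])
    finally show "(B * B) $$ (p, q) = A $$ (p, q)" .
  qed (use Ac B in auto)
  moreover have "mat_adjoint B = B"
    by (rule hermitianI[OF B]) (simp add: B_def mult_ac)
  moreover have "0 \<le> Re ((B *\<^sub>v x) \<bullet>c x)" if x: "x \<in> carrier_vec n" for x
  proof -
    have "(B *\<^sub>v x) \<bullet>c x = (\<Sum>p<n. \<Sum>q<n. \<Sum>i<k. of_real (sqrt (\<mu> i)) * (x $ q * cnj (v i $ q)) * (v i $ p * cnj (x $ p)))"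
      unfolding cscalar_prod_sum[OF x]
    proof (intro sum.cong refl)
      fix p assume "p \<in> {..<n}"
      then have p: "p < n" by simp
      have "(B *\<^sub>v x) $ p = (\<Sum>q<n. (\<Sum>i<k. of_real (sqrt (\<mu> i)) * v i $ p * cnj (v i $ q)) * x $ q)"
        unfolding mult_mat_vec_sum[OF B x p] using p by (simp add: B_def)
      then show "(B *\<^sub>v x) $ p * cnj (x $ p) = (\<Sum>q<n. \<Sum>i<k. of_real (sqrt (\<mu> i)) * (x $ q * cnj (v i $ q)) * (v i $ p * cnj (x $ p)))"
        by (simp only: sum_distrib_right sum_distrib_left mult_ac)
    qed
    also have "\<dots> = (\<Sum>p<n. \<Sum>i<k. \<Sum>q<n. of_real (sqrt (\<mu> i)) * (x $ q * cnj (v i $ q)) * (v i $ p * cnj (x $ p)))"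
      by (intro sum.cong refl sum.swap)
    also have "\<dots> = (\<Sum>p<n. \<Sum>i<k. of_real (sqrt (\<mu> i)) * (x \<bullet>c v i) * (v i $ p * cnj (x $ p)))"
      by (intro sum.cong refl) (simp add: cscalar_prod_sum[OF v] sum_distrib_right sum_distrib_left)
    also have "\<dots> = (\<Sum>i<k. \<Sum>p<n. of_real (sqrt (\<mu> i)) * (x \<bullet>c v i) * (v i $ p * cnj (x $ p)))"
      by (rule sum.swap)
    also have "\<dots> = (\<Sum>i<k. of_real (sqrt (\<mu> i)) * (x \<bullet>c v i) * (v i \<bullet>c x))"
      by (intro sum.cong refl) (simp add: cscalar_prod_sum[OF x] sum_distrib_left)
    also have "\<dots> = (\<Sum>i<k. of_real (sqrt (\<mu> i) * (cmod (x \<bullet>c v i))\<^sup>2))"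
    proof (intro sum.cong refl)
      fix i assume "i \<in> {..<k}"
      then have "v i \<bullet>c x = cnj (x \<bullet>c v i)" using cnj_cscalar_prod[OF x v[of i]] by simp
      then show "of_real (sqrt (\<mu> i)) * (x \<bullet>c v i) * (v i \<bullet>c x) = of_real (sqrt (\<mu> i) * (cmod (x \<bullet>c v i))\<^sup>2)"
        by (simp only: of_real_mult complex_norm_square mult.assoc)
    qed
    finally have "Re ((B *\<^sub>v x) \<bullet>c x) = (\<Sum>i<k. sqrt (\<mu> i) * (cmod (x \<bullet>c v i))\<^sup>2)"
      by (simp del: of_real_mult)
    also have "\<dots> \<ge> 0" by (intro sum_nonneg mult_nonneg_nonneg) (simp_all add: \<mu>)
    finally show ?thesis .
  qed
  ultimately show ?thesis using B by (auto simp: pos_semidef_def)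
qed

text \<open>If \<open>B\<^sup>2 = C\<^sup>2\<close> then \<open>D = B - C\<close> satisfies \<open>B D + D C = 0\<close>. On an eigenvector \<open>u\<close> of \<open>D\<close> with
  nonzero eigenvalue this says that the quadratic forms of \<open>B\<close> and \<open>C\<close>, and so that of \<open>D\<close>, vanish
  at \<open>u\<close>.\<close>

lemma psd_sqrt_unique:
  assumes B: "pos_semidef n B" and C: "pos_semidef n C" and eq: "B * B = C * C"
  shows "B = C"
proof (rule ccontr)
  assume "B \<noteq> C"
  have Bc: "B \<in> carrier_mat n n" and Bh: "mat_adjoint B = B"
    and Cc: "C \<in> carrier_mat n n" and Ch: "mat_adjoint C = C"
    using B C by (auto simp: pos_semidef_def)
  define D where "D = B - C"
  have D: "D \<in> carrier_mat n n" using Bc Cc by (simp add: D_def minus_carrier_mat)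
  have Dh: "mat_adjoint D = D"
  proof (rule hermitianI[OF D])
    fix i j assume ij: "i < n" "j < n"
    show "cnj (D $$ (j, i)) = D $$ (i, j)"
      using mat_adjoint_index[OF Bc ij] mat_adjoint_index[OF Cc ij] Bh Ch Bc Cc ij by (simp add: D_def)
  qed
  have "D \<noteq> 0\<^sub>m n n"
  proof
    assume D0: "D = 0\<^sub>m n n"
    have "B = C"
    proof (rule eq_matI)
      fix i j assume "i < dim_row C" "j < dim_col C"
      then have ij: "i < n" "j < n" using Cc by auto
      have "D $$ (i, j) = 0" using D0 ij by simp
      then show "B $$ (i, j) = C $$ (i, j)" using ij Bc Cc by (simp add: D_def)
    qed (use Bc Cc in auto)
    then show False using \<open>B \<noteq> C\<close> by simp
  qed
  then obtain u \<mu> where u: "u \<in> carrier_vec n" "u \<noteq> 0\<^sub>v n" "\<mu> \<noteq> 0" "D *\<^sub>v u = \<mu> \<cdot>\<^sub>v u"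
    using hermitian_nonzero_eigenvector[OF D Dh] by blast
  have Bu: "B *\<^sub>v u \<in> carrier_vec n" and Cu: "C *\<^sub>v u \<in> carrier_vec n" using Bc Cc u(1) by auto
  have Du: "D *\<^sub>v u = B *\<^sub>v u - C *\<^sub>v u"
    unfolding D_def using minus_mult_distrib_mat_vec[OF Bc Cc u(1)] .
  have uu: "u \<bullet>c u \<noteq> 0" using conjugate_square_eq_0_vec[OF u(1)] u(2) by auto
  have e0: "(D *\<^sub>v (C *\<^sub>v u)) \<bullet>c u + (B *\<^sub>v (D *\<^sub>v u)) \<bullet>c u = 0"
  proof -
    have "D *\<^sub>v (C *\<^sub>v u) = B *\<^sub>v (C *\<^sub>v u) - C *\<^sub>v (C *\<^sub>v u)"
      unfolding D_def using minus_mult_distrib_mat_vec[OF Bc Cc Cu] .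
    moreover have "B *\<^sub>v (D *\<^sub>v u) = B *\<^sub>v (B *\<^sub>v u) - B *\<^sub>v (C *\<^sub>v u)"
      unfolding Du using mult_minus_distrib_mat_vec[OF Bc Bu Cu] .
    moreover have "B *\<^sub>v (B *\<^sub>v u) = C *\<^sub>v (C *\<^sub>v u)"
      using arg_cong[OF eq, of "\<lambda>X. X *\<^sub>v u"] Bc Cc u(1) by (simp add: assoc_mult_mat_vec[of _ n n _ n])
    moreover have "B *\<^sub>v (C *\<^sub>v u) \<in> carrier_vec n" "C *\<^sub>v (C *\<^sub>v u) \<in> carrier_vec n"
      using Bc Cc Cu by auto
    ultimately show ?thesis using u(1) by (simp add: minus_scalar_prod_distrib[of _ n])
  qed
  have e1: "(D *\<^sub>v (C *\<^sub>v u)) \<bullet>c u = cnj \<mu> * ((C *\<^sub>v u) \<bullet>c u)"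
    unfolding hermitian_cscalar_prod[OF D Dh Cu u(1)] u(4)
    using u(1) Cu by (simp add: conjugate_smult_vec)
  have e2: "(B *\<^sub>v (D *\<^sub>v u)) \<bullet>c u = \<mu> * ((B *\<^sub>v u) \<bullet>c u)"
    unfolding u(4) using Bc u(1) Bu by (simp add: mult_mat_vec[of _ n n] smult_scalar_prod_distrib[of _ n])
  have e3: "\<mu> * (u \<bullet>c u) = (D *\<^sub>v u) \<bullet>c u"
    unfolding u(4) using u(1) by (simp add: smult_scalar_prod_distrib[of _ n])
  have e4: "(D *\<^sub>v u) \<bullet>c u = (B *\<^sub>v u) \<bullet>c u - (C *\<^sub>v u) \<bullet>c u"
    unfolding Du using u(1) Bu Cu by (simp add: minus_scalar_prod_distrib[of _ n])
  have e5: "cnj \<mu> = \<mu>"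
  proof -
    have "cnj \<mu> * (u \<bullet>c u) = u \<bullet>c (D *\<^sub>v u)" unfolding u(4) using u(1) by (simp add: conjugate_smult_vec)
    also have "\<dots> = \<mu> * (u \<bullet>c u)"
      unfolding hermitian_cscalar_prod[OF D Dh u(1) u(1), symmetric]
      unfolding u(4) using u(1) by (simp add: smult_scalar_prod_distrib[of _ n])
    finally show ?thesis using uu by simp
  qed
  have "\<mu> * ((B *\<^sub>v u) \<bullet>c u + (C *\<^sub>v u) \<bullet>c u) = 0"
    using e0 unfolding e1 e2 e5 by (simp add: algebra_simps)
  then have "(B *\<^sub>v u) \<bullet>c u + (C *\<^sub>v u) \<bullet>c u = 0" using u(3) by simp
  moreover have "Re ((B *\<^sub>v u) \<bullet>c u) \<ge> 0" "Re ((C *\<^sub>v u) \<bullet>c u) \<ge> 0"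
    using B C u(1) by (auto simp: pos_semidef_def)
  ultimately have "Re ((B *\<^sub>v u) \<bullet>c u) = 0" "Re ((C *\<^sub>v u) \<bullet>c u) = 0"
    by (auto simp: complex_eq_iff)
  then have "(B *\<^sub>v u) \<bullet>c u = 0" "(C *\<^sub>v u) \<bullet>c u = 0"
    using arg_cong[OF hermitian_quadratic_form_real[OF Bc Bh u(1)], of "\<lambda>z. z = 0"]
      arg_cong[OF hermitian_quadratic_form_real[OF Cc Ch u(1)], of "\<lambda>z. z = 0"]
    by (simp_all only: of_real_0 simp_thms)
  then show False
    using e3 e4 u(3) uu by simp
qed

lemma psd_sqrt:
  assumes "pos_semidef n A"
  shows "pos_semidef n (psd_sqrt A)" and "psd_sqrt A * psd_sqrt A = A"
proof -
  have n: "dim_row A = n" using assms by (auto simp: pos_semidef_def)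
  have "\<exists>!B. pos_semidef n B \<and> B * B = A"
    using psd_sqrt_exists[OF assms] psd_sqrt_unique by (metis (no_types, lifting))
  from theI'[OF this] show "pos_semidef n (psd_sqrt A)" "psd_sqrt A * psd_sqrt A = A"
    by (auto simp: psd_sqrt_def n)
qed

lemma inv_sqrt_posdef:
  assumes A: "pos_semidef n A"
    and pos: "\<And>v. v \<in> carrier_vec n \<Longrightarrow> v \<noteq> 0\<^sub>v n \<Longrightarrow> (A *\<^sub>v v) \<bullet>c v \<noteq> 0"
  shows "inv_sqrt A \<in> carrier_mat n n" and "mat_adjoint (inv_sqrt A) = inv_sqrt A"
    and "inv_sqrt A * psd_sqrt A = 1\<^sub>m n" and "psd_sqrt A * inv_sqrt A = 1\<^sub>m n"
proof -
  define B where "B = psd_sqrt A"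
  define G where "G = inv_sqrt A"
  have B: "B \<in> carrier_mat n n" "mat_adjoint B = B" "B * B = A"
    using psd_sqrt[OF A] by (auto simp: B_def pos_semidef_def)
  have "det B \<noteq> 0"
  proof
    assume "det B = 0"
    then obtain v where v: "v \<in> carrier_vec n" "v \<noteq> 0\<^sub>v n" "B *\<^sub>v v = 0\<^sub>v n"
      using det_0_iff_vec_prod_zero[OF B(1)] by blast
    have "A *\<^sub>v v = B *\<^sub>v (B *\<^sub>v v)"
      using B v(1) assoc_mult_mat_vec[of B n n B n v] by simp
    also have "\<dots> = 0\<^sub>v n" unfolding v(3) using B(1) by (intro eq_vecI) auto
    finally show False using pos[OF v(1,2)] v(1) by simp
  qed
  then have "B \<in> Units (ring_mat TYPE(complex) n ())" by (rule det_non_zero_imp_unit[OF B(1)])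
  then obtain G' where "mat_inverse B = Some G'"
    using mat_inverse(1)[OF B(1), where b = "()"] by (cases "mat_inverse B") auto
  then have G: "B * G = 1\<^sub>m n" "G * B = 1\<^sub>m n" "G \<in> carrier_mat n n"
    using mat_inverse(2)[OF B(1)] by (auto simp: G_def inv_sqrt_def B_def)
  have adj_mult: "mat_adjoint (X * Y) = mat_adjoint Y * mat_adjoint X"
    if X: "X \<in> carrier_mat n n" and Y: "Y \<in> carrier_mat n n" for X Y :: "complex mat"
  proof (rule eq_matI)
    fix i j assume "i < dim_row (mat_adjoint Y * mat_adjoint X)" "j < dim_col (mat_adjoint Y * mat_adjoint X)"
    then have ij: "i < n" "j < n"
      using mat_adjoint_carrier[OF X] mat_adjoint_carrier[OF Y] by auto
    show "mat_adjoint (X * Y) $$ (i, j) = (mat_adjoint Y * mat_adjoint X) $$ (i, j)"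
      unfolding mult_mat_sum[OF mat_adjoint_carrier[OF Y] mat_adjoint_carrier[OF X] ij]
        mat_adjoint_index[OF mult_carrier_mat[OF X Y] ij] mult_mat_sum[OF X Y ij(2,1)]
      using ij by (simp add: mat_adjoint_index[OF X] mat_adjoint_index[OF Y] mult.commute)
  qed (use X Y in auto)
  have G': "mat_adjoint G \<in> carrier_mat n n" using G by simp
  have "mat_adjoint (1\<^sub>m n) = (1\<^sub>m n :: complex mat)"
    by (rule hermitianI[of _ n]) auto
  then have "mat_adjoint G * B = 1\<^sub>m n"
    using adj_mult[OF B(1) G(3)] G(1) B(2) by simp
  then have "mat_adjoint G = G"
    using G(1,3) G' assoc_mult_mat[OF G' B(1) G(3)] by simp
  then show "inv_sqrt A \<in> carrier_mat n n" "mat_adjoint (inv_sqrt A) = inv_sqrt A"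
    "inv_sqrt A * psd_sqrt A = 1\<^sub>m n" "psd_sqrt A * inv_sqrt A = 1\<^sub>m n"
    using G by (simp_all add: G_def B_def)
qed

section \<open>Spectral norm and quadratic forms\<close>

abbreviation quad_form :: "complex mat \<Rightarrow> complex vec \<Rightarrow> complex" where
  "quad_form A v \<equiv> (A *\<^sub>v v) \<bullet>c v"

lemma quad_form_sum:
  assumes "A \<in> carrier_mat n n" "v \<in> carrier_vec n"
  shows "quad_form A v = (\<Sum>i<n. \<Sum>j<n. A $$ (i, j) * (v $ j * cnj (v $ i)))"
  unfolding cscalar_prod_sum[OF assms(2)]
  by (intro sum.cong refl) (simp add: mult_mat_vec_sum[OF assms] sum_distrib_right mult.assoc)

lemma cmod_cscalar_prod_le:
  assumes v: "v \<in> carrier_vec n" and w: "w \<in> carrier_vec n"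
  shows "cmod (v \<bullet>c w) \<le> euclid_norm v * euclid_norm w"
proof -
  have "cmod (v \<bullet>c w) \<le> (\<Sum>i<n. \<bar>cmod (v $ i)\<bar> * \<bar>cmod (w $ i)\<bar>)"
    unfolding cscalar_prod_sum[OF w] by (rule order_trans[OF norm_sum]) (simp add: norm_mult)
  also have "\<dots> \<le> euclid_norm v * euclid_norm w"
    unfolding euclid_norm_def using v w L2_set_mult_ineq by (metis carrier_vecD)
  finally show ?thesis .
qed

lemma spectral_norm_bdd_above:
  assumes H: "H \<in> carrier_mat n m"
  shows "bdd_above ((\<lambda>v. euclid_norm (H *\<^sub>v v)) ` {v \<in> carrier_vec m. euclid_norm v \<le> 1})"
proof (rule bdd_aboveI2)
  fix v assume "v \<in> {v \<in> carrier_vec m. euclid_norm v \<le> 1}"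
  then have v: "v \<in> carrier_vec m" and v1: "euclid_norm v \<le> 1" by auto
  have vj: "cmod (v $ j) \<le> 1" if "j < m" for j
  proof -
    have "cmod (v $ j) \<le> euclid_norm v"
      unfolding euclid_norm_def using that v by (intro member_le_L2_set) auto
    then show ?thesis using v1 by simp
  qed
  have "euclid_norm (H *\<^sub>v v) \<le> (\<Sum>i<n. \<bar>cmod ((H *\<^sub>v v) $ i)\<bar>)"
    unfolding euclid_norm_def using H by (simp only: dim_mult_mat_vec carrier_matD L2_set_le_sum_abs)
  also have "\<dots> \<le> (\<Sum>i<n. \<Sum>j<m. cmod (H $$ (i, j)))"
  proof (intro sum_mono)
    fix i assume "i \<in> {..<n}"
    then have i: "i < n" by simp
    have "cmod ((H *\<^sub>v v) $ i) \<le> (\<Sum>j<m. cmod (H $$ (i, j)) * cmod (v $ j))"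
      unfolding mult_mat_vec_sum[OF H v i] by (rule order_trans[OF norm_sum]) (simp add: norm_mult)
    also have "\<dots> \<le> (\<Sum>j<m. cmod (H $$ (i, j)) * 1)"
      by (intro sum_mono mult_left_mono vj) auto
    finally show "\<bar>cmod ((H *\<^sub>v v) $ i)\<bar> \<le> (\<Sum>j<m. cmod (H $$ (i, j)))" by simp
  qed
  finally show "euclid_norm (H *\<^sub>v v) \<le> (\<Sum>i<n. \<Sum>j<m. cmod (H $$ (i, j)))" .
qed

lemma euclid_norm_smult: "euclid_norm (c \<cdot>\<^sub>v v) = cmod c * euclid_norm v"
proof -
  have "euclid_norm (c \<cdot>\<^sub>v v) = L2_set (\<lambda>i. cmod c * cmod (v $ i)) {..<dim_vec v}"
    unfolding euclid_norm_def by (intro L2_set_cong) (auto simp: norm_mult)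
  then show ?thesis by (simp add: euclid_norm_def L2_set_right_distrib)
qed

lemma euclid_norm_zero [simp]: "euclid_norm (0\<^sub>v n) = 0"
  by (simp add: euclid_norm_def L2_set_def)

lemma euclid_norm_mult_le_spectral_norm:
  assumes H: "H \<in> carrier_mat n m" and v: "v \<in> carrier_vec m"
  shows "euclid_norm (H *\<^sub>v v) \<le> spectral_norm H * euclid_norm v"
proof (cases "euclid_norm v = 0")
  case True
  have "(\<Sum>i<m. (cmod (v $ i))\<^sup>2) = 0" using True euclid_norm_sq_sum[OF v] by simp
  then have "v = 0\<^sub>v m" using v by (intro eq_vecI) (auto simp: sum_nonneg_eq_0_iff)
  moreover have "H *\<^sub>v 0\<^sub>v m = 0\<^sub>v n" using H by (intro eq_vecI) auto
  ultimately show ?thesis by simp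
next
  case False
  then have pos: "euclid_norm v > 0" using euclid_norm_nonneg[of v] by linarith
  define w where "w = of_real (1 / euclid_norm v) \<cdot>\<^sub>v v"
  have w: "w \<in> carrier_vec m" using v by (simp add: w_def)
  have w1: "euclid_norm w = 1" using pos unfolding w_def euclid_norm_smult norm_of_real by simp
  have "euclid_norm (H *\<^sub>v w) \<le> spectral_norm H"
    unfolding spectral_norm_def using w w1 H spectral_norm_bdd_above[OF H]
    by (intro cSUP_upper) auto
  moreover have "euclid_norm (H *\<^sub>v w) = euclid_norm (H *\<^sub>v v) / euclid_norm v"
    unfolding w_def mult_mat_vec[OF H v] euclid_norm_smult norm_of_real using pos by simp
  ultimately show ?thesis using pos by (simp add: field_simps)
qed

lemma quad_form_le_spectral_norm:
  assumes H: "H \<in> carrier_mat n n" and v: "v \<in> carrier_vec n"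
  shows "cmod (quad_form H v) \<le> spectral_norm H * (euclid_norm v)\<^sup>2"
proof -
  have "cmod (quad_form H v) \<le> euclid_norm (H *\<^sub>v v) * euclid_norm v"
    using H v by (intro cmod_cscalar_prod_le) auto
  also have "\<dots> \<le> spectral_norm H * euclid_norm v * euclid_norm v"
    by (intro mult_right_mono euclid_norm_mult_le_spectral_norm[OF H v]) simp
  finally show ?thesis by (simp add: power2_eq_square mult.assoc)
qed

lemma spectral_norm_diag_ge:
  assumes "i < n"
  shows "cmod (c i) \<le> spectral_norm (mat_diag n c)"
proof -
  have C: "mat_diag n c \<in> carrier_mat n n" by simp
  have u: "unit_vec n i \<in> carrier_vec n" by simp
  have "mat_diag n c *\<^sub>v unit_vec n i = c i \<cdot>\<^sub>v unit_vec n i"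
    using assms by (intro eq_vecI) (auto simp: mat_diag_def scalar_prod_def sum.delta if_distrib cong: if_cong)
  moreover have "(euclid_norm (unit_vec n i))\<^sup>2 = 1"
    unfolding euclid_norm_sq_sum[OF u] using assms
    by (simp add: if_distrib[of cmod] if_distrib[of "\<lambda>x. x\<^sup>2"] cong: if_cong)
  then have "euclid_norm (unit_vec n i) = 1"
    using euclid_norm_nonneg[of "unit_vec n i"] by (simp add: power2_eq_1_iff)
  ultimately show ?thesis
    using euclid_norm_mult_le_spectral_norm[OF C u] by (simp add: euclid_norm_smult)
qed

text \<open>By polarization the form \<open>\<langle>H x, y\<rangle>\<close> is at most \<open>\<epsilon> (\<parallel>x\<parallel>\<^sup>2 + \<parallel>y\<parallel>\<^sup>2)\<close> in modulus; then take \<open>y = H x\<close>.\<close>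

lemma spectral_norm_le_of_quad_form:
  assumes H: "H \<in> carrier_mat n n" and \<epsilon>: "0 \<le> \<epsilon>" "\<epsilon> \<le> 1 / 2"
    and Q: "\<And>v. v \<in> carrier_vec n \<Longrightarrow> cmod (quad_form H v) \<le> \<epsilon> * (euclid_norm v)\<^sup>2"
  shows "0 \<le> spectral_norm H" and "spectral_norm H \<le> sqrt (2 * \<epsilon>)"
proof -
  let ?b = "\<lambda>x y. \<Sum>i<n. \<Sum>j<n. H $$ (i, j) * (x j * cnj (y i))"
  have Q': "cmod (?b x x) \<le> \<epsilon> * (\<Sum>i<n. (cmod (x i))\<^sup>2)" for x :: "nat \<Rightarrow> complex"
  proof -
    have x: "vec n x \<in> carrier_vec n" by simp
    show ?thesis using Q[OF x] unfolding quad_form_sum[OF H x] euclid_norm_sq_sum[OF x] by simp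
  qed
  have bound: "cmod (?b x y) \<le> \<epsilon> * ((\<Sum>i<n. (cmod (x i))\<^sup>2) + (\<Sum>i<n. (cmod (y i))\<^sup>2))"
    for x y :: "nat \<Rightarrow> complex"
  proof -
    \<comment> \<open>the four vectors of the polarization identity\<close>
    define z where "z k i = x i + \<i> ^ k * y i" for k i
    have pol: "4 * ?b x y = ?b (z 0) (z 0) - ?b (z 2) (z 2) + \<i> * ?b (z 1) (z 1) - \<i> * ?b (z 3) (z 3)"
      unfolding sum_distrib_left sum_subtractf[symmetric] sum.distrib[symmetric]
      by (intro sum.cong refl) (simp add: z_def algebra_simps power3_eq_cube power2_eq_square)
    have "4 * cmod (?b x y) = cmod (4 * ?b x y)" by (simp only: norm_mult norm_numeral)
    also have "\<dots> = cmod (?b (z 0) (z 0) - ?b (z 2) (z 2) + \<i> * ?b (z 1) (z 1) - \<i> * ?b (z 3) (z 3))"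
      by (simp only: pol)
    also have "\<dots> \<le> cmod (?b (z 0) (z 0)) + cmod (?b (z 2) (z 2)) + cmod (?b (z 1) (z 1)) + cmod (?b (z 3) (z 3))"
    proof -
      have "cmod (a - b + \<i> * c - \<i> * d) \<le> cmod a + cmod b + cmod c + cmod d" for a b c d
        using norm_triangle_ineq4[of "a - b + \<i> * c" "\<i> * d"] norm_triangle_ineq[of "a - b" "\<i> * c"]
          norm_triangle_ineq4[of a b] by (simp add: norm_mult)
      then show ?thesis .
    qed
    also have "\<dots> \<le> \<epsilon> * (\<Sum>i<n. (cmod (z 0 i))\<^sup>2) + \<epsilon> * (\<Sum>i<n. (cmod (z 2 i))\<^sup>2) +
        \<epsilon> * (\<Sum>i<n. (cmod (z 1 i))\<^sup>2) + \<epsilon> * (\<Sum>i<n. (cmod (z 3 i))\<^sup>2)"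
      by (intro add_mono Q')
    also have "\<dots> = \<epsilon> * (\<Sum>i<n. (cmod (z 0 i))\<^sup>2 + (cmod (z 2 i))\<^sup>2 + (cmod (z 1 i))\<^sup>2 + (cmod (z 3 i))\<^sup>2)"
      by (simp add: sum.distrib distrib_left)
    also have "(\<Sum>i<n. (cmod (z 0 i))\<^sup>2 + (cmod (z 2 i))\<^sup>2 + (cmod (z 1 i))\<^sup>2 + (cmod (z 3 i))\<^sup>2)
        = (\<Sum>i<n. 4 * (cmod (x i))\<^sup>2 + 4 * (cmod (y i))\<^sup>2)"
    proof (intro sum.cong refl)
      fix i
      have "(cmod (a + b))\<^sup>2 + (cmod (a - b))\<^sup>2 + (cmod (a + \<i> * b))\<^sup>2 + (cmod (a - \<i> * b))\<^sup>2
          = 4 * (cmod a)\<^sup>2 + 4 * (cmod b)\<^sup>2" for a b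
        unfolding cmod_power2 by (simp add: power2_eq_square algebra_simps)
      from this[of "x i" "y i"]
      show "(cmod (z 0 i))\<^sup>2 + (cmod (z 2 i))\<^sup>2 + (cmod (z 1 i))\<^sup>2 + (cmod (z 3 i))\<^sup>2
          = 4 * (cmod (x i))\<^sup>2 + 4 * (cmod (y i))\<^sup>2"
        by (simp add: z_def power3_eq_cube)
    qed
    finally show ?thesis by (simp add: sum.distrib distrib_left flip: sum_distrib_left)
  qed
  have le: "euclid_norm (H *\<^sub>v v) \<le> sqrt (2 * \<epsilon>)"
    if v: "v \<in> carrier_vec n" and v1: "euclid_norm v \<le> 1" for v
  proof -
    have Hv: "H *\<^sub>v v \<in> carrier_vec n" using H v by auto
    define s where "s = (euclid_norm (H *\<^sub>v v))\<^sup>2"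
    have "of_real s = (H *\<^sub>v v) \<bullet>c (H *\<^sub>v v)" using euclid_norm_sq[OF Hv] by (simp add: s_def)
    also have "\<dots> = ?b (\<lambda>i. v $ i) (\<lambda>i. (H *\<^sub>v v) $ i)"
      unfolding cscalar_prod_sum[OF Hv]
    proof (intro sum.cong refl)
      fix i assume "i \<in> {..<n}"
      then have i: "i < n" by simp
      show "(H *\<^sub>v v) $ i * cnj ((H *\<^sub>v v) $ i) = (\<Sum>j<n. H $$ (i, j) * (v $ j * cnj ((H *\<^sub>v v) $ i)))"
        by (subst (1) mult_mat_vec_sum[OF H v i]) (simp only: sum_distrib_right mult.assoc)
    qed
    finally have s: "of_real s = ?b (\<lambda>i. v $ i) (\<lambda>i. (H *\<^sub>v v) $ i)" .
    have "\<bar>s\<bar> = cmod (of_real s)" by (simp only: norm_of_real)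
    also have "\<dots> = cmod (?b (\<lambda>i. v $ i) (\<lambda>i. (H *\<^sub>v v) $ i))" by (simp only: s)
    also have "\<dots> \<le> \<epsilon> * ((euclid_norm v)\<^sup>2 + s)"
      using bound[of "\<lambda>i. v $ i" "\<lambda>i. (H *\<^sub>v v) $ i"]
      unfolding s_def euclid_norm_sq_sum[OF v] euclid_norm_sq_sum[OF Hv] .
    finally have "s \<le> \<epsilon> * ((euclid_norm v)\<^sup>2 + s)" by simp
    also have "\<dots> \<le> \<epsilon> * (1 + s)"
      using v1 \<epsilon>(1) by (intro mult_left_mono add_right_mono) (auto simp: power_le_one)
    also have "\<dots> \<le> \<epsilon> + 1 / 2 * s"
      unfolding distrib_left using \<epsilon> by (intro add_mono mult_right_mono) (simp_all add: s_def)
    finally have "s \<le> 2 * \<epsilon>" by simp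
    then show ?thesis unfolding s_def by (simp add: real_le_rsqrt)
  qed
  have z: "0\<^sub>v n \<in> {v \<in> carrier_vec (dim_col H). euclid_norm v \<le> 1}" using H by simp
  show "spectral_norm H \<le> sqrt (2 * \<epsilon>)"
    unfolding spectral_norm_def
  proof (rule cSUP_least)
    show "{v \<in> carrier_vec (dim_col H). euclid_norm v \<le> 1} \<noteq> {}" using z by blast
  qed (use le H in auto)
  have "euclid_norm (H *\<^sub>v 0\<^sub>v n) \<le> spectral_norm H"
    unfolding spectral_norm_def using z spectral_norm_bdd_above[OF H] H by (intro cSUP_upper) auto
  then show "0 \<le> spectral_norm H" using euclid_norm_nonneg[of "H *\<^sub>v 0\<^sub>v n"] by linarith
qed

text \<open>With \<open>G = A\<^sup>-\<^sup>1\<^sup>/\<^sup>2\<close> and \<open>x = G v\<close>, the form of \<open>G T G - I\<close> at \<open>v\<close> is that of \<open>T - A\<close> at \<open>x\<close>,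
  and \<open>\<parallel>v\<parallel>\<^sup>2 = \<langle>A x, x\<rangle>\<close>.\<close>

lemma quad_form_inv_sqrt:
  assumes A: "pos_semidef n A"
    and pos: "\<And>v. v \<in> carrier_vec n \<Longrightarrow> v \<noteq> 0\<^sub>v n \<Longrightarrow> quad_form A v \<noteq> 0"
    and T: "T \<in> carrier_mat n n" and v: "v \<in> carrier_vec n"
  shows "quad_form (inv_sqrt A * T * inv_sqrt A - 1\<^sub>m n) v =
      quad_form T (inv_sqrt A *\<^sub>v v) - quad_form A (inv_sqrt A *\<^sub>v v)"
    and "of_real ((euclid_norm v)\<^sup>2) = quad_form A (inv_sqrt A *\<^sub>v v)"
proof -
  define G where "G = inv_sqrt A"
  define B where "B = psd_sqrt A"
  have G: "G \<in> carrier_mat n n" "mat_adjoint G = G" "B * G = 1\<^sub>m n"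
    using inv_sqrt_posdef[OF A pos] by (auto simp: G_def B_def)
  have B: "B \<in> carrier_mat n n" "mat_adjoint B = B" "B * B = A"
    using psd_sqrt[OF A] by (auto simp: B_def pos_semidef_def)
  have Gv: "G *\<^sub>v v \<in> carrier_vec n" using G v by auto
  have vv: "B *\<^sub>v (G *\<^sub>v v) = v"
    using assoc_mult_mat_vec[OF B(1) G(1) v] G(3) v by simp
  have "quad_form A (G *\<^sub>v v) = (B *\<^sub>v (B *\<^sub>v (G *\<^sub>v v))) \<bullet>c (G *\<^sub>v v)"
    using assoc_mult_mat_vec[OF B(1) B(1) Gv] B(3) by simp
  also have "\<dots> = v \<bullet>c v"
    using hermitian_cscalar_prod[OF B(1,2) v Gv] vv by simp
  finally have AG: "quad_form A (G *\<^sub>v v) = v \<bullet>c v" .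
  then show "of_real ((euclid_norm v)\<^sup>2) = quad_form A (inv_sqrt A *\<^sub>v v)"
    using euclid_norm_sq[OF v] by (simp add: G_def)
  have TG: "T *\<^sub>v (G *\<^sub>v v) \<in> carrier_vec n" using T Gv by auto
  have GTG: "G * T * G \<in> carrier_mat n n" using G(1) T by auto
  have "(G * T * G - 1\<^sub>m n) *\<^sub>v v = G *\<^sub>v (T *\<^sub>v (G *\<^sub>v v)) - v"
    using minus_mult_distrib_mat_vec[OF GTG _ v, of "1\<^sub>m n"] G(1) T v
    by (simp add: assoc_mult_mat_vec[of _ n n _ n] assoc_mult_mat[of _ n n _ n _ n])
  then have "quad_form (G * T * G - 1\<^sub>m n) v = (G *\<^sub>v (T *\<^sub>v (G *\<^sub>v v))) \<bullet>c v - v \<bullet>c v"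
    using G(1) TG v by (simp add: minus_scalar_prod_distrib[of _ n])
  also have "(G *\<^sub>v (T *\<^sub>v (G *\<^sub>v v))) \<bullet>c v = quad_form T (G *\<^sub>v v)"
    using hermitian_cscalar_prod[OF G(1,2) TG v] .
  finally show "quad_form (inv_sqrt A * T * inv_sqrt A - 1\<^sub>m n) v =
      quad_form T (inv_sqrt A *\<^sub>v v) - quad_form A (inv_sqrt A *\<^sub>v v)"
    using AG by (simp add: G_def)
qed

lemma normalized_norm_le:
  assumes A: "pos_semidef n A"
    and pos: "\<And>v. v \<in> carrier_vec n \<Longrightarrow> v \<noteq> 0\<^sub>v n \<Longrightarrow> quad_form A v \<noteq> 0"
    and T: "T \<in> carrier_mat n n" and \<epsilon>: "0 \<le> \<epsilon>" "\<epsilon> \<le> 1 / 2"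
    and le: "\<And>x. x \<in> carrier_vec n \<Longrightarrow> cmod (quad_form T x - quad_form A x) \<le> \<epsilon> * Re (quad_form A x)"
  shows "0 \<le> spectral_norm (inv_sqrt A * T * inv_sqrt A - 1\<^sub>m n)"
    and "spectral_norm (inv_sqrt A * T * inv_sqrt A - 1\<^sub>m n) \<le> sqrt (2 * \<epsilon>)"
proof -
  note G = inv_sqrt_posdef(1)[OF A pos]
  have H: "inv_sqrt A * T * inv_sqrt A - 1\<^sub>m n \<in> carrier_mat n n"
    using G T by (intro minus_carrier_mat) auto
  have "cmod (quad_form (inv_sqrt A * T * inv_sqrt A - 1\<^sub>m n) v) \<le> \<epsilon> * (euclid_norm v)\<^sup>2"
    if v: "v \<in> carrier_vec n" for v
    using quad_form_inv_sqrt(1)[OF A pos T v] le[of "inv_sqrt A *\<^sub>v v"] arg_cong[OF quad_form_inv_sqrt(2)[OF A pos T v], of Re] G v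
    by auto
  from spectral_norm_le_of_quad_form[OF H \<epsilon> this]
  show "0 \<le> spectral_norm (inv_sqrt A * T * inv_sqrt A - 1\<^sub>m n)"
    "spectral_norm (inv_sqrt A * T * inv_sqrt A - 1\<^sub>m n) \<le> sqrt (2 * \<epsilon>)" by auto
qed

lemma normalized_norm_ge:
  assumes A: "pos_semidef n A"
    and pos: "\<And>v. v \<in> carrier_vec n \<Longrightarrow> v \<noteq> 0\<^sub>v n \<Longrightarrow> quad_form A v \<noteq> 0"
    and T: "T \<in> carrier_mat n n" and x: "x \<in> carrier_vec n"
  shows "cmod (quad_form T x - quad_form A x)
    \<le> spectral_norm (inv_sqrt A * T * inv_sqrt A - 1\<^sub>m n) * Re (quad_form A x)"
proof -
  note G = inv_sqrt_posdef[OF A pos]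
  have B: "psd_sqrt A \<in> carrier_mat n n" using psd_sqrt[OF A] by (auto simp: pos_semidef_def)
  define v where "v = psd_sqrt A *\<^sub>v x"
  have v: "v \<in> carrier_vec n" using B x by (auto simp: v_def)
  have Gv: "inv_sqrt A *\<^sub>v v = x"
    unfolding v_def using assoc_mult_mat_vec[OF G(1) B x] G(3) x by simp
  have H: "inv_sqrt A * T * inv_sqrt A - 1\<^sub>m n \<in> carrier_mat n n"
    using G(1) T by (intro minus_carrier_mat) auto
  show ?thesis
    using quad_form_le_spectral_norm[OF H v] quad_form_inv_sqrt(1)[OF A pos T v]
      arg_cong[OF quad_form_inv_sqrt(2)[OF A pos T v], of Re] by (simp add: Gv)
qed

section \<open>Toeplitz averages and the periodogram\<close>

text \<open>The common form of \<open>R\<^sup>b\<close> and of the estimator.\<close>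

definition toeplitz_average :: "nat \<Rightarrow> complex mat \<Rightarrow> complex mat" where
  "toeplitz_average M S = toeplitz M (biased_autocov M S)"

definition fourier_vec :: "nat \<Rightarrow> real \<Rightarrow> complex vec" where
  "fourier_vec M \<theta> = vec M (\<lambda>j. cis (real j * \<theta>))"

definition grid_point :: "nat \<Rightarrow> nat \<Rightarrow> real" where
  "grid_point M l = real l * (pi / real M)"

lemma fourier_vec_carrier [simp]: "fourier_vec M \<theta> \<in> carrier_vec M"
  by (simp add: fourier_vec_def)

lemma toeplitz_carrier [simp]: "toeplitz M r \<in> carrier_mat M M"
  by (simp add: toeplitz_def)

lemma toeplitz_average_carrier [simp]: "toeplitz_average M S \<in> carrier_mat M M"
  by (simp add: toeplitz_average_def)

text \<open>Characters of \<open>\<int>/2M\<close> are orthogonal. The exponents met below are sums of two differences of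
  indices below \<open>M\<close>, so \<open>2M\<close> points are enough to exclude aliasing.\<close>

lemma sum_cis_grid:
  fixes m :: int
  assumes "\<bar>m\<bar> < 2 * int M"
  shows "(\<Sum>l<2 * M. cis (of_int m * grid_point M l)) = (if m = 0 then of_nat (2 * M) else 0)"
proof (cases "m = 0")
  case True
  then show ?thesis by simp
next
  case False
  have M: "M > 0" using assms by (cases M) auto
  define z where "z = cis (of_int m * pi / real M)"
  have zl: "cis (of_int m * grid_point M l) = z ^ l" for l
    unfolding z_def Complex.DeMoivre grid_point_def by (simp add: mult_ac)
  have "z \<noteq> 1"
  proof
    assume "z = 1"
    then have "cos (of_int m * pi / real M) = 1" by (simp add: z_def complex_eq_iff)
    then obtain n :: int where "of_int m * pi / real M = of_int n * 2 * pi"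
      by (auto simp: cos_one_2pi_int)
    then have "real_of_int m = real_of_int (2 * n * int M)"
      using M by (simp add: field_simps)
    then have "m = 2 * n * int M" by linarith
    then have n: "n \<noteq> 0" "\<bar>m\<bar> = 2 * \<bar>n\<bar> * int M" using False by (auto simp: abs_mult)
    have "1 \<le> \<bar>n\<bar>" using n(1) by linarith
    then have "2 * int M \<le> 2 * \<bar>n\<bar> * int M" by (simp add: mult_le_cancel_right1)
    then show False using assms n by simp
  qed
  moreover have "z ^ (2 * M) = 1"
  proof -
    have "z ^ (2 * M) = cis (2 * pi * of_int m)"
      unfolding z_def Complex.DeMoivre using M by (simp add: field_simps)
    then show ?thesis by (simp add: cis_multiple_2pi)
  qed
  ultimately have "(\<Sum>l<2 * M. z ^ l) = 0" by (simp add: sum_gp_strict)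
  then show ?thesis using False by (simp add: zl)
qed

lemma quad_form_toeplitz_average_sum:
  assumes S: "S \<in> carrier_mat M M" and v: "v \<in> carrier_vec M"
  shows "of_nat M * quad_form (toeplitz_average M S) v =
    (\<Sum>i<M. \<Sum>j<M. \<Sum>p<M. \<Sum>q<M.
      if int p - int q = int i - int j then S $$ (p, q) * (v $ j * cnj (v $ i)) else 0)"
proof -
  have "of_nat M * toeplitz_average M S $$ (i, j) =
      (\<Sum>p<M. \<Sum>q<M. if int p - int q = int i - int j then S $$ (p, q) else 0)"
    if ij: "i < M" "j < M" for i j
  proof -
    define k where "k = int i - int j"
    have "of_nat M * toeplitz_average M S $$ (i, j) =
        (\<Sum>q | q < M \<and> 0 \<le> int q + k \<and> int q + k < int M. S $$ (nat (int q + k), q))"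
      using ij by (simp add: toeplitz_average_def toeplitz_def biased_autocov_def k_def)
    also have "\<dots> = (\<Sum>q<M. if 0 \<le> int q + k \<and> int q + k < int M then S $$ (nat (int q + k), q) else 0)"
      by (subst sum.inter_filter[symmetric]) (auto intro!: sum.cong)
    also have "\<dots> = (\<Sum>q<M. \<Sum>p<M. if int p - int q = k then S $$ (p, q) else 0)"
    proof (intro sum.cong refl)
      fix q assume "q \<in> {..<M}"
      show "(if 0 \<le> int q + k \<and> int q + k < int M then S $$ (nat (int q + k), q) else 0)
          = (\<Sum>p<M. if int p - int q = k then S $$ (p, q) else 0)"
      proof (cases "0 \<le> int q + k \<and> int q + k < int M")
        case True
        have "(\<Sum>p<M. if int p - int q = k then S $$ (p, q) else 0) =
            (\<Sum>p<M. if p = nat (int q + k) then S $$ (nat (int q + k), q) else 0)"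
          using True by (intro sum.cong refl) (auto simp: nat_eq_iff)
        also have "\<dots> = S $$ (nat (int q + k), q)" using True by (simp add: nat_less_iff)
        finally show ?thesis using True by simp
      next
        case False
        then have "\<And>p. p < M \<Longrightarrow> int p - int q \<noteq> k" by auto
        then show ?thesis using False by (auto intro!: sum.neutral[symmetric])
      qed
    qed
    also have "\<dots> = (\<Sum>p<M. \<Sum>q<M. if int p - int q = k then S $$ (p, q) else 0)"
      by (rule sum.swap)
    finally show ?thesis by (simp add: k_def)
  qed
  then show ?thesis
    unfolding quad_form_sum[OF toeplitz_average_carrier v]
    by (simp add: sum_distrib_left sum_distrib_right if_distrib if_distribR mult.assoc[symmetric] cong: if_cong)
qed

text \<open>Expand both factors on the right in characters. By orthogonality over the grid only the terms with
  \<open>p - q = i - j\<close> remain, and these make up the form of the averaged matrix. Comparing the forms of two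
  averaged matrices at all vectors is thus reduced to comparing periodograms at \<open>2M\<close> points.\<close>

lemma quad_form_toeplitz_average:
  assumes S: "S \<in> carrier_mat M M" and v: "v \<in> carrier_vec M"
  shows "2 * of_nat M * (of_nat M * quad_form (toeplitz_average M S) v) =
    (\<Sum>l<2 * M. quad_form S (fourier_vec M (grid_point M l)) *
       of_real ((cmod (v \<bullet>c fourier_vec M (grid_point M l)))\<^sup>2))"
proof -
  let ?A = "{..<M} \<times> {..<M}"
  define F where "F = (\<lambda>(p, q). S $$ (p, q))"
  define G where "G = (\<lambda>(i, j). v $ j * cnj (v $ i))"
  define d where "d = (\<lambda>(p :: nat, q :: nat). int p - int q)"
  have dlt: "\<bar>d b - d a\<bar> < 2 * int M" if "a \<in> ?A" "b \<in> ?A" for a b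
    using that by (auto simp: d_def)
  have e1: "quad_form S (fourier_vec M \<theta>) = (\<Sum>a\<in>?A. F a * cis (- of_int (d a) * \<theta>))" for \<theta>
    unfolding quad_form_sum[OF S fourier_vec_carrier] sum.cartesian_product
    by (intro sum.cong refl)
      (auto simp: fourier_vec_def F_def d_def cis_cnj cis_mult algebra_simps)
  have e2: "of_real ((cmod (v \<bullet>c fourier_vec M \<theta>))\<^sup>2) = (\<Sum>b\<in>?A. G b * cis (of_int (d b) * \<theta>))" for \<theta>
  proof -
    have "of_real ((cmod (v \<bullet>c fourier_vec M \<theta>))\<^sup>2) =
        (\<Sum>j<M. v $ j * cis (- real j * \<theta>)) * (\<Sum>i<M. cnj (v $ i) * cis (real i * \<theta>))"
      unfolding complex_norm_square cscalar_prod_sum[OF fourier_vec_carrier]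
      by (simp add: fourier_vec_def cis_cnj)
    also have "\<dots> = (\<Sum>i<M. \<Sum>j<M. (v $ j * cis (- real j * \<theta>)) * (cnj (v $ i) * cis (real i * \<theta>)))"
      unfolding sum_product by (rule sum.swap)
    also have "\<dots> = (\<Sum>b\<in>?A. G b * cis (of_int (d b) * \<theta>))"
      unfolding sum.cartesian_product
      by (intro sum.cong refl) (auto simp: G_def d_def cis_mult algebra_simps)
    finally show ?thesis .
  qed
  have "(\<Sum>l<2 * M. quad_form S (fourier_vec M (grid_point M l)) *
        of_real ((cmod (v \<bullet>c fourier_vec M (grid_point M l)))\<^sup>2)) =
      (\<Sum>l<2 * M. \<Sum>a\<in>?A. \<Sum>b\<in>?A. F a * G b * cis (of_int (d b - d a) * grid_point M l))"
    unfolding e1 e2 sum_product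
    by (intro sum.cong refl) (simp add: cis_mult algebra_simps)
  also have "\<dots> = (\<Sum>a\<in>?A. \<Sum>l<2 * M. \<Sum>b\<in>?A. F a * G b * cis (of_int (d b - d a) * grid_point M l))"
    by (rule sum.swap)
  also have "\<dots> = (\<Sum>a\<in>?A. \<Sum>b\<in>?A. \<Sum>l<2 * M. F a * G b * cis (of_int (d b - d a) * grid_point M l))"
    by (intro sum.cong refl sum.swap)
  also have "\<dots> = (\<Sum>a\<in>?A. \<Sum>b\<in>?A. F a * G b * (if d b - d a = 0 then of_nat (2 * M) else 0))"
    by (intro sum.cong refl) (simp only: sum_distrib_left[symmetric] sum_cis_grid[OF dlt])
  also have "\<dots> = (\<Sum>b\<in>?A. \<Sum>a\<in>?A. F a * G b * (if d b - d a = 0 then of_nat (2 * M) else 0))"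
    by (rule sum.swap)
  also have "\<dots> = 2 * of_nat M * (\<Sum>b\<in>?A. \<Sum>a\<in>?A. if d a = d b then F a * G b else 0)"
    unfolding sum_distrib_left by (intro sum.cong refl) (auto simp: algebra_simps)
  also have "(\<Sum>b\<in>?A. \<Sum>a\<in>?A. if d a = d b then F a * G b else 0) =
      (\<Sum>i<M. \<Sum>j<M. \<Sum>p<M. \<Sum>q<M.
      if int p - int q = int i - int j then S $$ (p, q) * (v $ j * cnj (v $ i)) else 0)"
  proof -
    have "(\<Sum>b\<in>?A. k b) = (\<Sum>i<M. \<Sum>j<M. k (i, j))" for k :: "nat \<times> nat \<Rightarrow> complex"
      by (simp add: sum.cartesian_product)
    then show ?thesis by (simp only: F_def G_def d_def prod.case)
  qed
  finally show ?thesis using quad_form_toeplitz_average_sum[OF S v] by simp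
qed

text \<open>The weights \<open>\<bar>\<langle>v, e\<rangle>\<bar>\<^sup>2\<close> in the formula above are nonnegative and do not depend on the matrix, so a
  relative error bound at the grid vectors carries over.\<close>

lemma toeplitz_average_form_close:
  assumes S: "S \<in> carrier_mat M M" and R: "R \<in> carrier_mat M M" and M: "M > 0"
    and close: "\<And>l. l < 2 * M \<Longrightarrow>
      cmod (quad_form S (fourier_vec M (grid_point M l)) - quad_form R (fourier_vec M (grid_point M l)))
        \<le> \<epsilon> * Re (quad_form R (fourier_vec M (grid_point M l)))"
    and v: "v \<in> carrier_vec M"
  shows "cmod (quad_form (toeplitz_average M S) v - quad_form (toeplitz_average M R) v)
    \<le> \<epsilon> * Re (quad_form (toeplitz_average M R) v)"
proof -
  let ?e = "\<lambda>l. fourier_vec M (grid_point M l)"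
  let ?w = "\<lambda>l. (cmod (v \<bullet>c ?e l))\<^sup>2"
  define c where "c = 2 * real M * real M"
  have c: "c > 0" using M by (simp add: c_def)
  have eq: "of_real c * quad_form (toeplitz_average M T) v = (\<Sum>l<2 * M. quad_form T (?e l) * of_real (?w l))"
    if "T \<in> carrier_mat M M" for T
    using quad_form_toeplitz_average[OF that v] by (simp add: c_def mult_ac)
  have "c * cmod (quad_form (toeplitz_average M S) v - quad_form (toeplitz_average M R) v)
      = cmod (of_real c * quad_form (toeplitz_average M S) v - of_real c * quad_form (toeplitz_average M R) v)"
    using c by (simp add: right_diff_distrib[symmetric] norm_mult)
  also have "\<dots> = cmod (\<Sum>l<2 * M. (quad_form S (?e l) - quad_form R (?e l)) * of_real (?w l))"
    unfolding eq[OF S] eq[OF R] by (simp add: sum_subtractf left_diff_distrib)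
  also have "\<dots> \<le> (\<Sum>l<2 * M. \<epsilon> * Re (quad_form R (?e l)) * ?w l)"
  proof (rule sum_norm_le)
    fix l assume "l \<in> {..<2 * M}"
    then show "cmod ((quad_form S (?e l) - quad_form R (?e l)) * of_real (?w l)) \<le> \<epsilon> * Re (quad_form R (?e l)) * ?w l"
      unfolding norm_mult norm_of_real abs_power2 using close by (intro mult_right_mono) auto
  qed
  also have "\<dots> = \<epsilon> * Re (of_real c * quad_form (toeplitz_average M R) v)"
    unfolding eq[OF R] by (simp add: sum_distrib_left mult_ac)
  also have "\<dots> = c * (\<epsilon> * Re (quad_form (toeplitz_average M R) v))" by (simp add: mult_ac)
  finally show ?thesis using c by simp
qed

lemma biased_mat_toeplitz_average: "biased_mat M r = toeplitz_average M (toeplitz M r)"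
proof (rule eq_matI)
  fix i j assume "i < dim_row (toeplitz_average M (toeplitz M r))" "j < dim_col (toeplitz_average M (toeplitz M r))"
  then have ij: "i < M" "j < M" by (simp_all add: toeplitz_average_def toeplitz_def)
  define k where "k = int i - int j"
  have k: "\<bar>k\<bar> < int M" using ij by (auto simp: k_def)
  let ?I = "{q. q < M \<and> 0 \<le> int q + k \<and> int q + k < int M}"
  have "?I = {nat (max 0 (- k))..<nat (min (int M) (int M - k))}" by auto
  then have card: "card ?I = nat (int M - \<bar>k\<bar>)" using k by (auto simp: nat_diff_distrib' max_def min_def abs_if)
  have "(\<Sum>q\<in>?I. toeplitz M r $$ (nat (int q + k), q)) = (\<Sum>q\<in>?I. r k)"
    by (intro sum.cong refl) (auto simp: toeplitz_def nat_less_iff)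
  also have "\<dots> = of_real (real_of_int (int M - \<bar>k\<bar>)) * r k"
  proof -
    have "complex_of_nat (card ?I) = of_real (real_of_int (int M - \<bar>k\<bar>))"
      unfolding card of_real_of_int_eq using k by (intro of_nat_nat) simp
    then show ?thesis by (simp only: sum_constant)
  qed
  finally have "biased_autocov M (toeplitz M r) k = of_real (1 - real_of_int \<bar>k\<bar> / real M) * r k"
    using ij by (simp add: biased_autocov_def field_simps)
  then show "biased_mat M r $$ (i, j) = toeplitz_average M (toeplitz M r) $$ (i, j)"
    using ij by (simp add: toeplitz_average_def biased_mat_def toeplitz_def k_def)
qed (simp_all add: biased_mat_def toeplitz_average_def toeplitz_def)

text \<open>The identity is its own average, so for it the formula is Parseval's identity on the grid.\<close>

lemma toeplitz_average_one: "M > 0 \<Longrightarrow> toeplitz_average M (1\<^sub>m M) = 1\<^sub>m M"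
proof (rule eq_matI)
  assume M: "M > 0"
  fix i j assume "i < dim_row (1\<^sub>m M :: complex mat)" "j < dim_col (1\<^sub>m M :: complex mat)"
  then have ij: "i < M" "j < M" by auto
  define k where "k = int i - int j"
  let ?I = "{q. q < M \<and> 0 \<le> int q + k \<and> int q + k < int M}"
  have "(\<Sum>q\<in>?I. (1\<^sub>m M :: complex mat) $$ (nat (int q + k), q)) = (\<Sum>q\<in>?I. if k = 0 then 1 else 0)"
    by (intro sum.cong refl) (auto simp: nat_less_iff nat_eq_iff)
  moreover have "?I = {..<M}" if "k = 0" using that by auto
  ultimately show "toeplitz_average M (1\<^sub>m M) $$ (i, j) = (1\<^sub>m M :: complex mat) $$ (i, j)"
    using ij M by (auto simp: toeplitz_average_def toeplitz_def biased_autocov_def k_def)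
qed (simp_all add: toeplitz_average_def toeplitz_def)

lemma fourier_vec_determines:
  assumes v: "v \<in> carrier_vec M" and z: "\<And>l. l < 2 * M \<Longrightarrow> v \<bullet>c fourier_vec M (grid_point M l) = 0"
  shows "v = 0\<^sub>v M"
proof (cases "M = 0")
  case True
  then show ?thesis using v by auto
next
  case False
  have "quad_form (1\<^sub>m M) v = 0"
    using quad_form_toeplitz_average[of "1\<^sub>m M" M v] z v False toeplitz_average_one[of M] by simp
  then show ?thesis using conjugate_square_eq_0_vec[OF v] v by simp
qed

text \<open>The form is a positive combination of the numbers \<open>\<bar>\<langle>v, e\<rangle>\<bar>\<^sup>2\<close>, which all vanish for \<open>v = 0\<close> only.\<close>

lemma toeplitz_average_posdef:
  assumes R: "pos_semidef M R" and M: "M > 0"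
    and pos: "\<And>v. v \<in> carrier_vec M \<Longrightarrow> v \<noteq> 0\<^sub>v M \<Longrightarrow> quad_form R v \<noteq> 0"
    and herm: "mat_adjoint (toeplitz_average M R) = toeplitz_average M R"
  shows "pos_semidef M (toeplitz_average M R)"
    and "\<And>v. v \<in> carrier_vec M \<Longrightarrow> v \<noteq> 0\<^sub>v M \<Longrightarrow> quad_form (toeplitz_average M R) v \<noteq> 0"
proof -
  have Rc: "R \<in> carrier_mat M M" and Rh: "mat_adjoint R = R" using R by (auto simp: pos_semidef_def)
  let ?e = "\<lambda>l. fourier_vec M (grid_point M l)"
  have e0: "?e l \<noteq> 0\<^sub>v M" for l
  proof
    assume "?e l = 0\<^sub>v M"
    then have "?e l $ 0 = 0" using M by simp
    then show False using M by (simp add: fourier_vec_def)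
  qed
  have qpos: "Re (quad_form R (?e l)) > 0" for l
  proof -
    have "quad_form R (?e l) = of_real (Re (quad_form R (?e l)))"
      by (rule hermitian_quadratic_form_real[OF Rc Rh]) simp
    moreover have "quad_form R (?e l) \<noteq> 0" using pos e0 by simp
    moreover have "Re (quad_form R (?e l)) \<ge> 0" using R by (simp add: pos_semidef_def)
    ultimately show ?thesis by (metis less_eq_real_def of_real_0)
  qed
  have eq: "2 * real M * real M * Re (quad_form (toeplitz_average M R) v) =
      (\<Sum>l<2 * M. Re (quad_form R (?e l)) * (cmod (v \<bullet>c ?e l))\<^sup>2)" if v: "v \<in> carrier_vec M" for v
    using arg_cong[OF quad_form_toeplitz_average[OF Rc v], of Re] by (simp add: mult_ac)
  have "Re (quad_form (toeplitz_average M R) v) \<ge> 0" if v: "v \<in> carrier_vec M" for v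
  proof -
    have "2 * real M * real M * Re (quad_form (toeplitz_average M R) v) \<ge> 0"
      unfolding eq[OF v] using qpos by (intro sum_nonneg mult_nonneg_nonneg) (auto simp: less_imp_le)
    moreover have "2 * real M * real M > 0" using M by simp
    ultimately show ?thesis by (metis mult_le_cancel_left_pos mult_zero_right)
  qed
  then show "pos_semidef M (toeplitz_average M R)"
    using herm by (simp add: pos_semidef_def)
  show "quad_form (toeplitz_average M R) v \<noteq> 0" if v: "v \<in> carrier_vec M" and nz: "v \<noteq> 0\<^sub>v M" for v
  proof
    assume "quad_form (toeplitz_average M R) v = 0"
    then have "(\<Sum>l<2 * M. Re (quad_form R (?e l)) * (cmod (v \<bullet>c ?e l))\<^sup>2) = 0"
      using eq[OF v] by simp
    moreover have "Re (quad_form R (?e l)) * (cmod (v \<bullet>c ?e l))\<^sup>2 \<ge> 0" for l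
      using qpos[of l] by simp
    ultimately have "\<forall>l<2 * M. Re (quad_form R (?e l)) * (cmod (v \<bullet>c ?e l))\<^sup>2 = 0"
      by (subst (asm) sum_nonneg_eq_0_iff) auto
    then have "v \<bullet>c ?e l = 0" if "l < 2 * M" for l
      using that qpos[of l] by auto
    then show False using fourier_vec_determines[OF v] nz by blast
  qed
qed

section \<open>Gaussian moments\<close>

lemma borel_measurable_cnj [measurable (raw)]:
  "f \<in> borel_measurable M \<Longrightarrow> (\<lambda>x. cnj (f x)) \<in> borel_measurable M"
  by (rule measurable_compose[of f M borel]) (auto intro!: borel_measurable_continuous_onI continuous_intros)

lemma sets_std_normal [simp, measurable_cong]: "sets std_normal = sets borel"
  by (simp add: std_normal_def)

lemma space_std_normal [simp]: "space std_normal = UNIV"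
  by (simp add: std_normal_def)

lemma prob_space_std_normal: "prob_space std_normal"
  unfolding std_normal_def by (rule prob_space_normal_density) simp

lemma nn_integral_normal_density:
  assumes "0 < \<sigma>"
  shows "(\<integral>\<^sup>+x. ennreal (normal_density m \<sigma> x) \<partial>lborel) = 1"
  using prob_space.emeasure_space_1[OF prob_space_normal_density[OF assms, of m]]
  by (simp add: emeasure_density)

lemma nn_integral_std_normal:
  assumes "f \<in> borel_measurable borel"
  shows "(\<integral>\<^sup>+x. f x \<partial>std_normal) = (\<integral>\<^sup>+x. ennreal (std_normal_density x) * f x \<partial>lborel)"
  unfolding std_normal_def using assms by (subst nn_integral_density) auto

lemma std_normal_exp_linear:
  "(\<integral>\<^sup>+x. ennreal (exp (a * x)) \<partial>std_normal) = ennreal (exp (a\<^sup>2 / 2))"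
proof -
  have "std_normal_density x * exp (a * x) = exp (a\<^sup>2 / 2) * normal_density a 1 x" for x
    by (simp add: normal_density_def std_normal_density_def field_simps power2_eq_square flip: exp_add exp_diff)
  then have "(\<integral>\<^sup>+x. ennreal (exp (a * x)) \<partial>std_normal) =
      (\<integral>\<^sup>+x. ennreal (exp (a\<^sup>2 / 2)) * ennreal (normal_density a 1 x) \<partial>lborel)"
    by (subst nn_integral_std_normal) (auto intro!: nn_integral_cong simp: ennreal_mult[symmetric])
  then show ?thesis by (simp add: nn_integral_cmult nn_integral_normal_density)
qed

lemma std_normal_exp_square:
  "(\<integral>\<^sup>+x. ennreal (exp (x\<^sup>2 / 4)) \<partial>std_normal) = ennreal (sqrt 2)"
proof -
  have "std_normal_density x * exp (x\<^sup>2 / 4) = sqrt 2 * normal_density 0 (sqrt 2) x" for x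
    by (simp add: normal_density_def std_normal_density_def real_sqrt_mult field_simps flip: exp_add exp_diff)
  then have "(\<integral>\<^sup>+x. ennreal (exp (x\<^sup>2 / 4)) \<partial>std_normal) =
      (\<integral>\<^sup>+x. ennreal (sqrt 2) * ennreal (normal_density 0 (sqrt 2) x) \<partial>lborel)"
    by (subst nn_integral_std_normal) (auto intro!: nn_integral_cong simp: ennreal_mult[symmetric])
  then show ?thesis by (simp add: nn_integral_cmult nn_integral_normal_density)
qed

lemma std_normal_second_moment:
  "integrable std_normal (\<lambda>x. x\<^sup>2)" "(\<integral>x. x\<^sup>2 \<partial>std_normal) = 1"
  "(\<integral>\<^sup>+x. ennreal (x\<^sup>2) \<partial>std_normal) = 1"
proof -
  have "has_bochner_integral lborel (\<lambda>x. std_normal_density x * x\<^sup>2) 1"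
    using std_normal_moment_even[of 1] by (simp add: numeral_2_eq_2)
  then have "has_bochner_integral std_normal (\<lambda>x. x\<^sup>2) 1"
    unfolding std_normal_def by (subst has_bochner_integral_density) auto
  then show 1: "integrable std_normal (\<lambda>x. x\<^sup>2)" "(\<integral>x. x\<^sup>2 \<partial>std_normal) = 1"
    by (auto simp: has_bochner_integral_iff)
  show "(\<integral>\<^sup>+x. ennreal (x\<^sup>2) \<partial>std_normal) = 1"
    using nn_integral_eq_integral[OF 1(1)] 1(2) by simp
qed

lemma std_normal_first_moment:
  "integrable std_normal (\<lambda>x. x)" "(\<integral>x. x \<partial>std_normal) = 0"
proof -
  have "has_bochner_integral lborel (\<lambda>x. std_normal_density x * x) 0"
    using std_normal_moment_odd[of 0] by simp
  then have "has_bochner_integral std_normal (\<lambda>x. x) 0"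
    unfolding std_normal_def by (subst has_bochner_integral_density) auto
  then show "integrable std_normal (\<lambda>x. x)" "(\<integral>x. x \<partial>std_normal) = 0"
    by (auto simp: has_bochner_integral_iff)
qed

text \<open>Decoupling: \<open>exp (|S|\<^sup>2 / 4)\<close> is itself a Gaussian average of exponentials linear in \<open>S\<close>.\<close>

lemma exp_square_moment_of_subgaussian:
  assumes \<mu>: "sigma_finite_measure \<mu>" and S [measurable]: "S \<in> borel_measurable \<mu>"
    and sub: "\<And>c. (\<integral>\<^sup>+\<omega>. ennreal (exp (Re (c * S \<omega>))) \<partial>\<mu>) \<le> ennreal (exp ((cmod c)\<^sup>2 / 2))"
  shows "(\<integral>\<^sup>+\<omega>. ennreal (exp ((cmod (S \<omega>))\<^sup>2 / 4)) \<partial>\<mu>) \<le> 2"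
proof -
  \<comment> \<open>With this scaling the Gaussian integral over \<open>x\<close> of \<open>exp (s x Re z)\<close> is \<open>exp ((Re z)\<^sup>2 / 4)\<close>.\<close>
  define s where "s = 1 / sqrt 2"
  have s2: "s\<^sup>2 = 1 / 2" by (simp add: s_def power_divide)
  interpret N: prob_space std_normal by (rule prob_space_std_normal)
  interpret \<mu>: sigma_finite_measure \<mu> by (rule \<mu>)
  interpret P: pair_sigma_finite std_normal \<mu> ..
  have decouple: "ennreal (exp ((cmod z)\<^sup>2 / 4)) =
      (\<integral>\<^sup>+x. \<integral>\<^sup>+y. ennreal (exp (Re (Complex (s * x) (- (s * y)) * z))) \<partial>std_normal \<partial>std_normal)" for z
  proof -
    have "(\<integral>\<^sup>+x. \<integral>\<^sup>+y. ennreal (exp (Re (Complex (s * x) (- (s * y)) * z))) \<partial>std_normal \<partial>std_normal) =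
        (\<integral>\<^sup>+x. ennreal (exp (s * Re z * x)) * (\<integral>\<^sup>+y. ennreal (exp (s * Im z * y)) \<partial>std_normal) \<partial>std_normal)"
      by (subst nn_integral_cmult[symmetric])
        (auto intro!: nn_integral_cong simp: ennreal_mult[symmetric] exp_add[symmetric] mult_ac)
    also have "\<dots> = ennreal (exp ((s * Re z)\<^sup>2 / 2)) * ennreal (exp ((s * Im z)\<^sup>2 / 2))"
      by (subst nn_integral_multc) (simp_all add: std_normal_exp_linear)
    also have "\<dots> = ennreal (exp ((cmod z)\<^sup>2 / 4))"
      by (simp add: ennreal_mult[symmetric] exp_add[symmetric] power_mult_distrib s2 cmod_power2 field_simps)
    finally show ?thesis by simp
  qed
  have "(\<integral>\<^sup>+\<omega>. ennreal (exp ((cmod (S \<omega>))\<^sup>2 / 4)) \<partial>\<mu>) =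
      (\<integral>\<^sup>+\<omega>. \<integral>\<^sup>+x. \<integral>\<^sup>+y. ennreal (exp (Re (Complex (s * x) (- (s * y)) * S \<omega>))) \<partial>std_normal \<partial>std_normal \<partial>\<mu>)"
    by (simp only: decouple)
  also have "\<dots> = (\<integral>\<^sup>+x. \<integral>\<^sup>+\<omega>. \<integral>\<^sup>+y. ennreal (exp (Re (Complex (s * x) (- (s * y)) * S \<omega>))) \<partial>std_normal \<partial>\<mu> \<partial>std_normal)"
    by (rule P.Fubini') simp
  also have "\<dots> = (\<integral>\<^sup>+x. \<integral>\<^sup>+y. \<integral>\<^sup>+\<omega>. ennreal (exp (Re (Complex (s * x) (- (s * y)) * S \<omega>))) \<partial>\<mu> \<partial>std_normal \<partial>std_normal)"
    by (intro nn_integral_cong P.Fubini') simp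
  also have "\<dots> \<le> (\<integral>\<^sup>+x. \<integral>\<^sup>+y. ennreal (exp ((cmod (Complex (s * x) (- (s * y))))\<^sup>2 / 2)) \<partial>std_normal \<partial>std_normal)"
    by (intro nn_integral_mono sub)
  also have "\<dots> = (\<integral>\<^sup>+x. ennreal (exp (x\<^sup>2 / 4)) * (\<integral>\<^sup>+y. ennreal (exp (y\<^sup>2 / 4)) \<partial>std_normal) \<partial>std_normal)"
    by (subst nn_integral_cmult[symmetric])
      (auto intro!: nn_integral_cong simp: ennreal_mult[symmetric] exp_add[symmetric] cmod_power2 power_mult_distrib s2 field_simps)
  also have "\<dots> = 2"
    by (subst nn_integral_multc) (simp_all add: std_normal_exp_square ennreal_mult[symmetric])
  finally show ?thesis .
qed

lemma prod_mono_ennreal: "(\<And>j. j \<in> A \<Longrightarrow> f j \<le> g j) \<Longrightarrow> prod f A \<le> prod g A" for f g :: "'a \<Rightarrow> ennreal"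
  by (induction A rule: infinite_finite_induct) (auto intro: mult_mono)

section \<open>Laws of the rows\<close>

lemma sets_cvec_space_component [measurable]:
  "j < M \<Longrightarrow> (\<lambda>z. z j) \<in> borel_measurable (cvec_space M)"
  unfolding cvec_space_def by (rule measurable_component_singleton) simp

lemma linear_form_measurable [measurable]:
  "(\<lambda>z. \<Sum>j<M. w j * z j) \<in> borel_measurable (cvec_space M)" for w :: "nat \<Rightarrow> complex"
  by (intro borel_measurable_sum borel_measurable_times) auto

text \<open>What the concentration argument uses of the law of a row. The constants 16 and 2 are chosen such
  that all admitted laws satisfy the condition in every dimension.\<close>

definition isotropic_subexponential :: "nat \<Rightarrow> (nat \<Rightarrow> complex) measure \<Rightarrow> bool" where
  "isotropic_subexponential M \<mu> \<longleftrightarrow> prob_space \<mu> \<and> sets \<mu> = sets (cvec_space M) \<and>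
     (\<forall>i<M. \<forall>j<M. (\<integral>z. z i * cnj (z j) \<partial>\<mu>) = (if i = j then 1 else 0)) \<and>
     (\<forall>w. (\<Sum>j<M. (cmod (w j))\<^sup>2) \<le> 1 \<longrightarrow>
       (\<integral>\<^sup>+z. ennreal (exp ((cmod (\<Sum>j<M. w j * z j))\<^sup>2 / 16)) \<partial>\<mu>) \<le> 2)"

text \<open>Independence of the coordinates turns a Gaussian bound for the exponential moments of each
  coordinate into one for all linear forms; decoupling then bounds the square of the linear form.\<close>

lemma isotropic_product_law:
  assumes \<nu>: "prob_space \<nu>" and sets [simp, measurable_cong]: "sets \<nu> = sets borel"
    and sub: "\<And>c. (\<integral>\<^sup>+z. ennreal (exp (Re (c * z))) \<partial>\<nu>) \<le> ennreal (exp ((cmod c)\<^sup>2 / 2))"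
    and mean: "integrable \<nu> (\<lambda>z. z)" "(\<integral>z. z \<partial>\<nu>) = 0"
    and var: "(\<integral>z. z * cnj z \<partial>\<nu>) = (1::complex)"
  shows "isotropic_subexponential M (PiM {..<M} (\<lambda>_. \<nu>))"
proof -
  interpret \<nu>: prob_space \<nu> by (rule \<nu>)
  interpret product_prob_space "\<lambda>_. \<nu>" "{..<M}" ..
  let ?\<mu> = "PiM {..<M} (\<lambda>_. \<nu>)"
  have sets_\<mu> [measurable_cong]: "sets ?\<mu> = sets (cvec_space M)"
    unfolding cvec_space_def by (intro sets_PiM_cong) auto
  have prob: "prob_space ?\<mu>" by (rule prob_space_PiM) (rule \<nu>)
  have "(\<integral>z. z i * cnj (z j) \<partial>?\<mu>) = (if i = j then 1 else 0)" if ij: "i < M" "j < M" for i j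
  proof (cases "i = j")
    case True
    have "(\<lambda>x. x * cnj x) \<in> borel_measurable \<nu>"
      by (subst measurable_cong_sets[OF sets refl]) measurable
    then have "(\<integral>z. z i * cnj (z i) \<partial>?\<mu>) = (\<integral>x. x * cnj x \<partial>distr ?\<mu> \<nu> (\<lambda>z. z i))"
      using ij by (subst integral_distr) auto
    also have "\<dots> = 1" using ij var by (simp add: PiM_component)
    finally show ?thesis using True by simp
  next
    case False
    define h where "h k = (\<lambda>x::complex. if k = i then x else if k = j then cnj x else 1)" for k
    have int: "integrable \<nu> (h k)" for k
      using mean(1) integrable_cnj[of \<nu> "\<lambda>x. x"] by (cases "k = i"; cases "k = j") (simp_all add: h_def)
    have "z i * cnj (z j) = (\<Prod>k<M. h k (z k))" for z
    proof -
      have "(\<Prod>k<M. h k (z k)) = h i (z i) * (\<Prod>k\<in>{..<M} - {i}. h k (z k))"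
        using ij by (intro prod.remove) auto
      also have "(\<Prod>k\<in>{..<M} - {i}. h k (z k)) = h j (z j) * (\<Prod>k\<in>{..<M} - {i} - {j}. h k (z k))"
        using ij False by (intro prod.remove) auto
      also have "(\<Prod>k\<in>{..<M} - {i} - {j}. h k (z k)) = 1"
        by (intro prod.neutral) (auto simp: h_def)
      finally show ?thesis using False by (simp add: h_def)
    qed
    then have "(\<integral>z. z i * cnj (z j) \<partial>?\<mu>) = (\<integral>z. (\<Prod>k<M. h k (z k)) \<partial>?\<mu>)" by simp
    also have "\<dots> = (\<Prod>k<M. \<integral>x. h k x \<partial>\<nu>)"
      by (rule product_integral_prod) (auto simp: int)
    also have "\<dots> = 0"
      using ij mean(2) by (intro prod_zero) (auto simp: h_def intro!: bexI[of _ i])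
    finally show ?thesis using False by simp
  qed
  moreover have "(\<integral>\<^sup>+z. ennreal (exp ((cmod (\<Sum>j<M. w j * z j))\<^sup>2 / 16)) \<partial>?\<mu>) \<le> 2"
    if w: "(\<Sum>j<M. (cmod (w j))\<^sup>2) \<le> 1" for w
  proof -
    have "(\<integral>\<^sup>+z. ennreal (exp (Re (c * (\<Sum>j<M. w j * z j)))) \<partial>?\<mu>) \<le> ennreal (exp ((cmod c)\<^sup>2 / 2))" for c
    proof -
      have "(\<integral>\<^sup>+z. ennreal (exp (Re (c * (\<Sum>j<M. w j * z j)))) \<partial>?\<mu>) =
          (\<integral>\<^sup>+z. (\<Prod>j<M. ennreal (exp (Re (c * w j * z j)))) \<partial>?\<mu>)"
        by (intro nn_integral_cong)
          (simp add: prod_ennreal exp_sum[symmetric] sum_distrib_left mult.assoc del: times_complex.simps)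
      also have "\<dots> = (\<Prod>j<M. \<integral>\<^sup>+x. ennreal (exp (Re (c * w j * x))) \<partial>\<nu>)"
        by (rule product_nn_integral_prod, simp, subst measurable_cong_sets[OF sets refl], measurable)
      also have "\<dots> \<le> (\<Prod>j<M. ennreal (exp ((cmod (c * w j))\<^sup>2 / 2)))"
        by (intro prod_mono_ennreal sub)
      also have "\<dots> = ennreal (exp ((cmod c)\<^sup>2 / 2 * (\<Sum>j<M. (cmod (w j))\<^sup>2)))"
        by (simp add: prod_ennreal exp_sum[symmetric] norm_mult power_mult_distrib sum_distrib_left)
      also have "\<dots> \<le> ennreal (exp ((cmod c)\<^sup>2 / 2))"
        using w mult_left_mono[OF w, of "(cmod c)\<^sup>2 / 2"] by (intro ennreal_leI) simp
      finally show ?thesis .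
    qed
    then have "(\<integral>\<^sup>+z. ennreal (exp ((cmod (\<Sum>j<M. w j * z j))\<^sup>2 / 4)) \<partial>?\<mu>) \<le> 2"
      using prob by (intro exp_square_moment_of_subgaussian)
        (auto intro: prob_space_imp_sigma_finite)
    moreover have "(\<integral>\<^sup>+z. ennreal (exp ((cmod (\<Sum>j<M. w j * z j))\<^sup>2 / 16)) \<partial>?\<mu>) \<le>
        (\<integral>\<^sup>+z. ennreal (exp ((cmod (\<Sum>j<M. w j * z j))\<^sup>2 / 4)) \<partial>?\<mu>)"
      by (intro nn_integral_mono ennreal_leI) simp
    ultimately show ?thesis by (rule order_trans[rotated])
  qed
  ultimately show ?thesis using prob sets_\<mu> by (simp add: isotropic_subexponential_def)
qed

lemma normal_real_vec_isotropic: "isotropic_subexponential M (normal_real_vec M)"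
  unfolding normal_real_vec_def
proof (rule isotropic_product_law)
  interpret N: prob_space std_normal by (rule prob_space_std_normal)
  show "prob_space (distr std_normal borel complex_of_real)" by (rule N.prob_space_distr) simp
  show "(\<integral>\<^sup>+z. ennreal (exp (Re (c * z))) \<partial>distr std_normal borel complex_of_real) \<le> ennreal (exp ((cmod c)\<^sup>2 / 2))" for c
    by (subst nn_integral_distr) (auto simp: std_normal_exp_linear cmod_power2 intro!: ennreal_leI)
  show "integrable (distr std_normal borel complex_of_real) (\<lambda>z. z)"
    using std_normal_first_moment(1) by (subst integrable_distr_eq) auto
  show "(\<integral>z. z \<partial>distr std_normal borel complex_of_real) = 0"
    using std_normal_first_moment by (subst integral_distr) auto
  have "(\<integral>z. z * cnj z \<partial>distr std_normal borel complex_of_real) = (\<integral>x. of_real (x\<^sup>2) \<partial>std_normal)"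
    by (subst integral_distr) (auto simp: power2_eq_square)
  also have "\<dots> = of_real (\<integral>x. x\<^sup>2 \<partial>std_normal)" by (rule integral_complex_of_real)
  finally show "(\<integral>z. z * cnj z \<partial>distr std_normal borel complex_of_real) = 1"
    by (simp add: std_normal_second_moment)
qed simp

lemma normal_complex_vec_isotropic: "isotropic_subexponential M (normal_complex_vec M)"
  unfolding normal_complex_vec_def
proof (rule isotropic_product_law)
  interpret N: prob_space std_normal by (rule prob_space_std_normal)
  interpret P: pair_prob_space std_normal std_normal ..
  let ?P = "std_normal \<Otimes>\<^sub>M std_normal"
  define s :: real where "s = 1 / sqrt 2"
  have s2: "s\<^sup>2 = 1 / 2" by (simp add: s_def power_divide)
  have cs: "complex_std_normal = distr ?P borel (\<lambda>(x, y). Complex (s * x) (s * y))"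
    unfolding complex_std_normal_def
    by (intro arg_cong[where f = "distr ?P borel"] ext) (auto simp: complex_eq_iff s_def)
  have cplx: "Complex (s * x) (s * y) = of_real s * of_real x + \<i> * of_real s * of_real y" for x y
    by (simp add: complex_eq_iff)
  have [measurable]: "(\<lambda>(x, y). Complex (s * x) (s * y)) \<in> borel_measurable ?P"
    by (simp add: cplx case_prod_beta)
  show "prob_space complex_std_normal" unfolding cs by (rule P.prob_space_distr) simp
  show "sets complex_std_normal = sets borel" by (simp add: cs)
  show "(\<integral>\<^sup>+z. ennreal (exp (Re (c * z))) \<partial>complex_std_normal) \<le> ennreal (exp ((cmod c)\<^sup>2 / 2))" for c
  proof -
    have "(\<integral>\<^sup>+z. ennreal (exp (Re (c * z))) \<partial>complex_std_normal) =
        (\<integral>\<^sup>+p. ennreal (exp (s * Re c * fst p)) * ennreal (exp (- s * Im c * snd p)) \<partial>?P)"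
      unfolding cs by (subst nn_integral_distr, simp, simp)
        (auto intro!: nn_integral_cong simp: ennreal_mult[symmetric] exp_add[symmetric] mult_ac)
    also have "\<dots> = (\<integral>\<^sup>+x. ennreal (exp (s * Re c * x)) * (\<integral>\<^sup>+y. ennreal (exp (- s * Im c * y)) \<partial>std_normal) \<partial>std_normal)"
      by (subst N.nn_integral_fst[symmetric]) (auto simp: nn_integral_cmult)
    also have "\<dots> = ennreal (exp ((s * Re c)\<^sup>2 / 2)) * ennreal (exp ((- s * Im c)\<^sup>2 / 2))"
      by (subst nn_integral_multc) (simp_all only: std_normal_exp_linear, simp)
    also have "\<dots> = ennreal (exp ((cmod c)\<^sup>2 / 4))"
      by (simp add: ennreal_mult[symmetric] exp_add[symmetric] power_mult_distrib s2 cmod_power2 field_simps)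
    also have "\<dots> \<le> ennreal (exp ((cmod c)\<^sup>2 / 2))" by (intro ennreal_leI) simp
    finally show ?thesis .
  qed
  have fst: "distr ?P std_normal fst = std_normal"
    by (simp add: N.distr_pair_fst N.emeasure_space_1)
  have "distr ?P std_normal snd = distr (distr ?P ?P (\<lambda>(x, y). (y, x))) std_normal snd"
    using P.distr_pair_swap by simp
  also have "\<dots> = distr ?P std_normal fst"
    by (subst distr_distr) (auto simp: comp_def case_prod_beta)
  finally have snd: "distr ?P std_normal snd = std_normal" using fst by simp
  have int_fst: "integrable ?P (\<lambda>p. h (fst p))" "(\<integral>p. h (fst p) \<partial>?P) = integral\<^sup>L std_normal h"
    if "integrable std_normal h" for h :: "real \<Rightarrow> real"
    using that integrable_distr_eq[of fst ?P std_normal h] integral_distr[of fst ?P std_normal h] fst by auto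
  have int_snd: "integrable ?P (\<lambda>p. h (snd p))" "(\<integral>p. h (snd p) \<partial>?P) = integral\<^sup>L std_normal h"
    if "integrable std_normal h" for h :: "real \<Rightarrow> real"
    using that integrable_distr_eq[of snd ?P std_normal h] integral_distr[of snd ?P std_normal h] snd by auto
  note m1 = int_fst[OF std_normal_first_moment(1)] int_snd[OF std_normal_first_moment(1)]
  note m2 = int_fst[OF std_normal_second_moment(1)] int_snd[OF std_normal_second_moment(1)]
  show "integrable complex_std_normal (\<lambda>z. z)"
    unfolding cs using m1 by (subst integrable_distr_eq) (auto simp: case_prod_unfold cplx)
  show "(\<integral>z. z \<partial>complex_std_normal) = 0"
    unfolding cs using m1 std_normal_first_moment by (subst integral_distr) (auto simp: case_prod_unfold cplx)
  have "(\<integral>z. z * cnj z \<partial>complex_std_normal) = (\<integral>p. of_real (1 / 2 * (fst p)\<^sup>2 + 1 / 2 * (snd p)\<^sup>2) \<partial>?P)"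
    unfolding cs
  proof (subst integral_distr)
    have "Complex (s * x) (s * y) * cnj (Complex (s * x) (s * y)) = of_real (1 / 2 * x\<^sup>2 + 1 / 2 * y\<^sup>2)" for x y
      unfolding complex_norm_square[symmetric] cmod_power2 by (simp add: power_mult_distrib s2)
    then show "(\<integral>p. (case p of (x, y) \<Rightarrow> Complex (s * x) (s * y)) * cnj (case p of (x, y) \<Rightarrow> Complex (s * x) (s * y)) \<partial>?P)
      = (\<integral>p. of_real (1 / 2 * (fst p)\<^sup>2 + 1 / 2 * (snd p)\<^sup>2) \<partial>?P)"
      by (simp add: case_prod_beta)
  qed auto
  also have "\<dots> = of_real (\<integral>p. 1 / 2 * (fst p)\<^sup>2 + 1 / 2 * (snd p)\<^sup>2 \<partial>?P)"
    by (rule integral_complex_of_real)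
  also have "(\<integral>p. 1 / 2 * (fst p)\<^sup>2 + 1 / 2 * (snd p)\<^sup>2 \<partial>?P) = 1"
    using m2 std_normal_second_moment(2) by simp
  finally show "(\<integral>z. z * cnj z \<partial>complex_std_normal) = 1" by simp
qed

subsection \<open>Uniform laws on spheres\<close>

text \<open>The reflection in the hyperplane orthogonal to \<open>v\<close>; for \<open>v = 0\<close> it is the identity, since the
  quotient is then 0.\<close>

definition householder :: "nat \<Rightarrow> (nat \<Rightarrow> real) \<Rightarrow> complex mat" where
  "householder M v = Matrix.mat M M (\<lambda>(i, j).
     of_real ((if i = j then 1 else 0) - 2 * v i * v j / (\<Sum>k<M. (v k)\<^sup>2)))"

lemma householder_carrier [simp]: "householder M v \<in> carrier_mat M M"
  by (simp add: householder_def)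

lemma householder_orthogonal: "householder M v \<in> orthogonal_group M"
proof -
  define s where "s = (\<Sum>k<M. (v k)\<^sup>2)"
  have H: "householder M v $$ (i, j) = of_real ((if i = j then 1 else 0) - 2 * v i * v j / s)"
    if "i < M" "j < M" for i j
    using that by (simp add: householder_def s_def)
  have "mat_adjoint (householder M v) * householder M v = 1\<^sub>m M"
  proof (rule eq_matI)
    fix i j assume "i < dim_row (1\<^sub>m M :: complex mat)" "j < dim_col (1\<^sub>m M :: complex mat)"
    then have ij: "i < M" "j < M" by auto
    have "(mat_adjoint (householder M v) * householder M v) $$ (i, j) =
        of_real (\<Sum>k<M. ((if k = i then 1 else 0) - 2 * v k * v i / s) * ((if k = j then 1 else 0) - 2 * v k * v j / s))"
      unfolding mult_mat_sum[OF mat_adjoint_carrier[OF householder_carrier] householder_carrier ij] of_real_sum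
      using ij by (intro sum.cong refl) (simp only: mat_adjoint_index[OF householder_carrier] H lessThan_iff complex_cnj_complex_of_real of_real_mult)
    also have "(\<Sum>k<M. ((if k = i then 1 else 0) - 2 * v k * v i / s) * ((if k = j then 1 else 0) - 2 * v k * v j / s))
        = (\<Sum>k<M. (if k = i then (if i = j then 1 else 0) else 0) - (if k = i then 2 * v i * v j / s else 0)
            - (if k = j then 2 * v i * v j / s else 0) + 4 * v i * v j / s\<^sup>2 * (v k)\<^sup>2)"
      by (intro sum.cong refl) (auto simp: algebra_simps power2_eq_square)
    also have "\<dots> = (if i = j then 1 else 0) - 2 * v i * v j / s - 2 * v i * v j / s + 4 * v i * v j / s\<^sup>2 * s"
      using ij by (simp add: sum.distrib sum_subtractf s_def sum_distrib_left)
    also have "\<dots> = (if i = j then 1 else 0)"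
      by (cases "s = 0") (auto simp: field_simps power2_eq_square)
    finally show "(mat_adjoint (householder M v) * householder M v) $$ (i, j) = (1\<^sub>m M :: complex mat) $$ (i, j)"
      using ij by simp
  qed (auto simp: householder_def)
  then show ?thesis
    by (auto simp: orthogonal_group_def unitary_group_def H)
qed

lemma mat_act_householder:
  assumes "i < M"
  shows "mat_act M (householder M v) x i =
    x i - of_real (2 * v i / (\<Sum>k<M. (v k)\<^sup>2)) * (\<Sum>j<M. of_real (v j) * x j)"
proof -
  define s where "s = (\<Sum>k<M. (v k)\<^sup>2)"
  have "mat_act M (householder M v) x i = (\<Sum>j<M. (if j = i then x i else 0) - of_real (2 * v i / s) * (of_real (v j) * x j))"
    using assms by (simp add: mat_act_def householder_def s_def algebra_simps cong: sum.cong) (auto intro!: sum.cong simp: algebra_simps)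
  then show ?thesis using assms by (simp add: sum_subtractf s_def sum_distrib_left)
qed

lemma mat_act_measurable [measurable]: "mat_act M U \<in> measurable (cvec_space M) (cvec_space M)"
  unfolding mat_act_def cvec_space_def
  by (intro measurable_restrict) (auto intro!: borel_measurable_sum borel_measurable_times measurable_component_singleton)

text \<open>A vector drawn from an orthogonally invariant law on the sphere, paired with an independent
  Gaussian \<open>g\<close>, can be treated in two ways. Given \<open>u\<close>, the pairing is Gaussian. Given \<open>g\<close>, it is
  distributed as \<open>\<parallel>g\<parallel> u\<^sub>0\<close>, where by Jensen's inequality \<open>\<parallel>g\<parallel>\<^sup>2\<close> may be replaced by its mean \<open>M\<close>. So the
  exponential moment of the sphere is at most the Gaussian one.\<close>

lemma sphere_exp_moment:
  assumes \<mu>: "prob_space \<mu>" and sets [simp, measurable_cong]: "sets \<mu> = sets (cvec_space M)"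
    and sphere: "AE u in \<mu>. u \<in> complex_sphere M"
    and inv: "\<And>U. U \<in> orthogonal_group M \<Longrightarrow> distr \<mu> (cvec_space M) (mat_act M U) = \<mu>"
    and M: "M > 0" and p: "(\<Sum>j<M. (p j)\<^sup>2) \<le> 1"
  shows "(\<integral>\<^sup>+u. ennreal (exp (real M / 4 * (cmod (\<Sum>j<M. of_real (p j) * u j))\<^sup>2)) \<partial>\<mu>) \<le> 2"
proof -
  interpret \<mu>: prob_space \<mu> by (rule \<mu>)
  interpret N: prob_space std_normal by (rule prob_space_std_normal)
  interpret PS: product_prob_space "\<lambda>_. std_normal" "{..<M}" ..
  let ?G = "PiM {..<M} (\<lambda>_. std_normal)"
  interpret G: prob_space ?G by (rule prob_space_PiM) (rule prob_space_std_normal)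
  interpret P: pair_sigma_finite \<mu> ?G ..
  have u0 [measurable]: "(\<lambda>u. u 0) \<in> borel_measurable (cvec_space M)" using M by simp
  have hom: "(\<integral>\<^sup>+u. ennreal (exp (t * (cmod (\<Sum>j<M. of_real (q j) * u j))\<^sup>2)) \<partial>\<mu>) =
      (\<integral>\<^sup>+u. ennreal (exp (t * ((\<Sum>j<M. (q j)\<^sup>2) * (cmod (u 0))\<^sup>2))) \<partial>\<mu>)" for q :: "nat \<Rightarrow> real" and t
  proof (cases "(\<Sum>j<M. (q j)\<^sup>2) = 0")
    case True
    then have "\<forall>j<M. q j = 0" by (simp add: sum_nonneg_eq_0_iff)
    then show ?thesis using True by simp
  next
    case False
    define r where "r = sqrt (\<Sum>j<M. (q j)\<^sup>2)"
    have r2: "r\<^sup>2 = (\<Sum>j<M. (q j)\<^sup>2)" by (simp add: r_def sum_nonneg)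
    then have r: "r \<noteq> 0" using False by auto
    define q' where "q' j = q j / r" for j
    have q'1: "(\<Sum>j<M. (q' j)\<^sup>2) = 1"
      using False by (simp add: q'_def power_divide r2 flip: sum_divide_distrib)
    have split0: "(\<Sum>j<M. h j) = h 0 + (\<Sum>j\<in>{..<M} - {0}. h j)" for h :: "nat \<Rightarrow> 'z::comm_monoid_add"
      using M by (intro sum.remove) auto
    \<comment> \<open>The reflection along \<open>v\<close> exchanges the first unit vector and \<open>q'\<close>.\<close>
    define v where "v j = (if j = 0 then 1 else 0) - q' j" for j
    have s: "(\<Sum>j<M. (v j)\<^sup>2) = 2 * v 0"
    proof -
      have "(\<Sum>j\<in>{..<M} - {0}. (v j)\<^sup>2) = (\<Sum>j\<in>{..<M} - {0}. (q' j)\<^sup>2)"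
        by (intro sum.cong refl) (simp add: v_def)
      also have "\<dots> = 1 - (q' 0)\<^sup>2" using q'1 split0[of "\<lambda>j. (q' j)\<^sup>2"] by simp
      finally show ?thesis unfolding split0[of "\<lambda>j. (v j)\<^sup>2"] by (simp add: v_def power2_eq_square algebra_simps)
    qed
    have act: "mat_act M (householder M v) u 0 = (\<Sum>j<M. of_real (q' j) * u j)" for u
    proof -
      have dot: "(\<Sum>j<M. of_real (v j) * u j) = u 0 - (\<Sum>j<M. of_real (q' j) * u j)"
        unfolding split0[of "\<lambda>j. of_real (v j) * u j"] split0[of "\<lambda>j. of_real (q' j) * u j"]
        by (simp add: v_def sum_negf algebra_simps)
      show ?thesis
      proof (cases "v 0 = 0")
        case True
        then have "\<forall>j<M. v j = 0" using s by (simp add: sum_nonneg_eq_0_iff)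
        then have "(\<Sum>j<M. of_real (v j) * u j) = 0" by simp
        then show ?thesis using True dot by (simp add: mat_act_householder[OF M])
      next
        case False
        then show ?thesis by (simp add: mat_act_householder[OF M] s dot)
      qed
    qed
    have "(\<integral>\<^sup>+u. ennreal (exp (t * ((\<Sum>j<M. (q j)\<^sup>2) * (cmod (u 0))\<^sup>2))) \<partial>\<mu>) =
        (\<integral>\<^sup>+u. ennreal (exp (t * (r\<^sup>2 * (cmod (u 0))\<^sup>2))) \<partial>distr \<mu> (cvec_space M) (mat_act M (householder M v)))"
      using inv[OF householder_orthogonal] by (simp add: r2)
    also have "\<dots> = (\<integral>\<^sup>+u. ennreal (exp (t * (r\<^sup>2 * (cmod (\<Sum>j<M. of_real (q' j) * u j))\<^sup>2))) \<partial>\<mu>)"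
      by (subst nn_integral_distr) (simp_all add: act)
    also have "\<dots> = (\<integral>\<^sup>+u. ennreal (exp (t * (cmod (\<Sum>j<M. of_real (q j) * u j))\<^sup>2)) \<partial>\<mu>)"
    proof (intro nn_integral_cong arg_cong[of _ _ ennreal] arg_cong[of _ _ exp] arg_cong[of _ _ "(*) t"])
      fix u :: "nat \<Rightarrow> complex"
      have "(\<Sum>j<M. of_real (q j) * u j) = of_real r * (\<Sum>j<M. of_real (q' j) * u j)"
        using r by (simp add: sum_distrib_left q'_def)
      then show "r\<^sup>2 * (cmod (\<Sum>j<M. of_real (q' j) * u j))\<^sup>2 = (cmod (\<Sum>j<M. of_real (q j) * u j))\<^sup>2"
        by (simp add: norm_mult power_mult_distrib)
    qed
    finally show ?thesis by simp
  qed
  have gauss: "(\<integral>\<^sup>+g. ennreal (exp ((cmod (\<Sum>j<M. of_real (g j) * u j))\<^sup>2 / 4)) \<partial>?G) \<le> 2"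
    if u: "u \<in> complex_sphere M" for u
  proof (rule exp_square_moment_of_subgaussian)
    have u1: "(\<Sum>j<M. (cmod (u j))\<^sup>2) = 1" using u by (simp add: complex_sphere_def)
    show "sigma_finite_measure ?G" by unfold_locales
    show "(\<lambda>g. \<Sum>j<M. of_real (g j) * u j) \<in> borel_measurable ?G"
      by (intro borel_measurable_sum borel_measurable_times) measurable
    fix c :: complex
    have "(\<integral>\<^sup>+g. ennreal (exp (Re (c * (\<Sum>j<M. of_real (g j) * u j)))) \<partial>?G) =
        (\<integral>\<^sup>+g. (\<Prod>j<M. ennreal (exp (Re (c * u j) * g j))) \<partial>?G)"
      by (intro nn_integral_cong)
        (simp add: prod_ennreal exp_sum[symmetric] sum_distrib_left algebra_simps)
    also have "\<dots> = (\<Prod>j<M. \<integral>\<^sup>+x. ennreal (exp (Re (c * u j) * x)) \<partial>std_normal)"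
      by (rule PS.product_nn_integral_prod) auto
    also have "\<dots> = (\<Prod>j<M. ennreal (exp ((Re (c * u j))\<^sup>2 / 2)))"
      by (simp only: std_normal_exp_linear)
    also have "\<dots> \<le> (\<Prod>j<M. ennreal (exp ((cmod c)\<^sup>2 * (cmod (u j))\<^sup>2 / 2)))"
    proof (intro prod_mono_ennreal ennreal_leI)
      fix j
      have "(Re (c * u j))\<^sup>2 \<le> (cmod (c * u j))\<^sup>2"
        using abs_Re_le_cmod[of "c * u j"] by (metis abs_ge_zero power2_abs power_mono)
      then show "exp ((Re (c * u j))\<^sup>2 / 2) \<le> exp ((cmod c)\<^sup>2 * (cmod (u j))\<^sup>2 / 2)"
        by (simp add: norm_mult power_mult_distrib)
    qed
    also have "\<dots> = ennreal (exp ((cmod c)\<^sup>2 / 2 * (\<Sum>j<M. (cmod (u j))\<^sup>2)))"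
      by (simp add: prod_ennreal exp_sum[symmetric] sum_distrib_left)
    finally show "(\<integral>\<^sup>+g. ennreal (exp (Re (c * (\<Sum>j<M. of_real (g j) * u j)))) \<partial>?G) \<le> ennreal (exp ((cmod c)\<^sup>2 / 2))"
      by (simp add: u1)
  qed
  have jensen: "ennreal (exp \<tau>) \<le> (\<integral>\<^sup>+x. ennreal (exp (\<tau> * x\<^sup>2)) \<partial>std_normal)" if \<tau>: "0 \<le> \<tau>" "\<tau> \<le> 1" for \<tau>
  proof -
    have "ennreal (exp \<tau>) = ennreal (exp \<tau> * (1 - \<tau>)) + ennreal (exp \<tau> * \<tau>)"
      using \<tau> by (subst ennreal_plus[symmetric]) (auto simp: algebra_simps)
    also have "\<dots> = (\<integral>\<^sup>+x. ennreal (exp \<tau> * (1 - \<tau>)) + ennreal (exp \<tau> * \<tau>) * ennreal (x\<^sup>2) \<partial>std_normal)"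
      by (subst nn_integral_add) (auto simp: nn_integral_cmult std_normal_second_moment N.emeasure_space_1[simplified])
    also have "\<dots> \<le> (\<integral>\<^sup>+x. ennreal (exp (\<tau> * x\<^sup>2)) \<partial>std_normal)"
    proof (intro nn_integral_mono)
      fix x
      have "exp \<tau> * (1 + \<tau> * (x\<^sup>2 - 1)) \<le> exp \<tau> * exp (\<tau> * (x\<^sup>2 - 1))"
        by (intro mult_left_mono exp_ge_add_one_self) auto
      also have "\<dots> = exp (\<tau> * x\<^sup>2)" by (simp add: exp_add[symmetric] algebra_simps)
      finally show "ennreal (exp \<tau> * (1 - \<tau>)) + ennreal (exp \<tau> * \<tau>) * ennreal (x\<^sup>2) \<le> ennreal (exp (\<tau> * x\<^sup>2))"
        using \<tau> by (simp add: ennreal_mult[symmetric] ennreal_plus[symmetric] algebra_simps del: ennreal_plus)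
    qed
    finally show ?thesis .
  qed
  have lower: "ennreal (exp (real M * \<tau>)) \<le> (\<integral>\<^sup>+g. ennreal (exp (\<tau> * (\<Sum>j<M. (g j)\<^sup>2))) \<partial>?G)"
    if \<tau>: "0 \<le> \<tau>" "\<tau> \<le> 1" for \<tau>
  proof -
    have "ennreal (exp (real M * \<tau>)) = (\<Prod>j<M. ennreal (exp \<tau>))"
      by (simp add: ennreal_power exp_of_nat_mult)
    also have "\<dots> \<le> (\<Prod>j<M. \<integral>\<^sup>+x. ennreal (exp (\<tau> * x\<^sup>2)) \<partial>std_normal)"
      by (intro prod_mono_ennreal jensen \<tau>)
    also have "\<dots> = (\<integral>\<^sup>+g. (\<Prod>j<M. ennreal (exp (\<tau> * (g j)\<^sup>2))) \<partial>?G)"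
      by (rule PS.product_nn_integral_prod[symmetric]) auto
    also have "\<dots> = (\<integral>\<^sup>+g. ennreal (exp (\<tau> * (\<Sum>j<M. (g j)\<^sup>2))) \<partial>?G)"
      by (intro nn_integral_cong) (simp add: prod_ennreal exp_sum[symmetric] sum_distrib_left)
    finally show ?thesis .
  qed
  have gj: "(\<lambda>q. snd q j) \<in> borel_measurable (\<mu> \<Otimes>\<^sub>M ?G)" if "j < M" for j
  proof -
    have "(\<lambda>g. g j) \<in> measurable ?G std_normal"
      using that by (intro measurable_component_singleton) simp
    then have "(\<lambda>q. snd q j) \<in> measurable (\<mu> \<Otimes>\<^sub>M ?G) std_normal"
      by (rule measurable_compose[OF measurable_snd])
    then show ?thesis by (simp cong: measurable_cong_sets)
  qed
  have uj: "(\<lambda>q. fst q j) \<in> borel_measurable (\<mu> \<Otimes>\<^sub>M ?G)" if "j < M" for j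
    using sets_cvec_space_component[OF that] by (intro measurable_compose[OF measurable_fst]) simp
  have [measurable]: "(\<lambda>q. \<Sum>j<M. of_real (snd q j) * fst q j) \<in> borel_measurable (\<mu> \<Otimes>\<^sub>M ?G)"
    using gj uj by (intro borel_measurable_sum borel_measurable_times borel_measurable_of_real) auto
  have [measurable]: "(\<lambda>q. \<Sum>j<M. (snd q j)\<^sup>2) \<in> borel_measurable (\<mu> \<Otimes>\<^sub>M ?G)"
    using gj by (intro borel_measurable_sum borel_measurable_power) auto
  have "(\<integral>\<^sup>+u. ennreal (exp (real M / 4 * (cmod (\<Sum>j<M. of_real (p j) * u j))\<^sup>2)) \<partial>\<mu>) =
      (\<integral>\<^sup>+u. ennreal (exp (real M / 4 * ((\<Sum>j<M. (p j)\<^sup>2) * (cmod (u 0))\<^sup>2))) \<partial>\<mu>)"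
    by (rule hom)
  also have "\<dots> \<le> (\<integral>\<^sup>+u. ennreal (exp (real M * ((cmod (u 0))\<^sup>2 / 4))) \<partial>\<mu>)"
  proof (intro nn_integral_mono ennreal_leI)
    fix u :: "nat \<Rightarrow> complex"
    have "(\<Sum>j<M. (p j)\<^sup>2) * (cmod (u 0))\<^sup>2 \<le> 1 * (cmod (u 0))\<^sup>2" using p by (intro mult_right_mono) auto
    then show "exp (real M / 4 * ((\<Sum>j<M. (p j)\<^sup>2) * (cmod (u 0))\<^sup>2)) \<le> exp (real M * ((cmod (u 0))\<^sup>2 / 4))"
      using M by simp
  qed
  also have "\<dots> \<le> (\<integral>\<^sup>+u. \<integral>\<^sup>+g. ennreal (exp ((cmod (u 0))\<^sup>2 / 4 * (\<Sum>j<M. (g j)\<^sup>2))) \<partial>?G \<partial>\<mu>)"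
  proof (rule nn_integral_mono_AE)
    show "AE u in \<mu>. ennreal (exp (real M * ((cmod (u 0))\<^sup>2 / 4))) \<le> (\<integral>\<^sup>+g. ennreal (exp ((cmod (u 0))\<^sup>2 / 4 * (\<Sum>j<M. (g j)\<^sup>2))) \<partial>?G)"
      using sphere
    proof eventually_elim
      fix u assume u: "u \<in> complex_sphere M"
      have "(cmod (u 0))\<^sup>2 \<le> (\<Sum>j<M. (cmod (u j))\<^sup>2)" using M by (intro member_le_sum) auto
      then have "(cmod (u 0))\<^sup>2 \<le> 1" using u by (simp add: complex_sphere_def)
      then show "ennreal (exp (real M * ((cmod (u 0))\<^sup>2 / 4))) \<le> (\<integral>\<^sup>+g. ennreal (exp ((cmod (u 0))\<^sup>2 / 4 * (\<Sum>j<M. (g j)\<^sup>2))) \<partial>?G)"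
        by (intro lower) auto
    qed
  qed
  also have "\<dots> = (\<integral>\<^sup>+g. \<integral>\<^sup>+u. ennreal (exp ((cmod (u 0))\<^sup>2 / 4 * (\<Sum>j<M. (g j)\<^sup>2))) \<partial>\<mu> \<partial>?G)"
    by (rule P.Fubini'[symmetric]) (simp add: case_prod_unfold)
  also have "\<dots> = (\<integral>\<^sup>+g. \<integral>\<^sup>+u. ennreal (exp ((cmod (\<Sum>j<M. of_real (g j) * u j))\<^sup>2 / 4)) \<partial>\<mu> \<partial>?G)"
  proof (rule nn_integral_cong)
    fix g :: "nat \<Rightarrow> real"
    show "(\<integral>\<^sup>+u. ennreal (exp ((cmod (u 0))\<^sup>2 / 4 * (\<Sum>j<M. (g j)\<^sup>2))) \<partial>\<mu>) =
        (\<integral>\<^sup>+u. ennreal (exp ((cmod (\<Sum>j<M. of_real (g j) * u j))\<^sup>2 / 4)) \<partial>\<mu>)"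
      using hom[of "1 / 4" g] by (simp add: mult_ac)
  qed
  also have "\<dots> = (\<integral>\<^sup>+u. \<integral>\<^sup>+g. ennreal (exp ((cmod (\<Sum>j<M. of_real (g j) * u j))\<^sup>2 / 4)) \<partial>?G \<partial>\<mu>)"
    by (rule P.Fubini') (simp add: case_prod_unfold)
  also have "\<dots> \<le> (\<integral>\<^sup>+u. 2 \<partial>\<mu>)"
    using sphere gauss by (intro nn_integral_mono_AE) auto
  finally show ?thesis by (simp add: \<mu>.emeasure_space_1)
qed

text \<open>Reflections include the sign changes and the transpositions of coordinates; these make the
  covariance a multiple of the identity, and the multiple is found from the trace.\<close>

lemma sphere_second_moments:
  assumes \<mu>: "prob_space \<mu>" and sets [simp, measurable_cong]: "sets \<mu> = sets (cvec_space M)"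
    and sphere: "AE u in \<mu>. u \<in> complex_sphere M"
    and inv: "\<And>U. U \<in> orthogonal_group M \<Longrightarrow> distr \<mu> (cvec_space M) (mat_act M U) = \<mu>"
    and ij: "i < M" "j < M"
  shows "(\<integral>u. u i * cnj (u j) \<partial>\<mu>) = (if i = j then 1 / of_nat M else 0)"
proof -
  interpret \<mu>: prob_space \<mu> by (rule \<mu>)
  have comp [measurable]: "(\<lambda>u. u k) \<in> borel_measurable \<mu>" if "k < M" for k
    using sets_cvec_space_component[OF that] by simp
  have int: "integrable \<mu> (\<lambda>u. u k * cnj (u l))" if kl: "k < M" "l < M" for k l
  proof (rule \<mu>.integrable_const_bound[where B = 1])
    show "AE u in \<mu>. cmod (u k * cnj (u l)) \<le> 1"
      using sphere
    proof eventually_elim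
      fix u assume u: "u \<in> complex_sphere M"
      have le: "cmod (u m) \<le> 1" if "m < M" for m
      proof -
        have "(cmod (u m))\<^sup>2 \<le> (\<Sum>j<M. (cmod (u j))\<^sup>2)" using that by (intro member_le_sum) auto
        then have "(cmod (u m))\<^sup>2 \<le> 1\<^sup>2" using u by (simp add: complex_sphere_def)
        then show ?thesis by (rule power2_le_imp_le) simp
      qed
      show "cmod (u k * cnj (u l)) \<le> 1"
        unfolding norm_mult complex_mod_cnj using mult_mono[OF le[OF kl(1)] le[OF kl(2)]] by simp
    qed
  qed (use kl in measurable)
  have invint: "(\<integral>u. u k * cnj (u l) \<partial>\<mu>) =
      (\<integral>u. mat_act M (householder M v) u k * cnj (mat_act M (householder M v) u l) \<partial>\<mu>)"
    if kl: "k < M" "l < M" for k l v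
  proof -
    have "(\<integral>u. u k * cnj (u l) \<partial>\<mu>) = (\<integral>u. u k * cnj (u l) \<partial>distr \<mu> (cvec_space M) (mat_act M (householder M v)))"
      using inv[OF householder_orthogonal] by simp
    also have "\<dots> = (\<integral>u. mat_act M (householder M v) u k * cnj (mat_act M (householder M v) u l) \<partial>\<mu>)"
      using kl by (subst integral_distr) (auto intro!: borel_measurable_times borel_measurable_cnj)
    finally show ?thesis .
  qed
  show ?thesis
  proof (cases "i = j")
    case False
    \<comment> \<open>the sign change of the coordinate \<open>i\<close>\<close>
    define v where "v k = (if k = i then 1 else 0 :: real)" for k
    have s: "(\<Sum>k<M. (v k)\<^sup>2) = 1" using ij by (simp add: v_def if_distrib[of "\<lambda>x. x\<^sup>2"] cong: if_cong)
    have "of_real (v k) * u k = (if k = i then u i else 0)" for k and u :: "nat \<Rightarrow> complex"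
      by (simp add: v_def)
    then have dot: "(\<Sum>k<M. of_real (v k) * u k) = u i" for u :: "nat \<Rightarrow> complex"
      using ij by simp
    have "mat_act M (householder M v) u i = - u i" "mat_act M (householder M v) u j = u j" for u
      using ij False by (simp_all add: mat_act_householder s dot) (simp_all add: v_def)
    then have "(\<integral>u. u i * cnj (u j) \<partial>\<mu>) = - (\<integral>u. u i * cnj (u j) \<partial>\<mu>)"
      using invint[OF ij, of v] by simp
    then show ?thesis using False by simp
  next
    case True
    have eq: "(\<integral>u. u k * cnj (u k) \<partial>\<mu>) = (\<integral>u. u i * cnj (u i) \<partial>\<mu>)" if k: "k < M" for k
    proof (cases "k = i")
      case False
      \<comment> \<open>the transposition of the coordinates \<open>i\<close> and \<open>k\<close>\<close>
      define v where "v l = (if l = i then 1 else 0) - (if l = k then 1 else 0 :: real)" for l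
      have "(v l)\<^sup>2 = (if l = i then 1 else 0) + (if l = k then 1 else 0)" for l
        using False by (simp add: v_def)
      then have s: "(\<Sum>l<M. (v l)\<^sup>2) = 2" using ij k by (simp add: sum.distrib)
      have "of_real (v l) * u l = (if l = i then u i else 0) - (if l = k then u k else 0)" for l and u :: "nat \<Rightarrow> complex"
        using False by (simp add: v_def)
      then have dot: "(\<Sum>l<M. of_real (v l) * u l) = u i - u k" for u :: "nat \<Rightarrow> complex"
        using ij k by (simp add: sum_subtractf)
      have "mat_act M (householder M v) u k = u i" for u
        using k False by (simp add: mat_act_householder s dot) (simp add: v_def)
      then show ?thesis using invint[OF k k, of v] by simp
    qed simp
    have "of_nat M * (\<integral>u. u i * cnj (u i) \<partial>\<mu>) = (\<Sum>k<M. \<integral>u. u k * cnj (u k) \<partial>\<mu>)"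
      by (simp add: eq)
    also have "\<dots> = (\<integral>u. (\<Sum>k<M. u k * cnj (u k)) \<partial>\<mu>)"
      by (rule Bochner_Integration.integral_sum[symmetric]) (simp add: int)
    also have "\<dots> = (\<integral>u. 1 \<partial>\<mu>)"
    proof (rule integral_cong_AE)
      show "AE u in \<mu>. (\<Sum>k<M. u k * cnj (u k)) = 1"
        using sphere
      proof eventually_elim
        fix u assume "u \<in> complex_sphere M"
        then have "of_real (\<Sum>k<M. (cmod (u k))\<^sup>2) = (1::complex)" by (simp add: complex_sphere_def)
        then show "(\<Sum>k<M. u k * cnj (u k)) = 1" by (simp add: complex_norm_square del: of_real_power)
      qed
    qed (auto intro!: borel_measurable_sum)
    also have "\<dots> = 1" by (simp add: \<mu>.prob_space)
    finally show ?thesis using True ij by (auto simp: field_simps)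
  qed
qed

text \<open>The moment bound for real \<open>w\<close> extends to complex \<open>w\<close> by splitting into real and imaginary part and
  convexity; this costs the factor between 4 and 16 in the exponent.\<close>

lemma scaled_sphere_isotropic:
  assumes \<mu>: "prob_space \<mu>" and sets [simp, measurable_cong]: "sets \<mu> = sets (cvec_space M)"
    and sphere: "AE u in \<mu>. u \<in> complex_sphere M"
    and inv: "\<And>U. U \<in> orthogonal_group M \<Longrightarrow> distr \<mu> (cvec_space M) (mat_act M U) = \<mu>"
    and M: "M > 0"
  shows "isotropic_subexponential M (scale_law M (sqrt (real M)) \<mu>)"
proof -
  interpret \<mu>: prob_space \<mu> by (rule \<mu>)
  let ?sc = "\<lambda>x. \<lambda>j\<in>{..<M}. complex_of_real (sqrt (real M)) * x j"
  have sc [measurable]: "?sc \<in> measurable (cvec_space M) (cvec_space M)"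
    unfolding cvec_space_def by (intro measurable_restrict) (auto intro!: measurable_component_singleton borel_measurable_times)
  then have sc' [measurable]: "?sc \<in> measurable \<mu> (cvec_space M)" by simp
  have "prob_space (scale_law M (sqrt (real M)) \<mu>)"
    unfolding scale_law_def by (rule \<mu>.prob_space_distr) simp
  moreover have "(\<integral>z. z i * cnj (z j) \<partial>scale_law M (sqrt (real M)) \<mu>) = (if i = j then 1 else 0)"
    if ij: "i < M" "j < M" for i j
  proof -
    define r where "r = sqrt (real M)"
    have "(\<integral>z. z i * cnj (z j) \<partial>scale_law M (sqrt (real M)) \<mu>) = (\<integral>u. ?sc u i * cnj (?sc u j) \<partial>\<mu>)"
      unfolding scale_law_def by (rule integral_distr[OF sc']) (use ij in measurable)
    also have "\<dots> = (\<integral>u. of_real (r * r) * (u i * cnj (u j)) \<partial>\<mu>)"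
      unfolding r_def[symmetric] using ij by (intro Bochner_Integration.integral_cong refl) (simp add: mult_ac)
    also have "of_real (r * r) = complex_of_nat M" by (simp add: r_def)
    also have "(\<integral>u. of_nat M * (u i * cnj (u j)) \<partial>\<mu>) = of_nat M * (\<integral>u. u i * cnj (u j) \<partial>\<mu>)"
      by (rule integral_mult_right_zero)
    finally show ?thesis using M by (simp add: sphere_second_moments[OF \<mu> sets sphere inv ij])
  qed
  moreover have "(\<integral>\<^sup>+z. ennreal (exp ((cmod (\<Sum>j<M. w j * z j))\<^sup>2 / 16)) \<partial>scale_law M (sqrt (real M)) \<mu>) \<le> 2"
    if w: "(\<Sum>j<M. (cmod (w j))\<^sup>2) \<le> 1" for w
  proof -
    let ?p = "\<lambda>u. (cmod (\<Sum>j<M. of_real (Re (w j)) * u j))\<^sup>2"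
    let ?q = "\<lambda>u. (cmod (\<Sum>j<M. of_real (Im (w j)) * u j))\<^sup>2"
    have comb: "ennreal h * ennreal x + ennreal h * ennreal y = ennreal (h * x + h * y)"
      if "0 \<le> h" "0 \<le> x" "0 \<le> y" for h x y
      using that by (simp add: ennreal_mult)
    have le: "(\<Sum>j<M. (Re (w j))\<^sup>2) \<le> 1" "(\<Sum>j<M. (Im (w j))\<^sup>2) \<le> 1"
      using w by (auto simp: cmod_power2 sum.distrib intro: order_trans[rotated] simp: sum_nonneg)
    have "(\<integral>\<^sup>+z. ennreal (exp ((cmod (\<Sum>j<M. w j * z j))\<^sup>2 / 16)) \<partial>scale_law M (sqrt (real M)) \<mu>) =
        (\<integral>\<^sup>+u. ennreal (exp (real M * (cmod (\<Sum>j<M. w j * u j))\<^sup>2 / 16)) \<partial>\<mu>)"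
      unfolding scale_law_def
    proof -
      have "(\<Sum>j<M. w j * ?sc u j) = of_real (sqrt (real M)) * (\<Sum>j<M. w j * u j)" for u
        unfolding sum_distrib_left by (intro sum.cong refl) simp
      then have "(cmod (\<Sum>j<M. w j * ?sc u j))\<^sup>2 = real M * (cmod (\<Sum>j<M. w j * u j))\<^sup>2" for u
        by (simp add: norm_mult power_mult_distrib)
      moreover have "(\<lambda>z. ennreal (exp ((cmod (\<Sum>j<M. w j * z j))\<^sup>2 / 16))) \<in> borel_measurable (distr \<mu> (cvec_space M) ?sc)"
        unfolding measurable_distr_eq1 by measurable
      ultimately show "(\<integral>\<^sup>+z. ennreal (exp ((cmod (\<Sum>j<M. w j * z j))\<^sup>2 / 16)) \<partial>distr \<mu> (cvec_space M) ?sc) =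
          (\<integral>\<^sup>+u. ennreal (exp (real M * (cmod (\<Sum>j<M. w j * u j))\<^sup>2 / 16)) \<partial>\<mu>)"
        by (simp only: nn_integral_distr[OF sc'])
    qed
    also have "\<dots> \<le> (\<integral>\<^sup>+u. ennreal (1 / 2) * ennreal (exp (real M / 4 * ?p u)) + ennreal (1 / 2) * ennreal (exp (real M / 4 * ?q u)) \<partial>\<mu>)"
    proof (intro nn_integral_mono)
      fix u :: "nat \<Rightarrow> complex"
      define S where "S = (\<Sum>j<M. of_real (Re (w j)) * u j)"
      define T where "T = (\<Sum>j<M. of_real (Im (w j)) * u j)"
      have "(\<Sum>j<M. w j * u j) = S + \<i> * T"
        unfolding S_def T_def sum_distrib_left sum.distrib[symmetric]
        by (intro sum.cong refl) (subst (1) complex_eq, simp add: algebra_simps)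
      then have "cmod (\<Sum>j<M. w j * u j) \<le> cmod S + cmod T"
        using norm_triangle_ineq[of S "\<i> * T"] by (simp add: norm_mult)
      then have "(cmod (\<Sum>j<M. w j * u j))\<^sup>2 \<le> (cmod S + cmod T)\<^sup>2" by (intro power_mono) auto
      also have "\<dots> \<le> 2 * (cmod S)\<^sup>2 + 2 * (cmod T)\<^sup>2"
        using zero_le_power2[of "cmod S - cmod T"] by (simp add: power2_eq_square algebra_simps)
      finally have le1: "real M * (cmod (\<Sum>j<M. w j * u j))\<^sup>2 / 16 \<le> real M / 8 * (cmod S)\<^sup>2 + real M / 8 * (cmod T)\<^sup>2"
        using mult_left_mono[of "(cmod (\<Sum>j<M. w j * u j))\<^sup>2" "2 * (cmod S)\<^sup>2 + 2 * (cmod T)\<^sup>2" "real M / 16"]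
        by (simp add: algebra_simps)
      have "exp (real M * (cmod (\<Sum>j<M. w j * u j))\<^sup>2 / 16) \<le> exp (real M / 8 * (cmod S)\<^sup>2) * exp (real M / 8 * (cmod T)\<^sup>2)"
        unfolding exp_add[symmetric] using le1 by simp
      also have "\<dots> \<le> 1 / 2 * (exp (real M / 8 * (cmod S)\<^sup>2))\<^sup>2 + 1 / 2 * (exp (real M / 8 * (cmod T)\<^sup>2))\<^sup>2"
        using zero_le_power2[of "exp (real M / 8 * (cmod S)\<^sup>2) - exp (real M / 8 * (cmod T)\<^sup>2)"]
        by (simp add: power2_eq_square algebra_simps)
      also have "\<dots> = 1 / 2 * exp (real M / 4 * (cmod S)\<^sup>2) + 1 / 2 * exp (real M / 4 * (cmod T)\<^sup>2)"
        by (simp add: exp_double[symmetric])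
      finally show "ennreal (exp (real M * (cmod (\<Sum>j<M. w j * u j))\<^sup>2 / 16)) \<le>
          ennreal (1 / 2) * ennreal (exp (real M / 4 * ?p u)) + ennreal (1 / 2) * ennreal (exp (real M / 4 * ?q u))"
        unfolding S_def T_def by (subst comb) (auto intro!: ennreal_leI simp del: ennreal_plus)
    qed
    also have "\<dots> = ennreal (1 / 2) * (\<integral>\<^sup>+u. ennreal (exp (real M / 4 * ?p u)) \<partial>\<mu>) + ennreal (1 / 2) * (\<integral>\<^sup>+u. ennreal (exp (real M / 4 * ?q u)) \<partial>\<mu>)"
      by (subst nn_integral_add) (auto simp: nn_integral_cmult)
    also have "\<dots> \<le> ennreal (1 / 2) * 2 + ennreal (1 / 2) * 2"
      using le by (intro add_mono mult_left_mono sphere_exp_moment[OF \<mu> sets sphere inv M]) auto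
    also have "\<dots> = ennreal (1 / 2 * 2 + 1 / 2 * 2)"
      by (simp only: ennreal_mult' ennreal_numeral ennreal_plus)
    also have "\<dots> = 2" by simp
    finally show ?thesis .
  qed
  ultimately show ?thesis by (simp add: isotropic_subexponential_def scale_law_def)
qed

text \<open>The unitary group contains the orthogonal one, and the real sphere lies in the complex one; so a
  single result on spheres covers both.\<close>

lemma row_laws_isotropic:
  assumes "\<mu> \<in> row_laws M" "M > 0"
  shows "isotropic_subexponential M \<mu>"
proof -
  have "isotropic_subexponential M (scale_law M (sqrt (real M)) \<nu>)"
    if "haar_on_sphere M (orthogonal_group M) (real_sphere M) \<nu>" for \<nu>
    using that assms(2) unfolding haar_on_sphere_def
    by (intro scaled_sphere_isotropic) (auto simp: real_sphere_def elim: eventually_mono)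
  moreover have "isotropic_subexponential M (scale_law M (sqrt (real M)) \<nu>)"
    if "haar_on_sphere M (unitary_group M) (complex_sphere M) \<nu>" for \<nu>
    using that assms(2) unfolding haar_on_sphere_def
    by (intro scaled_sphere_isotropic) (auto simp: orthogonal_group_def)
  ultimately show ?thesis
    using assms(1) normal_real_vec_isotropic normal_complex_vec_isotropic
    unfolding row_laws_def by auto
qed

section \<open>Concentration of weighted sums\<close>

lemma exp_le_quadratic: "exp x \<le> 1 + x + x\<^sup>2 / 2 * exp \<bar>x\<bar>" for x :: real
proof -
  obtain t where t: "\<bar>t\<bar> \<le> \<bar>x\<bar>" "exp x = (\<Sum>m<2. x ^ m / fact m) + exp t / fact 2 * x ^ 2"
    using Maclaurin_exp_le[of x 2] by blast
  have "exp t * x\<^sup>2 \<le> exp \<bar>x\<bar> * x\<^sup>2" using t(1) by (intro mult_right_mono) auto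
  then show ?thesis unfolding t(2) by (simp add: numeral_2_eq_2 field_simps)
qed

lemma (in prob_space) integrable_of_exp_moment:
  assumes Y [measurable]: "Y \<in> borel_measurable M" and pos: "\<And>\<omega>. Y \<omega> \<ge> 0"
    and mom: "(\<integral>\<^sup>+\<omega>. ennreal (exp (Y \<omega> / 16)) \<partial>M) \<le> 2"
  shows "integrable M (\<lambda>\<omega>. exp (Y \<omega> / 16))" and "expectation (\<lambda>\<omega>. exp (Y \<omega> / 16)) \<le> 2"
    and "integrable M Y"
proof -
  have "(\<integral>\<^sup>+\<omega>. ennreal (exp (Y \<omega> / 16)) \<partial>M) < \<infinity>"
    using mom ennreal_less_top[of 2] by (simp add: le_less_trans)
  then show int: "integrable M (\<lambda>\<omega>. exp (Y \<omega> / 16))" by (intro integrableI_nonneg) auto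
  have "ennreal (expectation (\<lambda>\<omega>. exp (Y \<omega> / 16))) \<le> ennreal 2"
    using mom by (subst nn_integral_eq_integral[symmetric, OF int]) auto
  then show "expectation (\<lambda>\<omega>. exp (Y \<omega> / 16)) \<le> 2" by (subst (asm) ennreal_le_iff) auto
  show "integrable M Y"
  proof (rule Bochner_Integration.integrable_bound)
    show "integrable M (\<lambda>\<omega>. 16 * exp (Y \<omega> / 16))" using int by simp
    show "AE \<omega> in M. norm (Y \<omega>) \<le> norm (16 * exp (Y \<omega> / 16))"
    proof (rule AE_I2)
      fix \<omega>
      have "1 + Y \<omega> / 16 \<le> exp (Y \<omega> / 16)" by (rule exp_ge_add_one_self)
      then have "Y \<omega> \<le> 16 * exp (Y \<omega> / 16)" by linarith
      then show "norm (Y \<omega>) \<le> norm (16 * exp (Y \<omega> / 16))" using pos[of \<omega>] by simp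
    qed
  qed simp
qed

text \<open>For \<open>\<bar>t\<bar> \<le> 1/32\<close> the second order term of \<open>exp (t (Y - 1))\<close> is dominated by \<open>t\<^sup>2 exp (Y / 16)\<close>;
  the first order term has mean 0.\<close>

lemma (in prob_space) centred_exp_moment:
  assumes Y [measurable]: "Y \<in> borel_measurable M" and pos: "\<And>\<omega>. Y \<omega> \<ge> 0"
    and mom: "(\<integral>\<^sup>+\<omega>. ennreal (exp (Y \<omega> / 16)) \<partial>M) \<le> 2"
    and mean: "expectation Y = 1" and t: "\<bar>t\<bar> \<le> 1 / 32"
  shows "(\<integral>\<^sup>+\<omega>. ennreal (exp (t * (Y \<omega> - 1))) \<partial>M) \<le> ennreal (exp (4096 * t\<^sup>2))"
proof -
  note int = integrable_of_exp_moment[OF Y pos mom]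
  define B where "B \<omega> = 1 + t * (Y \<omega> - 1) + 2048 * t\<^sup>2 * exp (Y \<omega> / 16)" for \<omega>
  have le: "exp (t * (Y \<omega> - 1)) \<le> B \<omega>" for \<omega>
  proof -
    define z where "z = Y \<omega> - 1"
    define e where "e = exp ((Y \<omega> + 1) / 32)"
    have z: "\<bar>z\<bar> \<le> Y \<omega> + 1" using pos[of \<omega>] by (simp add: z_def)
    have "z\<^sup>2 \<le> (Y \<omega> + 1)\<^sup>2" using z by (metis abs_ge_zero power2_abs power_mono)
    \<comment> \<open>\<open>u\<^sup>2 / 2 \<le> exp u\<close> at \<open>u = (Y + 1) / 32\<close>; half of the exponent 1/16 is spent here, the other half on
      the exponential factor.\<close>
    also have "\<dots> = 2048 * (((Y \<omega> + 1) / 32)\<^sup>2 / 2)" by (simp add: power_divide)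
    also have "\<dots> \<le> 2048 * e"
    proof (rule mult_left_mono)
      have "0 \<le> (Y \<omega> + 1) / 32" using pos[of \<omega>] by simp
      then show "((Y \<omega> + 1) / 32)\<^sup>2 / 2 \<le> e"
        using exp_lower_Taylor_quadratic[of "(Y \<omega> + 1) / 32"] unfolding e_def by linarith
    qed simp
    finally have z2: "z\<^sup>2 \<le> 2048 * e" .
    have "\<bar>t * z\<bar> \<le> 1 / 32 * (Y \<omega> + 1)"
      unfolding abs_mult using t z by (intro mult_mono) auto
    then have ee: "exp \<bar>t * z\<bar> \<le> e" by (simp add: e_def)
    have e2: "e * e = exp (1 / 16) * exp (Y \<omega> / 16)"
      by (simp add: e_def exp_add[symmetric] field_simps)
    have "exp (1 / 16 :: real) \<le> 1 + 1 / 16 + (1 / 16)\<^sup>2" by (rule exp_bound) auto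
    also have "\<dots> \<le> 2" by (simp add: power2_eq_square)
    finally have e16: "exp (1 / 16 :: real) \<le> 2" .
    have "(t * z)\<^sup>2 / 2 * exp \<bar>t * z\<bar> \<le> t\<^sup>2 * (2048 * e) / 2 * e"
      unfolding power_mult_distrib using z2 ee
      by (intro mult_mono divide_right_mono mult_left_mono) (auto simp: e_def)
    also have "\<dots> = 1024 * t\<^sup>2 * exp (Y \<omega> / 16) * exp (1 / 16)" using e2 by (simp add: mult_ac)
    also have "\<dots> \<le> 1024 * t\<^sup>2 * exp (Y \<omega> / 16) * 2" using e16 by (intro mult_left_mono) auto
    finally show ?thesis using exp_le_quadratic[of "t * z"] by (simp add: B_def z_def)
  qed
  have intB: "integrable M B" unfolding B_def using int by simp
  have "(\<integral>\<^sup>+\<omega>. ennreal (exp (t * (Y \<omega> - 1))) \<partial>M) \<le> (\<integral>\<^sup>+\<omega>. ennreal (B \<omega>) \<partial>M)"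
    by (intro nn_integral_mono ennreal_leI le)
  also have "\<dots> = ennreal (expectation B)"
    using intB le by (intro nn_integral_eq_integral) (auto intro: order_trans[OF exp_ge_zero])
  also have "expectation B = 1 + 2048 * t\<^sup>2 * expectation (\<lambda>\<omega>. exp (Y \<omega> / 16))"
    unfolding B_def using int mean by (simp add: prob_space)
  also have "ennreal \<dots> \<le> ennreal (1 + 4096 * t\<^sup>2)"
    using mult_left_mono[OF int(2), of "2048 * t\<^sup>2"] by (intro ennreal_leI) simp
  also have "\<dots> \<le> ennreal (exp (4096 * t\<^sup>2))" by (intro ennreal_leI exp_ge_add_one_self)
  finally show ?thesis .
qed

text \<open>Chernoff's bound in both directions. The exponent \<open>s\<close> is limited by the largest weight, since
  \<open>centred_exp_moment\<close> is available for parameters up to 1/32 only.\<close>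

lemma (in prob_space) weighted_sum_concentration:
  fixes Y :: "nat \<Rightarrow> 'a \<Rightarrow> real" and a :: "nat \<Rightarrow> real"
  assumes indep: "indep_vars (\<lambda>_. borel) Y {..<n}" and pos: "\<And>i \<omega>. Y i \<omega> \<ge> 0"
    and mom: "\<And>i. i < n \<Longrightarrow> (\<integral>\<^sup>+\<omega>. ennreal (exp (Y i \<omega> / 16)) \<partial>M) \<le> 2"
    and mean: "\<And>i. i < n \<Longrightarrow> expectation (Y i) = 1"
    and a: "\<And>i. i < n \<Longrightarrow> 0 \<le> a i" "\<And>i. i < n \<Longrightarrow> s * a i \<le> 1 / 32" "(\<Sum>i<n. a i) = 1"
    and s: "s > 0" and V: "(\<Sum>i<n. (a i)\<^sup>2) \<le> V"
  shows "prob {\<omega> \<in> space M. \<bar>(\<Sum>i<n. a i * Y i \<omega>) - 1\<bar> \<ge> \<epsilon>} \<le> 2 * exp (4096 * s\<^sup>2 * V - s * \<epsilon>)"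
proof -
  have Y [measurable]: "Y i \<in> borel_measurable M" if "i < n" for i
    using indep that by (auto simp: indep_vars_def)
  have tail: "emeasure M {\<omega> \<in> space M. \<sigma> * ((\<Sum>i<n. a i * Y i \<omega>) - 1) \<ge> \<epsilon>} \<le> ennreal (exp (4096 * s\<^sup>2 * V - s * \<epsilon>))"
    if \<sigma>: "\<bar>\<sigma>\<bar> = 1" for \<sigma> :: real
  proof -
    let ?f = "\<lambda>\<omega>. \<sigma> * ((\<Sum>i<n. a i * Y i \<omega>) - 1)"
    have f: "s * ?f \<omega> = (\<Sum>i<n. s * \<sigma> * a i * (Y i \<omega> - 1))" for \<omega>
    proof -
      have "(\<Sum>i<n. a i * Y i \<omega>) - 1 = (\<Sum>i<n. a i * Y i \<omega>) - (\<Sum>i<n. a i)" using a(3) by simp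
      also have "\<dots> = (\<Sum>i<n. a i * (Y i \<omega> - 1))" by (simp add: right_diff_distrib sum_subtractf)
      finally show ?thesis by (simp add: sum_distrib_left mult_ac)
    qed
    have [measurable]: "?f \<in> borel_measurable M"
      by (intro borel_measurable_times borel_measurable_diff borel_measurable_sum) auto
    have "emeasure M {\<omega> \<in> space M. ?f \<omega> \<ge> \<epsilon>} \<le>
        ennreal (exp (- s * \<epsilon>)) * (\<integral>\<^sup>+\<omega>. ennreal (exp (s * ?f \<omega>)) * indicator (space M) \<omega> \<partial>M)"
      using s by (intro Chernoff_ineq_nn_integral_ge) auto
    also have "(\<integral>\<^sup>+\<omega>. ennreal (exp (s * ?f \<omega>)) * indicator (space M) \<omega> \<partial>M) =
        (\<integral>\<^sup>+\<omega>. (\<Prod>i<n. ennreal (exp (s * \<sigma> * a i * (Y i \<omega> - 1)))) \<partial>M)"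
      unfolding f by (intro nn_integral_cong) (simp add: exp_sum prod_ennreal)
    also have "\<dots> = (\<Prod>i<n. \<integral>\<^sup>+\<omega>. ennreal (exp (s * \<sigma> * a i * (Y i \<omega> - 1))) \<partial>M)"
    proof (rule indep_vars_nn_integral)
      show "indep_vars (\<lambda>_. borel) (\<lambda>i \<omega>. ennreal (exp (s * \<sigma> * a i * (Y i \<omega> - 1)))) {..<n}"
        by (rule indep_vars_compose2[OF indep]) measurable
    qed auto
    also have "\<dots> \<le> (\<Prod>i<n. ennreal (exp (4096 * (s * \<sigma> * a i)\<^sup>2)))"
    proof (intro prod_mono_ennreal centred_exp_moment)
      fix i assume "i \<in> {..<n}"
      then have i: "i < n" by simp
      show "\<bar>s * \<sigma> * a i\<bar> \<le> 1 / 32" using a(1,2)[OF i] s \<sigma> by (simp add: abs_mult)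
    qed (use mom mean pos in auto)
    also have "\<dots> = ennreal (exp (4096 * s\<^sup>2 * (\<Sum>i<n. (a i)\<^sup>2)))"
    proof -
      have "\<sigma>\<^sup>2 = 1" using \<sigma> by (metis power2_abs power_one)
      then have "(\<Sum>i<n. 4096 * (s * \<sigma> * a i)\<^sup>2) = 4096 * s\<^sup>2 * (\<Sum>i<n. (a i)\<^sup>2)"
        unfolding sum_distrib_left by (intro sum.cong refl) (simp add: power_mult_distrib)
      then show ?thesis by (simp add: prod_ennreal exp_sum[symmetric])
    qed
    also have "\<dots> \<le> ennreal (exp (4096 * s\<^sup>2 * V))"
      using V by (intro ennreal_leI) (simp add: mult_left_mono)
    finally have "emeasure M {\<omega> \<in> space M. ?f \<omega> \<ge> \<epsilon>} \<le> ennreal (exp (- s * \<epsilon>)) * ennreal (exp (4096 * s\<^sup>2 * V))"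
      by (simp add: mult_left_mono)
    then show ?thesis by (simp add: ennreal_mult[symmetric] exp_add[symmetric])
  qed
  have [measurable]: "(\<lambda>\<omega>. \<Sum>i<n. a i * Y i \<omega>) \<in> borel_measurable M"
    by (intro borel_measurable_sum borel_measurable_times) auto
  have "{\<omega> \<in> space M. \<bar>(\<Sum>i<n. a i * Y i \<omega>) - 1\<bar> \<ge> \<epsilon>} \<subseteq>
      {\<omega> \<in> space M. 1 * ((\<Sum>i<n. a i * Y i \<omega>) - 1) \<ge> \<epsilon>} \<union> {\<omega> \<in> space M. (- 1) * ((\<Sum>i<n. a i * Y i \<omega>) - 1) \<ge> \<epsilon>}"
    by auto
  then have "emeasure M {\<omega> \<in> space M. \<bar>(\<Sum>i<n. a i * Y i \<omega>) - 1\<bar> \<ge> \<epsilon>} \<le>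
      emeasure M ({\<omega> \<in> space M. 1 * ((\<Sum>i<n. a i * Y i \<omega>) - 1) \<ge> \<epsilon>} \<union> {\<omega> \<in> space M. (- 1) * ((\<Sum>i<n. a i * Y i \<omega>) - 1) \<ge> \<epsilon>})"
    by (rule emeasure_mono) measurable
  also have "\<dots> \<le> emeasure M {\<omega> \<in> space M. 1 * ((\<Sum>i<n. a i * Y i \<omega>) - 1) \<ge> \<epsilon>} + emeasure M {\<omega> \<in> space M. (- 1) * ((\<Sum>i<n. a i * Y i \<omega>) - 1) \<ge> \<epsilon>}"
    by (rule emeasure_subadditive) measurable
  also have "\<dots> \<le> ennreal (exp (4096 * s\<^sup>2 * V - s * \<epsilon>)) + ennreal (exp (4096 * s\<^sup>2 * V - s * \<epsilon>))"
    by (intro add_mono tail) auto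
  also have "\<dots> = ennreal (2 * exp (4096 * s\<^sup>2 * V - s * \<epsilon>))" by (simp add: ennreal_plus[symmetric] del: ennreal_plus)
  finally show ?thesis by (simp add: emeasure_eq_measure)
qed

lemma isotropic_second_moment:
  assumes iso: "isotropic_subexponential M \<mu>" and w: "(\<Sum>j<M. (cmod (w j))\<^sup>2) = 1"
  shows "(\<integral>z. (cmod (\<Sum>j<M. w j * z j))\<^sup>2 \<partial>\<mu>) = 1"
proof -
  have \<mu>: "prob_space \<mu>" and sets [simp, measurable_cong]: "sets \<mu> = sets (cvec_space M)"
    and cov: "\<And>i j. i < M \<Longrightarrow> j < M \<Longrightarrow> (\<integral>z. z i * cnj (z j) \<partial>\<mu>) = (if i = j then 1 else 0)"
    and mom: "\<And>w. (\<Sum>j<M. (cmod (w j))\<^sup>2) \<le> 1 \<Longrightarrow>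
       (\<integral>\<^sup>+z. ennreal (exp ((cmod (\<Sum>j<M. w j * z j))\<^sup>2 / 16)) \<partial>\<mu>) \<le> 2"
    using iso by (auto simp: isotropic_subexponential_def)
  interpret \<mu>: prob_space \<mu> by (rule \<mu>)
  have meas [measurable]: "(\<lambda>z. \<Sum>j<M. v j * z j) \<in> borel_measurable \<mu>" for v :: "nat \<Rightarrow> complex"
    by simp
  have sq: "integrable \<mu> (\<lambda>z. (cmod (\<Sum>j<M. v j * z j))\<^sup>2)" if "(\<Sum>j<M. (cmod (v j))\<^sup>2) \<le> 1" for v
    using mom[OF that] by (intro \<mu>.integrable_of_exp_moment(3)) auto
  have sqi: "integrable \<mu> (\<lambda>z. (cmod (z i))\<^sup>2)" if i: "i < M" for i
  proof -
    define e where "e j = (if j = i then 1 else 0 :: complex)" for j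
    have "(\<Sum>j<M. (cmod (e j))\<^sup>2) = (\<Sum>j<M. if j = i then 1 else 0)" by (intro sum.cong refl) (simp add: e_def)
    then have "(\<Sum>j<M. (cmod (e j))\<^sup>2) \<le> 1" using i by simp
    moreover have "(\<Sum>j<M. e j * z j) = z i" for z :: "nat \<Rightarrow> complex"
    proof -
      have "(\<Sum>j<M. e j * z j) = (\<Sum>j<M. if j = i then z i else 0)" by (intro sum.cong refl) (simp add: e_def)
      then show ?thesis using i by simp
    qed
    ultimately show ?thesis using sq[of e] by simp
  qed
  have comp [measurable]: "(\<lambda>z. z i) \<in> borel_measurable \<mu>" if "i < M" for i
    using sets_cvec_space_component[OF that] by simp
  have int: "integrable \<mu> (\<lambda>z. z i * cnj (z j))" if ij: "i < M" "j < M" for i j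
  proof (rule Bochner_Integration.integrable_bound)
    show "integrable \<mu> (\<lambda>z. (cmod (z i))\<^sup>2 + (cmod (z j))\<^sup>2)" using sqi ij by simp
    show "AE z in \<mu>. norm (z i * cnj (z j)) \<le> norm ((cmod (z i))\<^sup>2 + (cmod (z j))\<^sup>2)"
    proof (rule AE_I2)
      fix z :: "nat \<Rightarrow> complex"
      have "2 * cmod (z i) * cmod (z j) \<le> (cmod (z i))\<^sup>2 + (cmod (z j))\<^sup>2" by (rule sum_squares_bound)
      then have "cmod (z i) * cmod (z j) \<le> (cmod (z i))\<^sup>2 + (cmod (z j))\<^sup>2"
        using mult_nonneg_nonneg[OF norm_ge_zero[of "z i"] norm_ge_zero[of "z j"]] by linarith
      then show "norm (z i * cnj (z j)) \<le> norm ((cmod (z i))\<^sup>2 + (cmod (z j))\<^sup>2)"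
        by (simp add: norm_mult)
    qed
  qed (use ij in measurable)
  have "complex_of_real (\<integral>z. (cmod (\<Sum>j<M. w j * z j))\<^sup>2 \<partial>\<mu>) = (\<integral>z. complex_of_real ((cmod (\<Sum>j<M. w j * z j))\<^sup>2) \<partial>\<mu>)"
    by (rule integral_complex_of_real[symmetric])
  also have "\<dots> = (\<integral>z. (\<Sum>i<M. \<Sum>j<M. w i * cnj (w j) * (z i * cnj (z j))) \<partial>\<mu>)"
    unfolding complex_norm_square by (simp add: sum_product mult_ac)
  also have "\<dots> = (\<Sum>i<M. \<integral>z. (\<Sum>j<M. w i * cnj (w j) * (z i * cnj (z j))) \<partial>\<mu>)"
    by (rule Bochner_Integration.integral_sum)
      (intro Bochner_Integration.integrable_sum integrable_mult_right int; simp)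
  also have "\<dots> = (\<Sum>i<M. \<Sum>j<M. \<integral>z. w i * cnj (w j) * (z i * cnj (z j)) \<partial>\<mu>)"
    by (intro sum.cong refl Bochner_Integration.integral_sum integrable_mult_right int) simp_all
  also have "\<dots> = (\<Sum>i<M. \<Sum>j<M. w i * cnj (w j) * (\<integral>z. z i * cnj (z j) \<partial>\<mu>))"
    by (simp only: integral_mult_right_zero)
  also have "\<dots> = (\<Sum>i<M. \<Sum>j<M. if j = i then w i * cnj (w i) else 0)"
    by (intro sum.cong refl) (simp add: cov)
  also have "\<dots> = of_real (\<Sum>i<M. (cmod (w i))\<^sup>2)"
    by (simp add: complex_norm_square del: of_real_power)
  finally show ?thesis using w of_real_eq_iff by metis
qed

section \<open>Toeplitz matrices of a spectral density\<close>

lemma toeplitz_hermitian: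
  assumes "\<And>k. r (- k) = cnj (r k)"
  shows "mat_adjoint (toeplitz M r) = toeplitz M r"
proof (rule hermitianI[OF toeplitz_carrier])
  show "cnj (toeplitz M r $$ (j, i)) = toeplitz M r $$ (i, j)" if "i < M" "j < M" for i j
    using that assms[of "int j - int i"] by (simp add: toeplitz_def)
qed

text \<open>The density cut off to one period, to be integrated over the whole line.\<close>

definition density_on_circle :: "(real \<Rightarrow> real) \<Rightarrow> real \<Rightarrow> real" where
  "density_on_circle f x = indicator {-pi..pi} x * f x"

definition dirichlet_sum :: "nat \<Rightarrow> complex vec \<Rightarrow> real \<Rightarrow> complex" where
  "dirichlet_sum M v x = (\<Sum>j<M. v $ j * cis (real j * x))"

lemma density_on_circle_integrable:
  assumes "f absolutely_integrable_on {-pi<..<pi}"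
  shows "integrable lebesgue (density_on_circle f)"
proof -
  have "integrable lebesgue (\<lambda>x. indicator {-pi<..<pi} x * f x)"
    using assms by (simp add: set_integrable_def)
  moreover have "integrable lebesgue (\<lambda>x. indicator {c} x * f c)" for c :: real
    by (intro integrable_mult_left) (simp add: integrable_indicator_iff)
  ultimately have "integrable lebesgue (\<lambda>x. indicator {-pi<..<pi} x * f x + indicator {pi} x * f pi + indicator {-pi} x * f (-pi))"
    by (intro Bochner_Integration.integrable_add) auto
  moreover have "(\<lambda>x. indicator {-pi<..<pi} x * f x + indicator {pi} x * f pi + indicator {-pi} x * f (-pi)) = density_on_circle f"
    by (intro ext) (auto simp: density_on_circle_def indicator_def)
  ultimately show ?thesis by simp
qed

lemma continuous_measurable_lebesgue:
  "continuous_on UNIV g \<Longrightarrow> g \<in> borel_measurable lebesgue" for g :: "real \<Rightarrow> 'b::real_normed_vector"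
  by (intro measurable_completion) (simp add: borel_measurable_continuous_onI)

lemma continuous_dirichlet_sum: "continuous_on A (dirichlet_sum M v)"
  unfolding dirichlet_sum_def by (intro continuous_intros)

lemma quad_form_spectral_density:
  assumes f: "f absolutely_integrable_on {-pi<..<pi}" and v: "v \<in> carrier_vec M"
  shows "integrable lebesgue (\<lambda>x. density_on_circle f x * (cmod (dirichlet_sum M v x))\<^sup>2)"
    and "quad_form (toeplitz M (fourier_coeff f)) v =
      of_real ((\<integral>x. density_on_circle f x * (cmod (dirichlet_sum M v x))\<^sup>2 \<partial>lebesgue) / (2 * pi))"
proof -
  let ?F = "density_on_circle f"
  note F = density_on_circle_integrable[OF f]
  have cis_int: "integrable lebesgue (\<lambda>x. complex_of_real (?F x) * cis (a * x))" for a
  proof (rule Bochner_Integration.integrable_bound[OF F])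
    have "(\<lambda>x. cis (a * x)) \<in> borel_measurable lebesgue"
      by (intro continuous_measurable_lebesgue continuous_intros)
    then show "(\<lambda>x. complex_of_real (?F x) * cis (a * x)) \<in> borel_measurable lebesgue"
      using F by (intro borel_measurable_times borel_measurable_of_real) auto
  qed (simp add: norm_mult)
  have coeff: "fourier_coeff f k = (\<integral>x. of_real (?F x) * cis (- of_int k * x) \<partial>lebesgue) / of_real (2 * pi)" for k
    unfolding fourier_coeff_def set_lebesgue_integral_def
    by (intro arg_cong2[where f = "(/)"] Bochner_Integration.integral_cong refl)
      (simp add: density_on_circle_def cis_conv_exp scaleR_conv_of_real mult_ac)
  have sq: "of_real ((cmod (dirichlet_sum M v x))\<^sup>2) =
      (\<Sum>i<M. \<Sum>j<M. v $ j * cnj (v $ i) * cis (- of_int (int i - int j) * x))" for x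
  proof -
    have "of_real ((cmod (dirichlet_sum M v x))\<^sup>2) =
        (\<Sum>j<M. v $ j * cis (real j * x)) * (\<Sum>i<M. cnj (v $ i) * cis (- real i * x))"
      unfolding complex_norm_square dirichlet_sum_def by (simp add: cis_cnj)
    also have "\<dots> = (\<Sum>i<M. \<Sum>j<M. v $ j * cis (real j * x) * (cnj (v $ i) * cis (- real i * x)))"
      unfolding sum_product by (rule sum.swap)
    also have "\<dots> = (\<Sum>i<M. \<Sum>j<M. v $ j * cnj (v $ i) * cis (- of_int (int i - int j) * x))"
      by (intro sum.cong refl) (simp add: cis_mult algebra_simps)
    finally show ?thesis .
  qed
  have "quad_form (toeplitz M (fourier_coeff f)) v =
      (\<Sum>i<M. \<Sum>j<M. fourier_coeff f (int i - int j) * (v $ j * cnj (v $ i)))"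
    unfolding quad_form_sum[OF toeplitz_carrier v]
    by (intro sum.cong refl) (simp add: toeplitz_def)
  also have "\<dots> = (\<Sum>i<M. \<Sum>j<M. \<integral>x. (v $ j * cnj (v $ i)) * (of_real (?F x) * cis (- of_int (int i - int j) * x)) \<partial>lebesgue) / of_real (2 * pi)"
    unfolding coeff sum_divide_distrib integral_mult_right_zero by (intro sum.cong refl) simp
  also have "(\<Sum>i<M. \<Sum>j<M. \<integral>x. (v $ j * cnj (v $ i)) * (of_real (?F x) * cis (- of_int (int i - int j) * x)) \<partial>lebesgue)
      = (\<Sum>i<M. \<integral>x. (\<Sum>j<M. (v $ j * cnj (v $ i)) * (of_real (?F x) * cis (- of_int (int i - int j) * x))) \<partial>lebesgue)"
    by (intro sum.cong refl Bochner_Integration.integral_sum[symmetric] integrable_mult_right cis_int)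
  also have "\<dots> = (\<integral>x. (\<Sum>i<M. \<Sum>j<M. (v $ j * cnj (v $ i)) * (of_real (?F x) * cis (- of_int (int i - int j) * x))) \<partial>lebesgue)"
    by (intro Bochner_Integration.integral_sum[symmetric] Bochner_Integration.integrable_sum integrable_mult_right cis_int)
  also have "\<dots> = (\<integral>x. complex_of_real (?F x * (cmod (dirichlet_sum M v x))\<^sup>2) \<partial>lebesgue)"
    unfolding of_real_mult sq sum_distrib_left by (simp add: mult_ac)
  also have "\<dots> = of_real (\<integral>x. ?F x * (cmod (dirichlet_sum M v x))\<^sup>2 \<partial>lebesgue)"
    by (rule integral_complex_of_real)
  finally show "quad_form (toeplitz M (fourier_coeff f)) v =
      of_real ((\<integral>x. ?F x * (cmod (dirichlet_sum M v x))\<^sup>2 \<partial>lebesgue) / (2 * pi))" by simp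
  have "integrable lebesgue (\<lambda>x. Re (\<Sum>i<M. \<Sum>j<M. (v $ j * cnj (v $ i)) * (of_real (?F x) * cis (- of_int (int i - int j) * x))))"
    by (intro integrable_Re Bochner_Integration.integrable_sum integrable_mult_right cis_int)
  moreover have "Re (\<Sum>i<M. \<Sum>j<M. (v $ j * cnj (v $ i)) * (of_real (?F x) * cis (- of_int (int i - int j) * x)))
      = ?F x * (cmod (dirichlet_sum M v x))\<^sup>2" for x
  proof -
    have "(\<Sum>i<M. \<Sum>j<M. (v $ j * cnj (v $ i)) * (of_real (?F x) * cis (- of_int (int i - int j) * x)))
        = of_real (?F x * (cmod (dirichlet_sum M v x))\<^sup>2)"
      unfolding of_real_mult sq sum_distrib_left by (simp add: mult_ac)
    then show ?thesis by (simp only: Re_complex_of_real)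
  qed
  ultimately show "integrable lebesgue (\<lambda>x. ?F x * (cmod (dirichlet_sum M v x))\<^sup>2)" by simp
qed

lemma fourier_coeff_neg: "fourier_coeff f (- k) = cnj (fourier_coeff f k)"
proof -
  let ?h = "\<lambda>x. indicator {-pi..pi} x *\<^sub>R (complex_of_real (f x) * exp (- \<i> * of_int k * of_real x))"
  have "cnj (\<integral>x. ?h x \<partial>lebesgue) = (\<integral>x. cnj (?h x) \<partial>lebesgue)"
    by (rule Bochner_Integration.integral_cnj[symmetric])
  also have "\<dots> = (\<integral>x. indicator {-pi..pi} x *\<^sub>R (complex_of_real (f x) * exp (- \<i> * of_int (- k) * of_real x)) \<partial>lebesgue)"
    by (intro Bochner_Integration.integral_cong refl) (simp add: exp_cnj)
  finally show ?thesis
    unfolding fourier_coeff_def set_lebesgue_integral_def by simp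
qed

text \<open>A nonzero polynomial has finitely many roots on the unit circle.\<close>

lemma dirichlet_sum_zero:
  assumes v: "v \<in> carrier_vec M" and z: "\<And>x. x \<in> {-pi..pi} \<Longrightarrow> dirichlet_sum M v x = 0"
  shows "v = 0\<^sub>v M"
proof (cases M)
  case 0
  then show ?thesis using v by auto
next
  case (Suc n)
  have "\<not> finite (cis ` {0..pi})"
  proof
    assume "finite (cis ` {0..pi})"
    moreover have "inj_on cis {0..pi}"
      by (rule inj_onI) (auto simp: complex_eq_iff intro: cos_inj_pi)
    ultimately have "finite {0..pi}" by (rule finite_imageD)
    then show False using pi_gt_zero infinite_Icc[of 0 pi] by simp
  qed
  moreover have "cis ` {0..pi} \<subseteq> {w. (\<Sum>j\<le>n. v $ j * w ^ j) = 0}"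
  proof safe
    fix x assume x: "x \<in> {0..pi}"
    have "(\<Sum>j\<le>n. v $ j * cis x ^ j) = dirichlet_sum M v x"
      unfolding dirichlet_sum_def Suc lessThan_Suc_atMost Complex.DeMoivre by simp
    then show "(\<Sum>j\<le>n. v $ j * cis x ^ j) = 0" using z[of x] x by simp
  qed
  ultimately have "\<not> finite {w. (\<Sum>j\<le>n. v $ j * w ^ j) = 0}" using finite_subset by blast
  then have "\<forall>j\<le>n. v $ j = 0" by (simp add: polyfun_finite_roots)
  then show ?thesis using v Suc by (intro eq_vecI) auto
qed

text \<open>Positivity of \<open>f\<close> forces the trigonometric polynomial of a null vector of the form to vanish almost
  everywhere, and by continuity everywhere.\<close>

lemma toeplitz_density_posdef:
  assumes f: "f absolutely_integrable_on {-pi<..<pi}"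
    and pos: "\<And>x. x \<in> {-pi..pi} - {0} \<Longrightarrow> f x > 0"
  shows "pos_semidef M (toeplitz M (fourier_coeff f))"
    and "\<And>v. v \<in> carrier_vec M \<Longrightarrow> v \<noteq> 0\<^sub>v M \<Longrightarrow> quad_form (toeplitz M (fourier_coeff f)) v \<noteq> 0"
proof -
  let ?g = "\<lambda>v x. density_on_circle f x * (cmod (dirichlet_sum M v x))\<^sup>2"
  have nn: "AE x in lebesgue. 0 \<le> ?g v x" for v
  proof -
    have "AE x in lebesgue. x \<notin> {0::real}" by (rule AE_not_in) auto
    then show ?thesis
      by (rule eventually_mono) (use pos in \<open>auto simp: density_on_circle_def indicator_def less_imp_le\<close>)
  qed
  have "0 \<le> Re (quad_form (toeplitz M (fourier_coeff f)) v)" if v: "v \<in> carrier_vec M" for v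
    unfolding quad_form_spectral_density(2)[OF f v] Re_complex_of_real
    using integral_nonneg_AE[OF nn] by simp
  then show "pos_semidef M (toeplitz M (fourier_coeff f))"
    by (simp add: pos_semidef_def toeplitz_hermitian fourier_coeff_neg)
  show "quad_form (toeplitz M (fourier_coeff f)) v \<noteq> 0" if v: "v \<in> carrier_vec M" and nz: "v \<noteq> 0\<^sub>v M" for v
  proof
    assume "quad_form (toeplitz M (fourier_coeff f)) v = 0"
    then have "(\<integral>x. ?g v x \<partial>lebesgue) = 0"
      unfolding quad_form_spectral_density(2)[OF f v] of_real_eq_0_iff by simp
    then have g0: "AE x in lebesgue. ?g v x = 0"
      using integral_nonneg_eq_0_iff_AE[OF quad_form_spectral_density(1)[OF f v] nn] by simp
    have "AE x in lebesgue. x \<notin> {0::real}" by (rule AE_not_in) auto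
    with g0 have "AE x in lebesgue. x \<in> {-pi..pi} \<longrightarrow> dirichlet_sum M v x = 0"
    proof eventually_elim
      fix x assume x: "?g v x = 0" "x \<notin> {0::real}"
      show "x \<in> {-pi..pi} \<longrightarrow> dirichlet_sum M v x = 0"
      proof
        assume xi: "x \<in> {-pi..pi}"
        then have "f x > 0" using pos x(2) by simp
        then show "dirichlet_sum M v x = 0" using x(1) xi by (simp add: density_on_circle_def)
      qed
    qed
    then obtain S where S: "S \<in> null_sets lebesgue" "{x \<in> space lebesgue. \<not> (x \<in> {-pi..pi} \<longrightarrow> dirichlet_sum M v x = 0)} \<subseteq> S"
      by (auto simp: eventually_ae_filter)
    have neg: "negligible S" using S(1) by (simp add: negligible_iff_null_sets)
    have hi: "((\<lambda>x. (cmod (dirichlet_sum M v x))\<^sup>2) has_integral 0) (cbox (-pi) pi)"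
      by (rule has_integral_negligible[OF neg]) (use S(2) in auto)
    have "dirichlet_sum M v x = 0" if "x \<in> {-pi..pi}" for x
    proof -
      have "(cmod (dirichlet_sum M v x))\<^sup>2 = 0"
      proof (rule has_integral_0_cbox_imp_0[OF _ _ hi])
        show "continuous_on (cbox (- pi) pi) (\<lambda>x. (cmod (dirichlet_sum M v x))\<^sup>2)"
          by (intro continuous_intros continuous_dirichlet_sum)
        show "box (- pi) pi \<noteq> {}" by (simp add: not_le)
      qed (use that in auto)
      then show ?thesis by simp
    qed
    then show False using dirichlet_sum_zero[OF v] nz by blast
  qed
qed

lemma biased_mat_hermitian:
  "mat_adjoint (biased_mat M (fourier_coeff f)) = biased_mat M (fourier_coeff f)"
  unfolding biased_mat_def by (rule toeplitz_hermitian) (simp add: fourier_coeff_neg)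

lemma biased_mat_posdef:
  assumes f: "f absolutely_integrable_on {-pi<..<pi}"
    and pos: "\<And>x. x \<in> {-pi..pi} - {0} \<Longrightarrow> f x > 0" and M: "M > 0"
  shows "pos_semidef M (biased_mat M (fourier_coeff f))"
    and "\<And>v. v \<in> carrier_vec M \<Longrightarrow> v \<noteq> 0\<^sub>v M \<Longrightarrow> quad_form (biased_mat M (fourier_coeff f)) v \<noteq> 0"
proof -
  have R: "pos_semidef M (toeplitz M (fourier_coeff f))"
    by (rule toeplitz_density_posdef(1)[OF f]) (rule pos)
  have Rpos: "quad_form (toeplitz M (fourier_coeff f)) v \<noteq> 0" if "v \<in> carrier_vec M" "v \<noteq> 0\<^sub>v M" for v
    by (rule toeplitz_density_posdef(2)[OF f _ that]) (rule pos)
  note avg = toeplitz_average_posdef[OF R M Rpos, folded biased_mat_toeplitz_average, OF _ _ biased_mat_hermitian]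
  show "pos_semidef M (biased_mat M (fourier_coeff f))" by (rule avg(1))
  show "quad_form (biased_mat M (fourier_coeff f)) v \<noteq> 0" if "v \<in> carrier_vec M" "v \<noteq> 0\<^sub>v M" for v
    by (rule avg(2)) (use that in auto)
qed

section \<open>Growth of the form at the constant vector\<close>

lemma sum_over_differences:
  fixes g :: "int \<Rightarrow> complex"
  shows "(\<Sum>i<M. \<Sum>j<M. g (int i - int j)) = (\<Sum>k\<in>{- int M<..<int M}. of_int (int M - \<bar>k\<bar>) * g k)"
proof (induction M)
  case (Suc M)
  have cross: "(\<Sum>i<M. g (int i - int M)) + (\<Sum>j<M. g (int M - int j)) + g 0 = (\<Sum>k\<in>{- int M..int M}. g k)"
  proof -
    have "(\<Sum>i<M. g (int i - int M)) = (\<Sum>k\<in>{- int M..<0}. g k)"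
      by (rule sum.reindex_bij_witness[of _ "\<lambda>k. nat (k + int M)" "\<lambda>i. int i - int M"]) auto
    moreover have "(\<Sum>j<M. g (int M - int j)) = (\<Sum>k\<in>{0<..int M}. g k)"
      by (rule sum.reindex_bij_witness[of _ "\<lambda>k. nat (int M - k)" "\<lambda>j. int M - int j"]) auto
    moreover have "{- int M..int M} = {- int M..<0} \<union> {0<..int M} \<union> {0}" by auto
    moreover have "{- int M..<0} \<inter> {0<..int M} = {}" by auto
    ultimately show ?thesis by (simp add: sum.union_disjoint)
  qed
  have "(\<Sum>i<Suc M. \<Sum>j<Suc M. g (int i - int j)) = (\<Sum>i<M. \<Sum>j<M. g (int i - int j)) +
      ((\<Sum>i<M. g (int i - int M)) + (\<Sum>j<M. g (int M - int j)) + g 0)"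
    by (simp add: sum.distrib add_ac)
  also have "\<dots> = (\<Sum>k\<in>{- int M<..<int M}. of_int (int M - \<bar>k\<bar>) * g k) + (\<Sum>k\<in>{- int M..int M}. g k)"
    unfolding cross Suc.IH ..
  also have "(\<Sum>k\<in>{- int M<..<int M}. of_int (int M - \<bar>k\<bar>) * g k) = (\<Sum>k\<in>{- int M..int M}. of_int (int M - \<bar>k\<bar>) * g k)"
    by (rule sum.mono_neutral_left) auto
  also have "\<dots> + (\<Sum>k\<in>{- int M..int M}. g k) = (\<Sum>k\<in>{- int M..int M}. of_int (int (Suc M) - \<bar>k\<bar>) * g k)"
    unfolding sum.distrib[symmetric] by (intro sum.cong refl) (simp add: algebra_simps)
  also have "{- int M..int M} = {- int (Suc M)<..<int (Suc M)}" by auto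
  finally show ?case .
qed simp

text \<open>In terms of \<open>r\<^sub>k\<close> the weights of \<open>q\<close> and \<open>u\<close> are \<open>M - \<bar>k\<bar>\<close> and \<open>(M - \<bar>k\<bar>)\<^sup>2\<close>, and
  \<open>(m + 1)\<^sup>2 = m\<^sup>2 + m + (m + 1)\<close>.\<close>

lemma weighted_difference_sum_step:
  fixes r :: "int \<Rightarrow> complex"
  defines "q \<equiv> \<lambda>M. \<Sum>i<M. \<Sum>j<M. r (int i - int j)"
    and "u \<equiv> \<lambda>M. \<Sum>i<M. \<Sum>j<M. of_int (int M - \<bar>int i - int j\<bar>) * r (int i - int j)"
  shows "u (Suc M) = u M + q M + q (Suc M)"
proof -
  let ?I = "{- int M..int M}"
  have I: "{- int (Suc M)<..<int (Suc M)} = ?I" by auto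
  have "u M = (\<Sum>k\<in>{- int M<..<int M}. of_int (int M - \<bar>k\<bar>) * (of_int (int M - \<bar>k\<bar>) * r k))"
    unfolding u_def by (rule sum_over_differences)
  also have "\<dots> = (\<Sum>k\<in>?I. of_int (int M - \<bar>k\<bar>) * (of_int (int M - \<bar>k\<bar>) * r k))"
    by (rule sum.mono_neutral_left) auto
  finally have 1: "u M = \<dots>" .
  have "q M = (\<Sum>k\<in>{- int M<..<int M}. of_int (int M - \<bar>k\<bar>) * r k)"
    unfolding q_def by (rule sum_over_differences)
  also have "\<dots> = (\<Sum>k\<in>?I. of_int (int M - \<bar>k\<bar>) * r k)"
    by (rule sum.mono_neutral_left) auto
  finally have 2: "q M = \<dots>" .
  have 3: "u (Suc M) = (\<Sum>k\<in>?I. of_int (int (Suc M) - \<bar>k\<bar>) * (of_int (int (Suc M) - \<bar>k\<bar>) * r k))"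
    using sum_over_differences[of "\<lambda>k. of_int (int (Suc M) - \<bar>k\<bar>) * r k" "Suc M"] unfolding u_def I .
  have 4: "q (Suc M) = (\<Sum>k\<in>?I. of_int (int (Suc M) - \<bar>k\<bar>) * r k)"
    unfolding q_def sum_over_differences I ..
  show ?thesis
    unfolding 1 2 3 4 sum.distrib[symmetric]
    by (intro sum.cong refl) (simp add: algebra_simps)
qed

lemma fourier_vec_zero_index: "j < M \<Longrightarrow> fourier_vec M 0 $ j = 1"
  by (simp add: fourier_vec_def)

lemma quad_form_toeplitz_ones:
  "quad_form (toeplitz M r) (fourier_vec M 0) = (\<Sum>i<M. \<Sum>j<M. r (int i - int j))"
  unfolding quad_form_sum[OF toeplitz_carrier fourier_vec_carrier]
  by (intro sum.cong refl) (simp add: toeplitz_def fourier_vec_zero_index)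

lemma quad_form_biased_ones:
  assumes "M > 0"
  shows "of_nat M * quad_form (biased_mat M r) (fourier_vec M 0) =
    (\<Sum>i<M. \<Sum>j<M. of_int (int M - \<bar>int i - int j\<bar>) * r (int i - int j))"
proof -
  have "of_nat M * complex_of_real (1 - real_of_int \<bar>k\<bar> / real M) = of_int (int M - \<bar>k\<bar>)" for k
  proof -
    have "of_nat M * complex_of_real (1 - real_of_int \<bar>k\<bar> / real M) = complex_of_real (real M * (1 - real_of_int \<bar>k\<bar> / real M))"
      by simp
    also have "real M * (1 - real_of_int \<bar>k\<bar> / real M) = real_of_int (int M - \<bar>k\<bar>)"
      using assms by (simp add: right_diff_distrib)
    finally show ?thesis by (simp only: of_real_of_int_eq)
  qed
  then show ?thesis
    unfolding biased_mat_def quad_form_toeplitz_ones sum_distrib_left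
    by (simp only: mult.assoc[symmetric])
qed

text \<open>If \<open>T\<^sub>M\<close> is at most \<open>\<beta> U\<^sub>M / M\<close>, the recurrence for \<open>U\<close> is that of a sequence growing like
  \<open>M\<close> to the power \<open>2 \<beta>\<close>.\<close>

lemma growth_of_recurrence:
  fixes T U :: "nat \<Rightarrow> real"
  assumes a: "a > 0" and rec: "\<And>M. U (Suc M) = U M + T M + T (Suc M)"
    and U: "\<And>M. M > 0 \<Longrightarrow> U M > 0"
    and T: "eventually (\<lambda>M. T M \<le> (1 + a / 8) * U M / real M) sequentially"
  shows "\<exists>C. eventually (\<lambda>M. T M \<le> C * real M powr (1 + a / 2)) sequentially"
proof -
  \<comment> \<open>Any exponent \<open>\<gamma> > 2 \<beta>\<close> dominates the recurrence; \<open>\<gamma> = 2 + a/2\<close> leaves room for \<open>\<beta> = 1 + a/8\<close>.\<close>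
  define \<beta> where "\<beta> = 1 + a / 8"
  define \<gamma> where "\<gamma> = 2 + a / 2"
  have "eventually (\<lambda>x::real. 1 + (1 + a / 8) / x \<le> (1 - (1 + a / 8) / (x + 1)) * ((x + 1) / x) powr (2 + a / 2)) at_top"
    using a by real_asymp
  then have bern: "eventually (\<lambda>M. 1 + \<beta> / real M \<le> (1 - \<beta> / (real M + 1)) * ((real M + 1) / real M) powr \<gamma>) sequentially"
    unfolding \<beta>_def \<gamma>_def by (rule eventually_compose_filterlim[OF _ filterlim_real_sequentially])
  have "eventually (\<lambda>x::real. 1 - (1 + a / 8) / (x + 1) > 0) at_top" using a by real_asymp
  then have pos: "eventually (\<lambda>M. 1 - \<beta> / (real M + 1) > 0) sequentially"
    unfolding \<beta>_def by (rule eventually_compose_filterlim[OF _ filterlim_real_sequentially])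
  have T': "eventually (\<lambda>M. T (Suc M) \<le> \<beta> * U (Suc M) / real (Suc M)) sequentially"
    using T eventually_sequentially_Suc[of "\<lambda>M. T M \<le> \<beta> * U M / real M"] unfolding \<beta>_def by simp
  have "eventually (\<lambda>M. M > 0 \<and> T M \<le> \<beta> * U M / real M \<and> U (Suc M) / real (Suc M) powr \<gamma> \<le> U M / real M powr \<gamma>) sequentially"
    using bern pos T T' eventually_gt_at_top[of 0]
  proof eventually_elim
    case (elim M)
    have TM: "T M \<le> \<beta> * U M / real M" using elim(3) by (simp add: \<beta>_def)
    have "U (Suc M) \<le> U M + \<beta> * U M / real M + \<beta> * U (Suc M) / real (Suc M)"
      unfolding rec[of M] using TM elim(4) rec[of M] by simp
    then have "U (Suc M) * (1 - \<beta> / (real M + 1)) \<le> U M * (1 + \<beta> / real M)"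
      by (simp add: algebra_simps)
    also have "\<dots> \<le> U M * ((1 - \<beta> / (real M + 1)) * ((real M + 1) / real M) powr \<gamma>)"
      using elim(1) U[OF elim(5)] by (intro mult_left_mono) auto
    finally have "U (Suc M) * (1 - \<beta> / (real M + 1)) \<le> (U M * ((real M + 1) / real M) powr \<gamma>) * (1 - \<beta> / (real M + 1))"
      by (simp add: mult_ac)
    then have "U (Suc M) \<le> U M * ((real M + 1) / real M) powr \<gamma>" using elim(2) by simp
    also have "\<dots> = U M / real M powr \<gamma> * real (Suc M) powr \<gamma>"
      using elim(5) by (simp add: powr_divide add.commute)
    finally have "U (Suc M) / real (Suc M) powr \<gamma> \<le> U M / real M powr \<gamma>"
      by (subst pos_divide_le_eq) auto
    then show ?case using TM elim(5) by blast
  qed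
  then obtain M0 where M0: "\<And>M. M \<ge> M0 \<Longrightarrow> M > 0"
    "\<And>M. M \<ge> M0 \<Longrightarrow> T M \<le> \<beta> * U M / real M"
    "\<And>M. M \<ge> M0 \<Longrightarrow> U (Suc M) / real (Suc M) powr \<gamma> \<le> U M / real M powr \<gamma>"
    by (auto simp: eventually_sequentially)
  have mono: "U M / real M powr \<gamma> \<le> U M0 / real M0 powr \<gamma>" if "M \<ge> M0" for M
    using that
  proof (induction rule: dec_induct)
    case (step n)
    then show ?case by (intro order_trans[OF M0(3)])
  qed simp
  have "T M \<le> \<beta> * (U M0 / real M0 powr \<gamma>) * real M powr (1 + a / 2)" if M: "M \<ge> M0" for M
  proof -
    have Mp: "real M > 0" using M0(1)[OF M] by simp
    have "U M \<le> U M0 / real M0 powr \<gamma> * real M powr \<gamma>"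
      using mono[OF M] Mp by (simp add: pos_divide_le_eq)
    then have "\<beta> * U M / real M \<le> \<beta> * (U M0 / real M0 powr \<gamma> * real M powr \<gamma>) / real M"
      using Mp a by (intro divide_right_mono mult_left_mono) (auto simp: \<beta>_def)
    also have "\<dots> = \<beta> * (U M0 / real M0 powr \<gamma>) * (real M powr \<gamma> / real M powr 1)" using Mp by simp
    also have "real M powr \<gamma> / real M powr 1 = real M powr (1 + a / 2)"
      by (simp only: powr_diff[symmetric]) (simp add: \<gamma>_def)
    finally show ?thesis using M0(2)[OF M] by linarith
  qed
  then show ?thesis unfolding eventually_sequentially by blast
qed

text \<open>Iterate \<open>L (2 t) / L t \<longrightarrow> 1\<close>. Restricting to powers of 2 avoids the uniform convergence theorem for
  slowly varying functions.\<close>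

lemma slowly_varying_dyadic_lower_bound:
  assumes L: "slowly_varying x0 L" and e: "e > 0"
  shows "\<exists>c>0. eventually (\<lambda>k. L (2 ^ k) \<ge> c * 2 powr (- e * real k)) sequentially"
proof -
  have pos: "L t > 0" if "t \<ge> x0" for t using L that by (auto simp: slowly_varying_def)
  have "((\<lambda>t. L (2 * t) / L t) \<longlongrightarrow> 1) at_top" using L by (auto simp: slowly_varying_def)
  moreover have p2: "filterlim (\<lambda>k. 2 ^ k :: real) at_top sequentially" by real_asymp
  ultimately have "(\<lambda>k. L (2 * 2 ^ k) / L (2 ^ k)) \<longlonglongrightarrow> 1" by (rule filterlim_compose)
  moreover have "2 powr (- e) < (1::real)" using e by (simp add: powr_less_one)
  ultimately have "eventually (\<lambda>k. L (2 * 2 ^ k) / L (2 ^ k) > 2 powr (- e)) sequentially"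
    by (rule order_tendstoD)
  moreover have "eventually (\<lambda>k. (2::real) ^ k \<ge> x0) sequentially"
    using p2 by (auto simp: filterlim_at_top)
  ultimately have "eventually (\<lambda>k. (2::real) ^ k \<ge> x0 \<and> L (2 ^ Suc k) \<ge> 2 powr (- e) * L (2 ^ k)) sequentially"
    by eventually_elim (auto simp: pos_less_divide_eq pos less_imp_le)
  then obtain k0 where k0: "\<And>k. k \<ge> k0 \<Longrightarrow> (2::real) ^ k \<ge> x0"
    "\<And>k. k \<ge> k0 \<Longrightarrow> L (2 ^ Suc k) \<ge> 2 powr (- e) * L (2 ^ k)"
    by (auto simp: eventually_sequentially)
  define c where "c = L (2 ^ k0) / 2 powr (- e * real k0)"
  have "c > 0" using pos[OF k0(1)[of k0]] by (simp add: c_def)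
  moreover have "L (2 ^ k) \<ge> c * 2 powr (- e * real k)" if "k \<ge> k0" for k
    using that
  proof (induction rule: dec_induct)
    case base
    then show ?case by (simp add: c_def)
  next
    case (step k)
    have "c * 2 powr (- e * real (Suc k)) = 2 powr (- e) * (c * 2 powr (- e * real k))"
      by (simp add: powr_add[symmetric] algebra_simps)
    also have "\<dots> \<le> 2 powr (- e) * L (2 ^ k)" using step.IH by (intro mult_left_mono) auto
    also have "\<dots> \<le> L (2 ^ Suc k)" using k0(2) step.hyps(1) by simp
    finally show ?case .
  qed
  ultimately show ?thesis by (auto simp: eventually_sequentially)
qed

text \<open>On \<open>[0, 1/M]\<close> the Dirichlet sum has modulus at least \<open>M / 2\<close>. Rescaling by \<open>M\<close> leaves the integral
  of \<open>L (M / y) / L M\<close>, whose lower limit is given by Fatou's lemma.\<close>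

lemma quad_form_ones_lower_bound:
  assumes f: "f absolutely_integrable_on {-pi<..<pi}"
    and pos: "\<And>x. x \<in> {-pi..pi} - {0} \<Longrightarrow> f x > 0"
    and L: "slowly_varying (1 / pi) L" and a: "0 < a"
    and form: "\<And>x. x \<in> {-pi..pi} - {0} \<Longrightarrow> f x = L (1 / \<bar>x\<bar>) / \<bar>x\<bar> powr a"
  shows "eventually (\<lambda>M. Re (quad_form (toeplitz M (fourier_coeff f)) (fourier_vec M 0))
      \<ge> real M powr (1 + a) * L (real M) / (32 * pi)) sequentially"
proof -
  let ?F = "density_on_circle f"
  let ?A = "{1 / 2..1 :: real}"
  have Lpos: "L t > 0" if "t \<ge> 1 / pi" for t using L that by (auto simp: slowly_varying_def)
  have pi1: "1 / pi \<le> 1" "1 \<le> pi" using pi_gt3 by auto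
  have F: "?F \<in> borel_measurable lebesgue" using density_on_circle_integrable[OF f] by auto
  have scaled: "(\<lambda>y. ?F (y / real M)) \<in> borel_measurable lebesgue" for M
  proof -
    have "(\<lambda>y. ?F ((1 / real M) *\<^sub>R y)) \<in> borel_measurable lebesgue"
      by (rule measurable_compose[OF lebesgue_measurable_scaling F])
    then show ?thesis by simp
  qed
  define h where "h M y = ennreal (indicator ?A y * (?F (y / real M) * (y / real M) powr a / L (real M)))" for M y
  have h_meas: "h M \<in> borel_measurable lebesgue" for M
  proof -
    have "(\<lambda>y. (y / real M) powr a) \<in> borel_measurable lebesgue"
      by (intro measurable_completion) measurable
    then show ?thesis unfolding h_def
      using scaled by (intro measurable_compose[OF _ measurable_ennreal] borel_measurable_times borel_measurable_divide borel_measurable_indicator) auto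
  qed
  have h_eq: "h M y = ennreal (indicator ?A y * (L (real M / y) / L (real M)))" if "M > 0" for M y
  proof (cases "y \<in> ?A")
    case True
    define x where "x = y / real M"
    have "0 < x" "x \<le> y" using True that by (auto simp: x_def field_simps)
    then have x: "x \<in> {-pi..pi} - {0}" using True pi1 by auto
    have "?F x * x powr a = L (1 / x)"
      using form[OF x] x \<open>0 < x\<close> by (simp add: density_on_circle_def)
    moreover have "1 / x = real M / y" by (simp add: x_def)
    ultimately show ?thesis by (simp add: h_def x_def)
  qed (simp add: h_def)
  have lim: "(\<lambda>M. h M y) \<longlonglongrightarrow> indicator ?A y" for y
  proof (cases "y \<in> ?A")
    case True
    then have "1 / y > 0" by auto
    then have "((\<lambda>t. L (1 / y * t) / L t) \<longlongrightarrow> 1) at_top" using L unfolding slowly_varying_def by blast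
    then have "(\<lambda>M. L (1 / y * real M) / L (real M)) \<longlonglongrightarrow> 1"
      by (rule filterlim_compose[OF _ filterlim_real_sequentially])
    then have "(\<lambda>M. ennreal (L (1 / y * real M) / L (real M))) \<longlonglongrightarrow> ennreal 1" by (rule tendsto_ennrealI)
    moreover have "eventually (\<lambda>M. ennreal (L (1 / y * real M) / L (real M)) = h M y) sequentially"
      using eventually_gt_at_top[of 0] by eventually_elim (use True in \<open>simp add: h_eq\<close>)
    ultimately have "(\<lambda>M. h M y) \<longlonglongrightarrow> ennreal 1" by (rule Lim_transform_eventually)
    then show ?thesis using True by simp
  next
    case False
    then show ?thesis by (simp add: h_def)
  qed
  have "(\<integral>\<^sup>+y. liminf (\<lambda>M. h M y) \<partial>lebesgue) = (\<integral>\<^sup>+y. indicator ?A y \<partial>lebesgue)"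
    by (intro nn_integral_cong lim_imp_Liminf lim) simp
  also have "\<dots> = ennreal (1 / 2)" by (subst nn_integral_indicator) auto
  finally have "ennreal (1 / 2) \<le> liminf (\<lambda>M. \<integral>\<^sup>+y. h M y \<partial>lebesgue)"
    using nn_integral_liminf[OF h_meas, of "\<lambda>M. M"] by simp
  moreover have "ennreal (1 / 4) < ennreal (1 / 2)" by (rule ennreal_lessI) auto
  ultimately have "ennreal (1 / 4) < liminf (\<lambda>M. \<integral>\<^sup>+y. h M y \<partial>lebesgue)" by (rule less_le_trans[rotated])
  then have ev: "eventually (\<lambda>M. ennreal (1 / 4) < (\<integral>\<^sup>+y. h M y \<partial>lebesgue)) sequentially"
    by (rule less_LiminfD)
  show ?thesis
    using ev eventually_gt_at_top[of 0]
  proof eventually_elim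
    fix M :: nat assume h: "ennreal (1 / 4) < (\<integral>\<^sup>+y. h M y \<partial>lebesgue)" and M: "0 < M"
    have LM: "L (real M) > 0" using Lpos[of "real M"] M pi1 by simp
    let ?e = "fourier_vec M 0"
    let ?D = "dirichlet_sum M ?e"
    define g where "g x = ?F x * (cmod (?D x))\<^sup>2" for x
    note qf = quad_form_spectral_density[OF f fourier_vec_carrier[of M 0], folded g_def]
    have dir: "cmod (?D x) \<ge> real M / 2" if x: "0 \<le> x" "x \<le> 1 / real M" for x
    proof -
      have "cos (real j * x) \<ge> 1 / 2" if j: "j < M" for j
      proof -
        have "real j * x \<le> real M * (1 / real M)" using j x by (intro mult_mono) auto
        then have "real j * x \<le> 1" using M by simp
        moreover have "1 \<le> pi / 3" using pi_gt3 by simp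
        ultimately have "cos (real j * x) \<ge> cos (pi / 3)" using x by (intro cos_monotone_0_pi_le) auto
        then show ?thesis by (simp add: cos_60)
      qed
      then have "(\<Sum>j<M. 1 / 2) \<le> (\<Sum>j<M. cos (real j * x))" by (intro sum_mono) auto
      also have "\<dots> = Re (?D x)" by (simp add: dirichlet_sum_def fourier_vec_zero_index)
      also have "\<dots> \<le> cmod (?D x)" by (rule complex_Re_le_cmod)
      finally show ?thesis by simp
    qed
    have g_meas: "g \<in> borel_measurable lebesgue" using qf(1) by auto
    have g_nonneg: "AE x in lebesgue. 0 \<le> g x"
    proof -
      have "AE x in lebesgue. x \<notin> {0::real}" by (rule AE_not_in) auto
      then show ?thesis
        by (rule eventually_mono) (use pos in \<open>auto simp: g_def density_on_circle_def indicator_def less_imp_le\<close>)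
    qed
    define c where "c = real M powr a * L (real M) * (real M)\<^sup>2 / 4"
    have c: "c \<ge> 0" using LM by (simp add: c_def)
    have point: "ennreal c * h M y \<le> ennreal (g (0 + 1 / real M * y))" for y
    proof (cases "y \<in> ?A")
      case True
      define x where "x = y / real M"
      have x0: "0 < x" "x \<le> 1 / real M" "x \<le> y" using True M by (auto simp: x_def field_simps)
      then have x: "x \<in> {-pi..pi} - {0}" using True pi1 by auto
      have Fx: "?F x > 0" using pos[OF x] x by (simp add: density_on_circle_def)
      have "c * (?F x * x powr a / L (real M)) = ?F x * (real M / 2)\<^sup>2 * (real M powr a * x powr a)"
        using LM by (simp add: c_def power2_eq_square)
      also have "real M powr a * x powr a = y powr a"
        using M x0 by (simp add: powr_mult[symmetric] x_def)
      also have "?F x * (real M / 2)\<^sup>2 * y powr a \<le> ?F x * (real M / 2)\<^sup>2 * 1"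
        using True a Fx by (intro mult_left_mono) (auto intro: powr_le1)
      also have "\<dots> \<le> ?F x * (cmod (?D x))\<^sup>2"
        using Fx dir[of x] x0 by (simp add: power_mono)
      finally have "c * (?F x * x powr a / L (real M)) \<le> g x" by (simp add: g_def)
      then show ?thesis using True c by (simp add: h_def x_def ennreal_mult'[symmetric] ennreal_leI)
    qed (simp add: h_def)
    have "ennreal (c / 4) = ennreal c * ennreal (1 / 4)" using c by (simp add: ennreal_mult[symmetric])
    also have "\<dots> \<le> ennreal c * (\<integral>\<^sup>+y. h M y \<partial>lebesgue)" using h by (intro mult_left_mono) auto
    also have "\<dots> = (\<integral>\<^sup>+y. ennreal c * h M y \<partial>lebesgue)" by (rule nn_integral_cmult[symmetric, OF h_meas])
    also have "\<dots> \<le> (\<integral>\<^sup>+y. ennreal (g (0 + 1 / real M * y)) \<partial>lebesgue)" by (intro nn_integral_mono point)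
    finally have le: "ennreal (c / 4) \<le> (\<integral>\<^sup>+y. ennreal (g (0 + 1 / real M * y)) \<partial>lebesgue)" .
    have "ennreal (c / (4 * real M)) = ennreal \<bar>1 / real M\<bar> * ennreal (c / 4)"
      using c by (simp add: ennreal_mult[symmetric])
    also have "\<dots> \<le> ennreal \<bar>1 / real M\<bar> * (\<integral>\<^sup>+y. ennreal (g (0 + 1 / real M * y)) \<partial>lebesgue)"
      using le by (intro mult_left_mono) auto
    also have "\<dots> = (\<integral>\<^sup>+x. ennreal (g x) \<partial>lebesgue)"
      using M g_meas by (intro nn_integral_real_affine_lebesgue[symmetric]) auto
    also have "\<dots> = ennreal (\<integral>x. g x \<partial>lebesgue)" by (rule nn_integral_eq_integral[OF qf(1) g_nonneg])
    finally have "c / (4 * real M) \<le> (\<integral>x. g x \<partial>lebesgue)"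
      using integral_nonneg_AE[OF g_nonneg] by (simp add: ennreal_le_iff)
    then have "c / (4 * real M) / (2 * pi) \<le> Re (quad_form (toeplitz M (fourier_coeff f)) ?e)"
      unfolding qf(2) Re_complex_of_real by (intro divide_right_mono) auto
    moreover have "c / (4 * real M) / (2 * pi) = real M powr (1 + a) * L (real M) / (32 * pi)"
      using M by (simp add: c_def powr_add power2_eq_square field_simps)
    ultimately show "Re (quad_form (toeplitz M (fourier_coeff f)) ?e) \<ge> real M powr (1 + a) * L (real M) / (32 * pi)"
      by simp
  qed
qed

text \<open>Otherwise the recurrence bounds the form at the constant vector by \<open>C M\<^sup>1\<^sup>+\<^sup>a\<^sup>/\<^sup>2\<close>, whereas along the powers
  of 2 it is at least of order \<open>M\<^sup>1\<^sup>+\<^sup>3\<^sup>a\<^sup>/\<^sup>4\<close>.\<close>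

lemma biased_form_not_close:
  assumes f: "f absolutely_integrable_on {-pi<..<pi}"
    and pos: "\<And>x. x \<in> {-pi..pi} - {0} \<Longrightarrow> f x > 0"
    and L: "slowly_varying (1 / pi) L" and a: "0 < a"
    and form: "\<And>x. x \<in> {-pi..pi} - {0} \<Longrightarrow> f x = L (1 / \<bar>x\<bar>) / \<bar>x\<bar> powr a"
  shows "\<exists>\<delta>>0. \<not> eventually (\<lambda>M. cmod (quad_form (biased_mat M (fourier_coeff f)) (fourier_vec M 0)
      - quad_form (toeplitz M (fourier_coeff f)) (fourier_vec M 0))
      \<le> \<delta> * Re (quad_form (toeplitz M (fourier_coeff f)) (fourier_vec M 0))) sequentially"
proof -
  let ?b = "\<lambda>M. quad_form (biased_mat M (fourier_coeff f)) (fourier_vec M 0)"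
  let ?t = "\<lambda>M. quad_form (toeplitz M (fourier_coeff f)) (fourier_vec M 0)"
  define T where "T M = Re (?t M)" for M
  define U where "U M = real M * Re (?b M)" for M
  \<comment> \<open>chosen such that an error \<open>\<delta> T\<close> gives \<open>T \<le> (1 + a/8) U / M\<close>\<close>
  define \<delta> where "\<delta> = 1 - 1 / (1 + a / 8)"
  have \<delta>: "\<delta> > 0" "1 - \<delta> > 0" "1 / (1 - \<delta>) = 1 + a / 8" using a by (auto simp: \<delta>_def)
  have Uc: "U M = Re (\<Sum>i<M. \<Sum>j<M. of_int (int M - \<bar>int i - int j\<bar>) * fourier_coeff f (int i - int j))" for M
  proof (cases "M > 0")
    case True
    have "U M = Re (of_nat M * ?b M)"
      by (simp add: U_def)
    then show ?thesis by (simp only: quad_form_biased_ones[OF True])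
  qed (simp add: U_def)
  have rec: "U (Suc M) = U M + T M + T (Suc M)" for M
    using arg_cong[OF weighted_difference_sum_step[of M "fourier_coeff f"], of Re]
    unfolding Uc T_def quad_form_toeplitz_ones by simp
  have U_pos: "U M > 0" if M: "M > 0" for M
  proof -
    have psd: "pos_semidef M (biased_mat M (fourier_coeff f))"
      by (rule biased_mat_posdef(1)[OF f _ M]) (rule pos)
    have "fourier_vec M 0 $ 0 \<noteq> (0\<^sub>v M :: complex vec) $ 0" using M by (simp add: fourier_vec_zero_index)
    then have "fourier_vec M 0 \<noteq> 0\<^sub>v M" by metis
    then have "?b M \<noteq> 0"
      by (intro biased_mat_posdef(2)[OF f _ M]) (use pos in auto)
    moreover have "?b M =
        of_real (Re (?b M))"
      using psd by (intro hermitian_quadratic_form_real) (auto simp: pos_semidef_def)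
    ultimately have "Re (?b M) \<noteq> 0"
      by (metis of_real_0)
    moreover have "Re (?b M) \<ge> 0"
      using psd by (simp add: pos_semidef_def)
    ultimately show ?thesis using M by (simp add: U_def)
  qed
  have "\<not> eventually (\<lambda>M. cmod (?b M
      - ?t M) \<le> \<delta> * T M) sequentially"
  proof
    assume "eventually (\<lambda>M. cmod (?b M
      - ?t M) \<le> \<delta> * T M) sequentially"
    then have "eventually (\<lambda>M. T M \<le> (1 + a / 8) * U M / real M) sequentially"
      using eventually_gt_at_top[of 0]
    proof eventually_elim
      case (elim M)
      have "\<bar>U M / real M - T M\<bar> \<le> \<delta> * T M"
        using abs_Re_le_cmod[of "?b M
          - ?t M"] elim by (simp add: U_def T_def)
      then have "T M * (1 - \<delta>) \<le> U M / real M" by (simp add: algebra_simps)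
      then have "T M \<le> U M / real M / (1 - \<delta>)" by (simp only: pos_le_divide_eq[OF \<delta>(2)])
      also have "\<dots> = U M / real M * (1 / (1 - \<delta>))" by simp
      also have "\<dots> = (1 + a / 8) * U M / real M" unfolding \<delta>(3) by simp
      finally show ?case .
    qed
    then obtain C where "eventually (\<lambda>M. T M \<le> C * real M powr (1 + a / 2)) sequentially"
      using growth_of_recurrence[where a = a and T = T and U = U, OF a rec U_pos] by blast
    moreover have "eventually (\<lambda>M. T M \<ge> real M powr (1 + a) * L (real M) / (32 * pi)) sequentially"
      unfolding T_def by (rule quad_form_ones_lower_bound[OF f _ L a]) (use pos form in auto)
    ultimately have "eventually (\<lambda>M. real M powr (1 + a) * L (real M) / (32 * pi) \<le> C * real M powr (1 + a / 2)) sequentially"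
      by eventually_elim simp
    moreover have "filterlim (\<lambda>k. 2 ^ k :: nat) at_top sequentially"
      by (rule filterlim_subseq) (simp add: strict_mono_def)
    ultimately have up: "eventually (\<lambda>k. real (2 ^ k) powr (1 + a) * L (real (2 ^ k)) / (32 * pi) \<le> C * real (2 ^ k) powr (1 + a / 2)) sequentially"
      by (rule eventually_compose_filterlim)
    obtain c where c: "c > 0" "eventually (\<lambda>k. L (2 ^ k) \<ge> c * 2 powr (- (a / 4) * real k)) sequentially"
      using slowly_varying_dyadic_lower_bound[OF L, of "a / 4"] a by auto
    have "eventually (\<lambda>k. c / (32 * pi) * 2 powr (a / 4 * real k) \<le> C) sequentially"
      using up c(2)
    proof eventually_elim
      case (elim k)
      have p: "real (2 ^ k) powr s = 2 powr (s * real k)" for s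
        by (simp add: powr_realpow[symmetric] powr_powr mult.commute)
      have "c / (32 * pi) * 2 powr (a / 4 * real k) * 2 powr ((1 + a / 2) * real k) =
          2 powr ((1 + a) * real k) * (c * 2 powr (- (a / 4) * real k)) / (32 * pi)"
      proof -
        have "2 powr (a / 4 * real k) * 2 powr ((1 + a / 2) * real k) = 2 powr ((1 + a) * real k) * 2 powr (- (a / 4) * real k)"
          unfolding powr_add[symmetric] by (simp add: algebra_simps)
        then show ?thesis by simp
      qed
      also have "\<dots> \<le> 2 powr ((1 + a) * real k) * L (2 ^ k) / (32 * pi)"
        using elim(2) by (intro divide_right_mono mult_left_mono) auto
      also have "\<dots> \<le> C * 2 powr ((1 + a / 2) * real k)" using elim(1) unfolding p by simp
      finally show ?case by (rule mult_right_le_imp_le) simp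
    qed
    moreover have "filterlim (\<lambda>k. c / (32 * pi) * 2 powr (a / 4 * real k)) at_top sequentially"
      using c(1) a by real_asymp
    then have "eventually (\<lambda>k. c / (32 * pi) * 2 powr (a / 4 * real k) > C) sequentially"
      by (simp add: filterlim_at_top_dense)
    ultimately have "eventually (\<lambda>k::nat. False) sequentially" by eventually_elim simp
    then show False by simp
  qed
  then show ?thesis using \<delta>(1) unfolding T_def by blast
qed

section \<open>The sample covariance\<close>

lemma mat_adjoint_adjoint: "mat_adjoint (mat_adjoint A) = A" for A :: "complex mat"
proof (rule eq_matI)
  fix i j assume ij: "i < dim_row A" "j < dim_col A"
  have A: "A \<in> carrier_mat (dim_row A) (dim_col A)" by simp
  show "mat_adjoint (mat_adjoint A) $$ (i, j) = A $$ (i, j)"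
    unfolding mat_adjoint_index[OF mat_adjoint_carrier[OF A] ij] mat_adjoint_index[OF A ij(2,1)] by simp
qed auto

lemma quad_form_gram:
  assumes X: "X \<in> carrier_mat n m" and v: "v \<in> carrier_vec m"
  shows "quad_form (mat_adjoint X * X) v = (X *\<^sub>v v) \<bullet>c (X *\<^sub>v v)"
proof -
  have X': "mat_adjoint X \<in> carrier_mat m n" using X by simp
  have Xv: "X *\<^sub>v v \<in> carrier_vec n" using X v by auto
  have "quad_form (mat_adjoint X * X) v = (mat_adjoint X *\<^sub>v (X *\<^sub>v v)) \<bullet>c v"
    using assoc_mult_mat_vec[OF X' X v] by simp
  also have "\<dots> = (X *\<^sub>v v) \<bullet>c (X *\<^sub>v v)"
    using adjoint_cscalar_prod[OF X' Xv v] by (simp add: mat_adjoint_adjoint)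
  finally show ?thesis .
qed

lemma psd_sqrt_cscalar_prod:
  assumes A: "pos_semidef n A" and v: "v \<in> carrier_vec n"
  shows "(psd_sqrt A *\<^sub>v v) \<bullet>c (psd_sqrt A *\<^sub>v v) = quad_form A v"
proof -
  have B: "psd_sqrt A \<in> carrier_mat n n" "mat_adjoint (psd_sqrt A) = psd_sqrt A" "psd_sqrt A * psd_sqrt A = A"
    using psd_sqrt[OF A] by (auto simp: pos_semidef_def)
  have "(psd_sqrt A *\<^sub>v v) \<bullet>c (psd_sqrt A *\<^sub>v v) = quad_form (psd_sqrt A * psd_sqrt A) v"
    using quad_form_gram[OF B(1) v] B(2) by simp
  then show ?thesis using B(3) by simp
qed

lemma quad_form_diag:
  assumes v: "v \<in> carrier_vec n"
  shows "quad_form (mat_diag n (\<lambda>i. complex_of_real (c i))) v = of_real (\<Sum>i<n. c i * (cmod (v $ i))\<^sup>2)"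
proof -
  have D: "mat_diag n (\<lambda>i. complex_of_real (c i)) \<in> carrier_mat n n" by simp
  have "quad_form (mat_diag n (\<lambda>i. complex_of_real (c i))) v =
      (\<Sum>i<n. \<Sum>j<n. if j = i then of_real (c i) * (v $ i * cnj (v $ i)) else 0)"
    unfolding quad_form_sum[OF D v] by (intro sum.cong refl) (auto simp: mat_diag_def)
  also have "\<dots> = (\<Sum>i<n. of_real (c i * (cmod (v $ i))\<^sup>2))"
    by (intro sum.cong refl) (simp add: complex_norm_square del: of_real_power)
  finally show ?thesis by simp
qed

lemma diag_psd:
  assumes "\<And>i. i < n \<Longrightarrow> 0 \<le> c i"
  shows "pos_semidef n (mat_diag n (\<lambda>i. complex_of_real (c i)))"
proof -
  let ?D = "mat_diag n (\<lambda>i. complex_of_real (c i))"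
  have D: "?D \<in> carrier_mat n n" by simp
  have "mat_adjoint ?D = ?D"
    by (rule hermitianI[OF D]) (auto simp: mat_diag_def)
  moreover have "0 \<le> Re (quad_form ?D v)" if "v \<in> carrier_vec n" for v
    unfolding quad_form_diag[OF that] Re_complex_of_real
    using assms by (intro sum_nonneg mult_nonneg_nonneg) auto
  ultimately show ?thesis using D by (simp add: pos_semidef_def)
qed

lemma data_mat_carrier:
  assumes "pos_semidef n C" "pos_semidef M R" "Z \<in> carrier_mat n M"
  shows "data_mat C Z R \<in> carrier_mat n M"
  using psd_sqrt[OF assms(1)] psd_sqrt[OF assms(2)] assms(3)
  by (auto simp: data_mat_def pos_semidef_def intro!: mult_carrier_mat)

lemma biased_estimator_toeplitz_average:
  "X \<in> carrier_mat n M \<Longrightarrow> biased_estimator X = toeplitz_average M (sample_cov X)"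
  by (simp add: biased_estimator_def toeplitz_average_def)

lemma sample_cov_carrier: "X \<in> carrier_mat n M \<Longrightarrow> sample_cov X \<in> carrier_mat M M"
  by (auto simp: sample_cov_def intro!: mult_carrier_mat)

lemma quad_form_sample_cov:
  fixes c :: "nat \<Rightarrow> real"
  assumes c: "\<And>i. i < n \<Longrightarrow> 0 \<le> c i" and R: "pos_semidef M R" and Z: "Z \<in> carrier_mat n M"
    and e: "e \<in> carrier_vec M"
  shows "quad_form (sample_cov (data_mat (mat_diag n (\<lambda>i. complex_of_real (c i))) Z R)) e =
    of_real (\<Sum>i<n. c i / real n * (cmod (\<Sum>j<M. Z $$ (i, j) * (psd_sqrt R *\<^sub>v e) $ j))\<^sup>2)"
proof -
  let ?D = "mat_diag n (\<lambda>i. complex_of_real (c i))"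
  let ?y = "psd_sqrt R *\<^sub>v e"
  have D: "pos_semidef n ?D" by (rule diag_psd) (rule c)
  have BR: "psd_sqrt R \<in> carrier_mat M M" and BD: "psd_sqrt ?D \<in> carrier_mat n n"
    using psd_sqrt[OF R] psd_sqrt[OF D] by (auto simp: pos_semidef_def)
  define X where "X = data_mat ?D Z R"
  have X: "X \<in> carrier_mat n M" unfolding X_def by (rule data_mat_carrier[OF D R Z])
  have y: "?y \<in> carrier_vec M" using BR e by auto
  have Zy: "Z *\<^sub>v ?y \<in> carrier_vec n" using Z y by auto
  have Xe: "X *\<^sub>v e = psd_sqrt ?D *\<^sub>v (Z *\<^sub>v ?y)"
    unfolding X_def data_mat_def
    using assoc_mult_mat_vec[OF mult_carrier_mat[OF BD Z] BR e] assoc_mult_mat_vec[OF BD Z y] by simp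
  have XX: "mat_adjoint X * X \<in> carrier_mat M M" using X by (auto intro!: mult_carrier_mat)
  have "quad_form (sample_cov X) e = 1 / of_nat n * quad_form (mat_adjoint X * X) e"
    unfolding sample_cov_def quad_form_sum[OF smult_carrier_mat[OF XX] e] quad_form_sum[OF XX e]
    using X by (simp add: sum_distrib_left mult.assoc sum_divide_distrib)
  also have "quad_form (mat_adjoint X * X) e = quad_form ?D (Z *\<^sub>v ?y)"
    unfolding quad_form_gram[OF X e] Xe by (rule psd_sqrt_cscalar_prod[OF D Zy])
  also have "\<dots> = of_real (\<Sum>i<n. c i * (cmod ((Z *\<^sub>v ?y) $ i))\<^sup>2)" by (rule quad_form_diag[OF Zy])
  also have "(\<Sum>i<n. c i * (cmod ((Z *\<^sub>v ?y) $ i))\<^sup>2) = (\<Sum>i<n. c i * (cmod (\<Sum>j<M. Z $$ (i, j) * ?y $ j))\<^sup>2)"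
    by (intro sum.cong refl) (simp only: mult_mat_vec_sum[OF Z y] lessThan_iff)
  also have "1 / of_nat n * complex_of_real (\<Sum>i<n. c i * (cmod (\<Sum>j<M. Z $$ (i, j) * ?y $ j))\<^sup>2) =
      of_real (\<Sum>i<n. c i / real n * (cmod (\<Sum>j<M. Z $$ (i, j) * ?y $ j))\<^sup>2)"
  proof -
    have "1 / of_nat n * complex_of_real s = of_real (1 / real n * s)" for s by simp
    then show ?thesis by (simp only: sum_distrib_left) (simp add: mult_ac)
  qed
  finally show ?thesis by (simp only: X_def)
qed

text \<open>At a fixed vector the form of \<open>S\<close>, divided by its mean, is a weighted average of independent
  variables of mean 1 with a common exponential moment.\<close>

lemma periodogram_deviation:
  fixes Z :: "'w \<Rightarrow> complex mat" and c :: "nat \<Rightarrow> real" and \<epsilon> :: real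
  assumes P: "prob_space P" and iid: "iid_rows P n M Z \<mu>" and iso: "isotropic_subexponential M \<mu>"
    and n: "n > 0" and c: "\<And>i. i < n \<Longrightarrow> 0 \<le> c i" "\<And>i. i < n \<Longrightarrow> c i \<le> b" and b: "b > 0"
    and tr: "(\<Sum>i<n. c i) = real n" and sq: "(\<Sum>i<n. (c i)\<^sup>2) \<le> K * real n"
    and R: "pos_semidef M R" and e: "e \<in> carrier_vec M" "quad_form R e \<noteq> 0"
  defines "bad \<equiv> {\<omega> \<in> space P. \<not> cmod (quad_form (sample_cov (data_mat (mat_diag n (\<lambda>i. complex_of_real (c i))) (Z \<omega>) R)) e
      - quad_form R e) \<le> \<epsilon> * Re (quad_form R e)}"
  shows "bad \<in> sets P" and "measure P bad \<le> 2 * exp (4 * K * real n / b\<^sup>2 - \<epsilon> * real n / (32 * b))"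
proof -
  interpret P: prob_space P by (rule P)
  have Z: "Z \<omega> \<in> carrier_mat n M" if "\<omega> \<in> space P" for \<omega> using iid that by (auto simp: iid_rows_def)
  have indep: "P.indep_vars (\<lambda>_. cvec_space M) (row_var M Z) {..<n}"
    and law: "\<And>i. i < n \<Longrightarrow> distr P (cvec_space M) (row_var M Z i) = \<mu>"
    using iid by (auto simp: iid_rows_def)
  have rv: "row_var M Z i \<in> measurable P (cvec_space M)" if "i < n" for i
    using indep that by (auto simp: P.indep_vars_def)
  define \<rho> where "\<rho> = Re (quad_form R e)"
  define y where "y = psd_sqrt R *\<^sub>v e"
  have y: "y \<in> carrier_vec M" using psd_sqrt(1)[OF R] e(1) by (auto simp: y_def pos_semidef_def)
  have qR: "quad_form R e = of_real \<rho>"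
    unfolding \<rho>_def using R e(1) by (intro hermitian_quadratic_form_real) (auto simp: pos_semidef_def)
  have "\<rho> \<ge> 0" using R e(1) by (simp add: \<rho>_def pos_semidef_def)
  moreover have "\<rho> \<noteq> 0" using e(2) qR by auto
  ultimately have \<rho>: "\<rho> > 0" by simp
  have yn: "(\<Sum>j<M. (cmod (y $ j))\<^sup>2) = \<rho>"
  proof -
    have "complex_of_real (\<Sum>j<M. (cmod (y $ j))\<^sup>2) = y \<bullet>c y" using cscalar_prod_self[OF y] by simp
    also have "\<dots> = of_real \<rho>" unfolding y_def psd_sqrt_cscalar_prod[OF R e(1)] qR ..
    finally show ?thesis by (simp only: of_real_eq_iff)
  qed
  define w where "w j = y $ j / of_real (sqrt \<rho>)" for j
  have w: "(\<Sum>j<M. (cmod (w j))\<^sup>2) = 1"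
    using \<rho> yn by (simp add: w_def norm_divide power_divide flip: sum_divide_distrib)
  define \<phi> where "\<phi> z = (cmod (\<Sum>j<M. w j * z j))\<^sup>2" for z :: "nat \<Rightarrow> complex"
  have \<phi>: "\<phi> \<in> borel_measurable (cvec_space M)" unfolding \<phi>_def by measurable
  define Y where "Y i \<omega> = \<phi> (row_var M Z i \<omega>)" for i \<omega>
  have Y_indep: "P.indep_vars (\<lambda>_. borel) Y {..<n}"
    unfolding Y_def by (rule P.indep_vars_compose2[OF indep]) (rule \<phi>)
  have Y_mom: "(\<integral>\<^sup>+\<omega>. ennreal (exp (Y i \<omega> / 16)) \<partial>P) \<le> 2" if i: "i < n" for i
  proof -
    have m: "(\<lambda>z. ennreal (exp (\<phi> z / 16))) \<in> borel_measurable (distr P (cvec_space M) (row_var M Z i))"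
      unfolding measurable_distr_eq1 using \<phi> by measurable
    have "(\<integral>\<^sup>+\<omega>. ennreal (exp (Y i \<omega> / 16)) \<partial>P) = (\<integral>\<^sup>+z. ennreal (exp (\<phi> z / 16)) \<partial>distr P (cvec_space M) (row_var M Z i))"
      unfolding Y_def by (rule nn_integral_distr[OF rv[OF i] m, symmetric])
    also have "\<dots> \<le> 2" using iso w unfolding law[OF i] \<phi>_def isotropic_subexponential_def by simp
    finally show ?thesis .
  qed
  have Y_mean: "P.expectation (Y i) = 1" if i: "i < n" for i
  proof -
    have "P.expectation (Y i) = (\<integral>z. \<phi> z \<partial>distr P (cvec_space M) (row_var M Z i))"
      unfolding Y_def by (rule integral_distr[OF rv[OF i] \<phi>, symmetric])
    also have "\<dots> = 1" unfolding law[OF i] \<phi>_def by (rule isotropic_second_moment[OF iso w])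
    finally show ?thesis .
  qed
  have form: "quad_form (sample_cov (data_mat (mat_diag n (\<lambda>i. complex_of_real (c i))) (Z \<omega>) R)) e =
      of_real (\<rho> * (\<Sum>i<n. c i / real n * Y i \<omega>))" if \<omega>: "\<omega> \<in> space P" for \<omega>
  proof -
    have "(cmod (\<Sum>j<M. Z \<omega> $$ (i, j) * y $ j))\<^sup>2 = \<rho> * Y i \<omega>" for i
    proof -
      have "(\<Sum>j<M. Z \<omega> $$ (i, j) * y $ j) = of_real (sqrt \<rho>) * (\<Sum>j<M. w j * row_var M Z i \<omega> j)"
        unfolding sum_distrib_left using \<rho> by (intro sum.cong refl) (simp add: w_def row_var_def)
      then show ?thesis using \<rho> by (simp add: Y_def \<phi>_def norm_mult power_mult_distrib)
    qed
    then have "(\<Sum>i<n. c i / real n * (cmod (\<Sum>j<M. Z \<omega> $$ (i, j) * y $ j))\<^sup>2) = \<rho> * (\<Sum>i<n. c i / real n * Y i \<omega>)"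
      by (simp only: sum_distrib_left) (simp add: mult_ac)
    moreover have "quad_form (sample_cov (data_mat (mat_diag n (\<lambda>i. complex_of_real (c i))) (Z \<omega>) R)) e =
        of_real (\<Sum>i<n. c i / real n * (cmod (\<Sum>j<M. Z \<omega> $$ (i, j) * y $ j))\<^sup>2)"
      unfolding y_def by (rule quad_form_sample_cov[OF _ R Z[OF \<omega>] e(1)]) (rule c(1))
    ultimately show ?thesis by (simp only:)
  qed
  have bad: "bad = {\<omega> \<in> space P. \<bar>(\<Sum>i<n. c i / real n * Y i \<omega>) - 1\<bar> > \<epsilon>}"
  proof -
    have "cmod (of_real (\<rho> * s) - of_real \<rho>) \<le> \<epsilon> * \<rho> \<longleftrightarrow> \<bar>s - 1\<bar> \<le> \<epsilon>" for s
    proof -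
      have "cmod (of_real (\<rho> * s) - of_real \<rho>) = \<bar>s - 1\<bar> * \<rho>"
      proof -
        have "\<rho> * s - \<rho> = (s - 1) * \<rho>" by (simp add: algebra_simps)
        then show ?thesis using \<rho> by (simp only: of_real_diff[symmetric] norm_of_real abs_mult abs_of_pos)
      qed
      then show ?thesis using \<rho> by simp
    qed
    then show ?thesis unfolding bad_def by (auto simp: form qR simp del: of_real_mult)
  qed
  have Ym: "Y i \<in> borel_measurable P" if "i < n" for i using Y_indep that by (auto simp: P.indep_vars_def)
  have [measurable]: "(\<lambda>\<omega>. \<Sum>i<n. c i / real n * Y i \<omega>) \<in> borel_measurable P"
    using Ym by (intro borel_measurable_sum borel_measurable_times) auto
  show "bad \<in> sets P" unfolding bad by measurable
  have sum_sets: "{\<omega> \<in> space P. \<bar>(\<Sum>i<n. c i / real n * Y i \<omega>) - 1\<bar> \<ge> \<epsilon>} \<in> sets P"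
    by measurable
  have "measure P bad \<le> measure P {\<omega> \<in> space P. \<bar>(\<Sum>i<n. c i / real n * Y i \<omega>) - 1\<bar> \<ge> \<epsilon>}"
    unfolding bad by (intro P.finite_measure_mono sum_sets) auto
  \<comment> \<open>\<open>n / (32 b)\<close> is the largest parameter that weights up to \<open>b / n\<close> allow.\<close>
  also have "\<dots> \<le> 2 * exp (4096 * (real n / (32 * b))\<^sup>2 * (K / real n) - real n / (32 * b) * \<epsilon>)"
  proof (rule P.weighted_sum_concentration[OF Y_indep])
    show "0 \<le> Y i \<omega>" for i \<omega> by (simp add: Y_def \<phi>_def)
    show "(\<Sum>i<n. c i / real n) = 1" using tr n by (simp flip: sum_divide_distrib)
    have "(\<Sum>i<n. (c i / real n)\<^sup>2) = (\<Sum>i<n. (c i)\<^sup>2) / (real n)\<^sup>2"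
      by (simp add: power_divide sum_divide_distrib)
    also have "\<dots> \<le> K * real n / (real n)\<^sup>2" using sq by (intro divide_right_mono) auto
    finally show "(\<Sum>i<n. (c i / real n)\<^sup>2) \<le> K / real n" using n by (simp add: power2_eq_square)
    show "real n / (32 * b) * (c i / real n) \<le> 1 / 32" if "i < n" for i
      using c(2)[OF that] n b by (simp add: field_simps)
  qed (use Y_mom Y_mean c(1) n b in auto)
  also have "4096 * (real n / (32 * b))\<^sup>2 * (K / real n) - real n / (32 * b) * \<epsilon> = 4 * K * real n / b\<^sup>2 - \<epsilon> * real n / (32 * b)"
    using n b by (simp add: power2_eq_square field_simps)
  finally show "measure P bad \<le> 2 * exp (4 * K * real n / b\<^sup>2 - \<epsilon> * real n / (32 * b))" .
qed

section \<open>Comparison of the normalized estimators\<close>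

text \<open>The exponent of \<open>periodogram_deviation\<close> for \<open>b = \<kappa> m\<close> with \<open>m = ln M\<close>. It is at most \<open>-3 ln M\<close>, so each
  failure has probability of order \<open>M\<^sup>-\<^sup>3\<close>, and the union over \<open>2M\<close> grid points remains summable.\<close>

lemma exponent_bound:
  fixes \<epsilon> K \<kappa> n m :: real
  assumes \<epsilon>: "\<epsilon> > 0" and \<kappa>: "\<kappa> > 0" and n: "n > 0" and m: "m \<ge> 1" "\<kappa> * m \<ge> 256 * K / \<epsilon>"
    and nm: "n / m ^ 3 \<ge> 192 * \<kappa> / \<epsilon>"
  shows "4 * K * n / (\<kappa> * m)\<^sup>2 - \<epsilon> * n / (32 * (\<kappa> * m)) \<le> - 3 * m"
proof -
  define b where "b = \<kappa> * m"
  have b: "b > 0" using \<kappa> m(1) by (simp add: b_def)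
  have "4 * K / b \<le> \<epsilon> / 64" using m(2) b \<epsilon> by (simp add: b_def field_simps)
  then have "n / b * (4 * K / b) \<le> n / b * (\<epsilon> / 64)" using n b by (intro mult_left_mono) auto
  then have 1: "4 * K * n / b\<^sup>2 - \<epsilon> * n / (32 * b) \<le> - (\<epsilon> / (64 * \<kappa>) * (n / m))"
    using b \<kappa> m(1) by (simp add: power2_eq_square b_def field_simps)
  have "192 * \<kappa> / \<epsilon> * m ^ 2 \<le> n / m ^ 3 * m ^ 2" using nm by (intro mult_right_mono) auto
  also have "\<dots> = n / m" using m(1) by (simp add: field_simps power2_eq_square power3_eq_cube)
  finally have "\<epsilon> / (64 * \<kappa>) * (192 * \<kappa> / \<epsilon> * m ^ 2) \<le> \<epsilon> / (64 * \<kappa>) * (n / m)"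
    using \<epsilon> \<kappa> by (intro mult_left_mono) auto
  moreover have "\<epsilon> / (64 * \<kappa>) * (192 * \<kappa> / \<epsilon> * m ^ 2) = 3 * m ^ 2" using \<epsilon> \<kappa> by (simp add: field_simps)
  moreover have "m \<le> m ^ 2" using m(1) by (simp add: power2_eq_square)
  ultimately show ?thesis using 1 unfolding b_def by linarith
qed

theorem proposition2p4:
  fixes P :: "'w measure"
    and N :: "nat \<Rightarrow> nat"
    and Z :: "nat \<Rightarrow> 'w \<Rightarrow> complex mat"
    and c :: "nat \<Rightarrow> nat \<Rightarrow> real"
    and f L :: "real \<Rightarrow> real"
    and a K \<kappa> :: real
  defines "C \<equiv> (\<lambda>n. mat_diag n (\<lambda>i. complex_of_real (c n i)))"
    and "R \<equiv> (\<lambda>M. toeplitz M (fourier_coeff f))"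
    and "Rb \<equiv> (\<lambda>M. biased_mat M (fourier_coeff f))"
  defines "Rhat \<equiv> (\<lambda>M \<omega>. biased_estimator (data_mat (C (N M)) (Z M \<omega>) (R M)))"
  assumes P: "prob_space P"
    and N_pos: "\<And>M. M \<ge> 1 \<Longrightarrow> N M \<ge> 1"
    and Z_rows: "\<And>M. M \<ge> 1 \<Longrightarrow> \<exists>\<mu> \<in> row_laws M. iid_rows P (N M) M (Z M) \<mu>"
    and c_nonneg: "\<And>M i. M \<ge> 1 \<Longrightarrow> i < N M \<Longrightarrow> c (N M) i \<ge> 0"
    and K_pos: "K > 0" and \<kappa>_pos: "\<kappa> > 0"
    and C_square: "\<And>M. M \<ge> 1 \<Longrightarrow> Re (mat_trace (C (N M) * C (N M))) / real (N M) \<le> K"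
    \<comment> \<open>the case M = 1, where ln M = 0, would contradict \<open>C_trace\<close>\<close>
    and C_norm: "\<And>M. M \<ge> 2 \<Longrightarrow> spectral_norm (C (N M)) \<le> \<kappa> * ln (real M)"
    and f_L1: "f absolutely_integrable_on {-pi<..<pi}"
    and f_pos: "\<And>x. x \<in> {-pi..pi} - {0} \<Longrightarrow> f x > 0"
    and f_bdd: "\<And>\<delta>. \<delta> > 0 \<Longrightarrow> bounded (f ` ({-pi..pi} - {-\<delta><..<\<delta>}))"
    and f_essinf: "essinf (lebesgue_on {-pi<..<pi}) (\<lambda>x. ereal (f x)) > 0"
    and f_even: "\<And>x. x \<in> {-pi..pi} \<Longrightarrow> f (- x) = f x"
    and a_range: "0 < a" "a < 1"
    and L_slow: "slowly_varying (1 / pi) L"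
    and f_form: "\<And>x. x \<in> {-pi..pi} - {0} \<Longrightarrow> f x = L (1 / \<bar>x\<bar>) / \<bar>x\<bar> powr a"
    and C_trace: "\<And>M. M \<ge> 1 \<Longrightarrow> mat_trace (C (N M)) / of_nat (N M) = 1"
    and N_growth: "filterlim (\<lambda>M. real (N M) / ln (real M) ^ 3) at_top sequentially"
  shows "AE \<omega> in P.
      (\<lambda>M. spectral_norm (inv_sqrt (Rb M) * Rhat M \<omega> * inv_sqrt (Rb M) - 1\<^sub>m M)) \<longlonglongrightarrow> 0 \<and>
      \<not> (\<lambda>M. spectral_norm (inv_sqrt (R M) * Rhat M \<omega> * inv_sqrt (R M) - 1\<^sub>m M)) \<longlonglongrightarrow> 0"
proof -
  interpret P: prob_space P by (rule P)
  have R_psd: "pos_semidef M (R M)" for M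
    unfolding R_def by (rule toeplitz_density_posdef(1)[OF f_L1]) (rule f_pos)
  have R_pos: "quad_form (R M) v \<noteq> 0" if "v \<in> carrier_vec M" "v \<noteq> 0\<^sub>v M" for M v
    unfolding R_def by (rule toeplitz_density_posdef(2)[OF f_L1 _ that]) (rule f_pos)
  have R_carrier: "R M \<in> carrier_mat M M" for M by (simp add: R_def)
  have Rb_psd: "pos_semidef M (Rb M)" if "M > 0" for M
    unfolding Rb_def by (rule biased_mat_posdef(1)[OF f_L1 _ that]) (rule f_pos)
  have Rb_pos: "quad_form (Rb M) v \<noteq> 0" if "M > 0" "v \<in> carrier_vec M" "v \<noteq> 0\<^sub>v M" for M v
    unfolding Rb_def by (rule biased_mat_posdef(2)[OF f_L1 _ that]) (rule f_pos)
  have Rb_avg: "Rb M = toeplitz_average M (R M)" for M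
    by (simp add: Rb_def R_def biased_mat_toeplitz_average)
  define S where "S M \<omega> = sample_cov (data_mat (C (N M)) (Z M \<omega>) (R M))" for M \<omega>
  define e where "e M l = fourier_vec M (grid_point M l)" for M l
  have e_carrier: "e M l \<in> carrier_vec M" for M l by (simp add: e_def)
  have e_nz: "e M l \<noteq> 0\<^sub>v M" if "M > 0" for M l
  proof
    assume "e M l = 0\<^sub>v M"
    then have "e M l $ 0 = 0" using that by simp
    then show False using that by (simp add: e_def fourier_vec_def)
  qed
  have C_psd: "pos_semidef (N M) (C (N M))" if "M \<ge> 1" for M
    unfolding C_def by (rule diag_psd) (rule c_nonneg[OF that])
  have data: "data_mat (C (N M)) (Z M \<omega>) (R M) \<in> carrier_mat (N M) M"
    if M: "M \<ge> 1" and \<omega>: "\<omega> \<in> space P" for M \<omega>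
  proof -
    obtain \<mu> where "iid_rows P (N M) M (Z M) \<mu>" using Z_rows[OF M] by blast
    then have "Z M \<omega> \<in> carrier_mat (N M) M" using \<omega> by (auto simp: iid_rows_def)
    then show ?thesis by (rule data_mat_carrier[OF C_psd[OF M] R_psd])
  qed
  have S_carrier: "S M \<omega> \<in> carrier_mat M M" if "M \<ge> 1" "\<omega> \<in> space P" for M \<omega>
    unfolding S_def by (rule sample_cov_carrier[OF data[OF that]])
  have Rhat_avg: "Rhat M \<omega> = toeplitz_average M (S M \<omega>)" if "M \<ge> 1" "\<omega> \<in> space P" for M \<omega>
    unfolding Rhat_def S_def by (rule biased_estimator_toeplitz_average[OF data[OF that]])

  have tr1: "(\<Sum>i<N M. c (N M) i) = real (N M)" if M: "M \<ge> 1" for M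
  proof -
    have "mat_trace (C (N M)) = complex_of_real (\<Sum>i<N M. c (N M) i)"
      by (simp add: mat_trace_def C_def mat_diag_def)
    then have "complex_of_real (\<Sum>i<N M. c (N M) i) = of_nat (N M)"
      using C_trace[OF M] N_pos[OF M] by simp
    then have "complex_of_real (\<Sum>i<N M. c (N M) i) = complex_of_real (real (N M))" by simp
    then show ?thesis by (simp only: of_real_eq_iff)
  qed
  have tr2: "(\<Sum>i<N M. (c (N M) i)\<^sup>2) \<le> K * real (N M)" if M: "M \<ge> 1" for M
  proof -
    have "C (N M) * C (N M) = mat_diag (N M) (\<lambda>i. complex_of_real ((c (N M) i)\<^sup>2))"
      by (simp add: C_def power2_eq_square)
    then have "Re (mat_trace (C (N M) * C (N M))) = (\<Sum>i<N M. (c (N M) i)\<^sup>2)"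
      by (simp add: mat_trace_def mat_diag_def del: of_real_power)
    then show ?thesis using C_square[OF M] N_pos[OF M] by (simp add: divide_le_eq)
  qed
  have c_le: "c (N M) i \<le> \<kappa> * ln (real M)" if "M \<ge> 2" "i < N M" for M i
  proof -
    have "\<bar>c (N M) i\<bar> \<le> spectral_norm (C (N M))"
      using spectral_norm_diag_ge[OF that(2), of "\<lambda>i. complex_of_real (c (N M) i)"] by (simp add: C_def)
    then show ?thesis using C_norm[OF that(1)] by simp
  qed

  define close where "close \<epsilon> M \<omega> \<longleftrightarrow>
    (\<forall>l<2 * M. cmod (quad_form (S M \<omega>) (e M l) - quad_form (R M) (e M l)) \<le> \<epsilon> * Re (quad_form (R M) (e M l)))"
    for \<epsilon> M \<omega>
  have AE_close: "AE \<omega> in P. eventually (\<lambda>M. close \<epsilon> M \<omega>) sequentially" if \<epsilon>: "\<epsilon> > 0" for \<epsilon>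
  proof -
    define bad where "bad M l = {\<omega> \<in> space P. \<not> cmod (quad_form (S M \<omega>) (e M l) - quad_form (R M) (e M l))
      \<le> \<epsilon> * Re (quad_form (R M) (e M l))}" for M l
    have "eventually (\<lambda>x::real. ln x \<ge> 1) at_top" by real_asymp
    then have "eventually (\<lambda>M. ln (real M) \<ge> 1) sequentially"
      by (rule eventually_compose_filterlim[OF _ filterlim_real_sequentially])
    moreover have "eventually (\<lambda>x::real. \<kappa> * ln x \<ge> 256 * K / \<epsilon>) at_top" using \<kappa>_pos by real_asymp
    then have "eventually (\<lambda>M. \<kappa> * ln (real M) \<ge> 256 * K / \<epsilon>) sequentially"
      by (rule eventually_compose_filterlim[OF _ filterlim_real_sequentially])
    moreover have "eventually (\<lambda>M. real (N M) / ln (real M) ^ 3 \<ge> 192 * \<kappa> / \<epsilon>) sequentially"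
      using N_growth by (simp add: filterlim_at_top)
    ultimately have "eventually (\<lambda>M. M \<ge> 2 \<and> ln (real M) \<ge> 1 \<and> \<kappa> * ln (real M) \<ge> 256 * K / \<epsilon> \<and>
        real (N M) / ln (real M) ^ 3 \<ge> 192 * \<kappa> / \<epsilon>) sequentially"
      using eventually_ge_at_top[of 2] by eventually_elim blast
    then obtain M0 where M0: "\<And>M. M \<ge> M0 \<Longrightarrow> M \<ge> 2 \<and> ln (real M) \<ge> 1 \<and> \<kappa> * ln (real M) \<ge> 256 * K / \<epsilon> \<and>
        real (N M) / ln (real M) ^ 3 \<ge> 192 * \<kappa> / \<epsilon>"
      by (auto simp: eventually_sequentially)
    have bad: "bad M l \<in> sets P \<and> measure P (bad M l) \<le> 2 * real M powr (- 3)" if M: "M \<ge> M0" for M l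
    proof -
      have M2: "M \<ge> 2" "M \<ge> 1" "M > 0" using M0[OF M] by auto
      have Np: "N M > 0" using N_pos[OF M2(2)] by simp
      obtain \<mu> where \<mu>: "\<mu> \<in> row_laws M" "iid_rows P (N M) M (Z M) \<mu>" using Z_rows[OF M2(2)] by blast
      have b: "\<kappa> * ln (real M) > 0" using \<kappa>_pos M2 by simp
      have bad_eq: "bad M l = {\<omega> \<in> space P. \<not> cmod (quad_form (sample_cov (data_mat
          (mat_diag (N M) (\<lambda>i. complex_of_real (c (N M) i))) (Z M \<omega>) (R M))) (e M l)
          - quad_form (R M) (e M l)) \<le> \<epsilon> * Re (quad_form (R M) (e M l))}"
        by (simp only: bad_def S_def C_def)
      note dev = periodogram_deviation[OF P \<mu>(2) row_laws_isotropic[OF \<mu>(1) M2(3)] Np _ _ b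
          tr1[OF M2(2)] tr2[OF M2(2)] R_psd e_carrier R_pos[OF e_carrier e_nz[OF M2(3)]]]
      have bad_sets: "bad M l \<in> sets P"
        unfolding bad_eq by (rule dev(1)) (use c_nonneg c_le M2 in auto)
      have "measure P (bad M l) \<le> 2 * exp (4 * K * real (N M) / (\<kappa> * ln (real M))\<^sup>2 - \<epsilon> * real (N M) / (32 * (\<kappa> * ln (real M))))"
        unfolding bad_eq by (rule dev(2)) (use c_nonneg c_le M2 in auto)
      also have "\<dots> \<le> 2 * exp (- 3 * ln (real M))"
        using exponent_bound[OF \<epsilon> \<kappa>_pos, of "real (N M)" "ln (real M)" K] M0[OF M] Np by simp
      also have "\<dots> = 2 * real M powr (- 3)" using M2 by (simp add: powr_def)
      finally show ?thesis using bad_sets by blast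
    qed
    define A where "A M = (if M \<ge> M0 then \<Union>l<2 * M. bad M l else {})" for M
    have A_sets: "A M \<in> sets P" for M using bad by (auto simp: A_def)
    have A_le: "measure P (A M) \<le> 4 * real M powr (- 2)" for M
    proof (cases "M \<ge> M0")
      case True
      have "measure P (A M) \<le> (\<Sum>l<2 * M. measure P (bad M l))"
        using True bad unfolding A_def by (simp, intro measure_UNION_le) auto
      also have "\<dots> \<le> (\<Sum>l<2 * M. 2 * real M powr (- 3))" by (intro sum_mono) (use bad[OF True] in blast)
      also have "\<dots> = 4 * (real M powr 1 * real M powr (- 3))" using M0[OF True] by simp
      also have "real M powr 1 * real M powr (- 3) = real M powr (- 2)" by (simp only: powr_add[symmetric]) simp
      finally show ?thesis .
    qed (simp add: A_def)
    have "summable (\<lambda>M. 4 * real M powr (- 2))"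
      by (intro summable_mult) (simp add: summable_real_powr_iff)
    then have summ: "summable (\<lambda>M. measure P (A M))"
      by (rule summable_comparison_test'[where N = 0]) (simp add: A_le)
    have "AE \<omega> in P. eventually (\<lambda>M. \<omega> \<in> space P - A M) sequentially"
      by (rule borel_cantelli_AE1[OF A_sets _ summ]) (simp add: P.emeasure_eq_measure)
    then show ?thesis
    proof eventually_elim
      fix \<omega> assume "eventually (\<lambda>M. \<omega> \<in> space P - A M) sequentially"
      then show "eventually (\<lambda>M. close \<epsilon> M \<omega>) sequentially"
        using eventually_ge_at_top[of M0]
        by eventually_elim (auto simp: A_def bad_def close_def)
    qed
  qed
  have "AE \<omega> in P. \<forall>k. eventually (\<lambda>M. close (1 / real (Suc k)) M \<omega>) sequentially"
    by (subst AE_all_countable) (intro allI AE_close, simp)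
  then show ?thesis
    using AE_space
  proof eventually_elim
    fix \<omega> assume ev: "\<forall>k. eventually (\<lambda>M. close (1 / real (Suc k)) M \<omega>) sequentially" and \<omega>: "\<omega> \<in> space P"
    let ?E = "\<lambda>M. spectral_norm (inv_sqrt (Rb M) * Rhat M \<omega> * inv_sqrt (Rb M) - 1\<^sub>m M)"
    let ?F = "\<lambda>M. spectral_norm (inv_sqrt (R M) * Rhat M \<omega> * inv_sqrt (R M) - 1\<^sub>m M)"
    have forms: "cmod (quad_form (Rhat M \<omega>) v - quad_form (Rb M) v) \<le> \<epsilon> * Re (quad_form (Rb M) v)"
      if M: "M \<ge> 1" and cl: "close \<epsilon> M \<omega>" and v: "v \<in> carrier_vec M" for M \<epsilon> v
      unfolding Rhat_avg[OF M \<omega>] Rb_avg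
      by (rule toeplitz_average_form_close[OF S_carrier[OF M \<omega>] R_carrier _ _ v])
        (use M cl in \<open>auto simp: close_def e_def\<close>)
    have Rhat_carrier: "Rhat M \<omega> \<in> carrier_mat M M" if "M \<ge> 1" for M
      unfolding Rhat_avg[OF that \<omega>] by simp
    have "?E \<longlonglongrightarrow> 0"
    proof (rule tendstoI)
      fix r :: real assume r: "r > 0"
      have "eventually (\<lambda>k. sqrt (2 * (1 / real (Suc k))) < r \<and> 1 / real (Suc k) \<le> 1 / 2) sequentially"
      proof (intro eventually_conj)
        have "(\<lambda>k. sqrt (2 * (1 / real (Suc k)))) \<longlonglongrightarrow> 0" by real_asymp
        then show "eventually (\<lambda>k. sqrt (2 * (1 / real (Suc k))) < r) sequentially" using r by (rule order_tendstoD)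
        show "eventually (\<lambda>k. 1 / real (Suc k) \<le> 1 / 2) sequentially" by real_asymp
      qed
      then obtain k where k: "sqrt (2 * (1 / real (Suc k))) < r" "1 / real (Suc k) \<le> 1 / 2"
        by (auto simp: eventually_sequentially)
      show "eventually (\<lambda>M. dist (?E M) 0 < r) sequentially"
        using spec[OF ev, of k] eventually_ge_at_top[of 1]
      proof eventually_elim
        fix M assume cl: "close (1 / real (Suc k)) M \<omega>" and M: "1 \<le> M"
        then have M': "M > 0" by simp
        note nl = normalized_norm_le[OF Rb_psd[OF M'] Rb_pos[OF M'] Rhat_carrier[OF M] _ k(2) forms[OF M cl]]
        have "0 \<le> ?E M"
          by (rule nl(1)) auto
        moreover have "?E M \<le> sqrt (2 * (1 / real (Suc k)))"
          by (rule nl(2)) auto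
        ultimately show "dist (?E M) 0 < r"
          using k(1) by simp
      qed
    qed
    moreover have "\<not> ?F \<longlonglongrightarrow> 0"
    proof
      assume lim: "?F \<longlonglongrightarrow> 0"
      obtain \<delta> where \<delta>: "\<delta> > 0" and far: "\<not> eventually (\<lambda>M. cmod (quad_form (Rb M) (fourier_vec M 0) - quad_form (R M) (fourier_vec M 0))
          \<le> \<delta> * Re (quad_form (R M) (fourier_vec M 0))) sequentially"
        using biased_form_not_close[OF f_L1 f_pos L_slow a_range(1) f_form] unfolding Rb_def R_def by blast
      have "eventually (\<lambda>k. 1 / real (Suc k) < min (1 / 2) (\<delta> / 4)) sequentially"
      proof -
        have "(\<lambda>k. 1 / real (Suc k)) \<longlonglongrightarrow> 0" by real_asymp
        then show ?thesis using \<delta> by (intro order_tendstoD) auto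
      qed
      then obtain k where k: "1 / real (Suc k) < min (1 / 2) (\<delta> / 4)" by (auto simp: eventually_sequentially)
      define \<eta> where "\<eta> = 1 / real (Suc k)"
      have \<eta>: "0 < \<eta>" "\<eta> < 1 / 2" "\<eta> < \<delta> / 4" using k by (auto simp: \<eta>_def)
      have "eventually (\<lambda>M. ?F M < \<delta> / 4) sequentially"
        using order_tendstoD(2)[OF lim, of "\<delta> / 4"] \<delta> by simp
      with spec[OF ev, of k] eventually_ge_at_top[of 1]
      have "eventually (\<lambda>M. cmod (quad_form (Rb M) (fourier_vec M 0) - quad_form (R M) (fourier_vec M 0))
          \<le> \<delta> * Re (quad_form (R M) (fourier_vec M 0))) sequentially"
      proof eventually_elim
        fix M assume cl: "close (1 / real (Suc k)) M \<omega>" and M: "1 \<le> M"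
          and small: "?F M < \<delta> / 4"
        let ?o = "fourier_vec M 0"
        \<comment> \<open>The estimator is close to both matrices at \<open>?o\<close>. In the triangle inequality for \<open>D\<close> the error
          relative to the form of \<open>Rb M\<close> produces the multiple \<open>\<eta> D\<close>, which is absorbed.\<close>
        define T where "T = Re (quad_form (R M) ?o)"
        define D where "D = cmod (quad_form (Rb M) ?o - quad_form (R M) ?o)"
        have T: "T \<ge> 0" using R_psd[of M] by (simp add: T_def pos_semidef_def)
        have "cmod (quad_form (Rhat M \<omega>) ?o - quad_form (R M) ?o) \<le> ?F M * T"
          unfolding T_def by (rule normalized_norm_ge[OF R_psd R_pos Rhat_carrier[OF M]]) auto
        also have "\<dots> \<le> \<delta> / 4 * T" using small T by (intro mult_right_mono) auto
        finally have 1: "cmod (quad_form (Rhat M \<omega>) ?o - quad_form (R M) ?o) \<le> \<delta> / 4 * T" .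
        have "Re (quad_form (Rb M) ?o) \<le> T + D"
          using complex_Re_le_cmod[of "quad_form (Rb M) ?o - quad_form (R M) ?o"] by (simp add: T_def D_def)
        then have "\<eta> * Re (quad_form (Rb M) ?o) \<le> \<eta> * (T + D)" using \<eta>(1) by (intro mult_left_mono) auto
        then have 2: "cmod (quad_form (Rhat M \<omega>) ?o - quad_form (Rb M) ?o) \<le> \<eta> * (T + D)"
          using forms[OF M cl fourier_vec_carrier[of M 0]] unfolding \<eta>_def by linarith
        have "D \<le> cmod (quad_form (Rhat M \<omega>) ?o - quad_form (R M) ?o) + cmod (quad_form (Rhat M \<omega>) ?o - quad_form (Rb M) ?o)"
        proof -
          have "cmod (x - y) \<le> cmod (z - y) + cmod (z - x)" for x y z
            using norm_triangle_ineq4[of "z - y" "z - x"] by simp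
          then show ?thesis unfolding D_def .
        qed
        also have "\<dots> \<le> \<delta> / 4 * T + \<eta> * (T + D)" by (intro add_mono 1 2)
        also have "\<dots> = \<delta> / 4 * T + \<eta> * T + \<eta> * D" by (simp add: algebra_simps)
        also have "\<dots> \<le> \<delta> / 4 * T + \<delta> / 4 * T + 1 / 2 * D"
          using \<eta> T by (intro add_mono mult_right_mono) (auto simp: D_def)
        finally show "D \<le> \<delta> * Re (quad_form (R M) ?o)" by (simp add: T_def[symmetric] field_simps)
      qed
      then show False using far by simp
    qed
    ultimately show "?E \<longlonglongrightarrow> 0 \<and> \<not> ?F \<longlonglongrightarrow> 0" by blast
  qed
qed

end
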